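(* Let $\mathcal M$ be any Riemannian manifold with a closed geodesic curve $C$ and a point $\bar y_1\in C$ such that any locally geodesic curve connecting $\bar y_1$ with itself lies inside $C$. Then minimizers of the spline energy $\mathcal F$ under interpolation constraints do not exist in general; that is, there are $I\in\mathbb N$, $I>2$, times $0\le t_1<\ldots<t_I\le 1$ and points $\bar y_1,\ldots,\bar y_I\in\mathcal M$ such that $\mathcal F$ has no minimizer among the curves $y:[0,1]\to\mathcal M$ of Sobolev class $W^{2,2}$ satisfying $y(t_i)=\bar y_i$ for $i=1,\ldots,I$.
   Context: For a curve $y:[0,1]\to\mathcal M$ on a Riemannian manifold $(\mathcal M,g)$, the spline energy is $\mathcal F[y]=\int_0^1 g_{y(t)}\left(\tfrac{D}{\mathrm dt}\dot y(t),\tfrac{D}{\mathrm dt}\dot y(t)\right)\mathrm dt$, where $\tfrac{D}{\mathrm dt}$ is the (Levi-Civita) covariant derivative along $y$ and a dot denotes differentiation in time. A locally geodesic curve is a curve $y$ with $\tfrac{D}{\mathrm dt}\dot y=0$. A closed geodesic curve is the image of a nonconstant periodic locally geodesic curve $\mathbb R\to\mathcal M$. *)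

theory Defs
  imports "HOL-Analysis.Analysis"
begin

section \<open>Smooth maps\<close>

fun Ck_on :: "nat \<Rightarrow> 'a::real_normed_vector set \<Rightarrow> ('a \<Rightarrow> 'b::real_normed_vector) \<Rightarrow> bool" where
  "Ck_on 0 S f \<longleftrightarrow> continuous_on S f"
| "Ck_on (Suc k) S f \<longleftrightarrow>
     (\<forall>x\<in>S. f differentiable (at x)) \<and> (\<forall>v. Ck_on k S (\<lambda>x. frechet_derivative f (at x) v))"

text \<open>Only meaningful for open \<open>S\<close>, as derivatives are taken with respect to the whole space.\<close>

definition smooth_on :: "'a::real_normed_vector set \<Rightarrow> ('a \<Rightarrow> 'b::real_normed_vector) \<Rightarrow> bool" where
  "smooth_on S f \<longleftrightarrow> (\<forall>k. Ck_on k S f)"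

section \<open>Riemannian manifolds\<close>

text \<open>
  A chart is its domain together with its coordinate map. The model space is a Euclidean space
  \<open>'e\<close>, whose dimension is the dimension of the manifold. The manifold is a subspace \<open>M\<close> of a
  second-countable Hausdorff space, possibly the whole space.
\<close>

type_synonym ('m, 'e) chart = "'m set \<times> ('m \<Rightarrow> 'e)"

abbreviation chart_dom :: "('m, 'e) chart \<Rightarrow> 'm set" where
  "chart_dom c \<equiv> fst c"

abbreviation coord :: "('m, 'e) chart \<Rightarrow> 'm \<Rightarrow> 'e" where
  "coord c \<equiv> snd c"

definition transition :: "('m, 'e) chart \<Rightarrow> ('m, 'e) chart \<Rightarrow> 'e \<Rightarrow> 'e" where
  "transition c d = coord d \<circ> inv_into (chart_dom c) (coord c)"

definition smooth_manifold ::
  "'m::{t2_space, second_countable_topology} set \<Rightarrow> ('m, 'e::euclidean_space) chart set \<Rightarrow> bool" where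
  "smooth_manifold M \<A> \<longleftrightarrow>
     (\<forall>c\<in>\<A>. openin (top_of_set M) (chart_dom c) \<and> open (coord c ` chart_dom c) \<and>
        homeomorphism (chart_dom c) (coord c ` chart_dom c)
          (coord c) (inv_into (chart_dom c) (coord c))) \<and>
     (\<Union>c\<in>\<A>. chart_dom c) = M \<and>
     (\<forall>c\<in>\<A>. \<forall>d\<in>\<A>. smooth_on (coord c ` (chart_dom c \<inter> chart_dom d)) (transition c d))"

text \<open>
  A metric is given by its local representations: \<open>g c x v w\<close> is the inner product, at the point
  with coordinates \<open>x\<close> in the chart \<open>c\<close>, of the tangent vectors with components \<open>v\<close> and \<open>w\<close>.
  The last condition is the transformation law of a covariant 2-tensor.
\<close>

type_synonym ('m, 'e) metric = "('m, 'e) chart \<Rightarrow> 'e \<Rightarrow> 'e \<Rightarrow> 'e \<Rightarrow> real"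

definition riemannian_metric ::
  "('m, 'e::euclidean_space) chart set \<Rightarrow> ('m, 'e) metric \<Rightarrow> bool" where
  "riemannian_metric \<A> g \<longleftrightarrow>
     (\<forall>c\<in>\<A>. \<forall>x \<in> coord c ` chart_dom c.
        bilinear (g c x) \<and> (\<forall>v w. g c x v w = g c x w v) \<and> (\<forall>v. v \<noteq> 0 \<longrightarrow> g c x v v > 0)) \<and>
     (\<forall>c\<in>\<A>. \<forall>v w. smooth_on (coord c ` chart_dom c) (\<lambda>x. g c x v w)) \<and>
     (\<forall>c\<in>\<A>. \<forall>d\<in>\<A>. \<forall>p \<in> chart_dom c \<inter> chart_dom d. \<forall>v w.
        g c (coord c p) v w =
        g d (coord d p) (frechet_derivative (transition c d) (at (coord c p)) v)
                        (frechet_derivative (transition c d) (at (coord c p)) w))"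

definition riemannian_manifold ::
  "'m::{t2_space, second_countable_topology} set \<Rightarrow> ('m, 'e::euclidean_space) chart set
     \<Rightarrow> ('m, 'e) metric \<Rightarrow> bool" where
  "riemannian_manifold M \<A> g \<longleftrightarrow> smooth_manifold M \<A> \<and> riemannian_metric \<A> g"

section \<open>The Levi-Civita covariant derivative along a curve\<close>

text \<open>\<open>metric_deriv g c x z v w\<close> is the derivative of \<open>g c \<cdot> v w\<close> at \<open>x\<close> in direction \<open>z\<close>.\<close>

definition metric_deriv ::
  "('m, 'e::euclidean_space) metric \<Rightarrow> ('m, 'e) chart \<Rightarrow> 'e \<Rightarrow> 'e \<Rightarrow> 'e \<Rightarrow> 'e \<Rightarrow> real" where
  "metric_deriv g c x z v w = frechet_derivative (\<lambda>x. g c x v w) (at x) z"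

text \<open>
  The Christoffel symbols of the Levi-Civita connection, as a vector-valued bilinear map
  \<open>(v, w) \<mapsto> \<Sum>\<^sub>k \<Sum>\<^sub>i \<Sum>\<^sub>j \<Gamma>\<^sup>k\<^sub>i\<^sub>j v\<^sup>i w\<^sup>j e\<^sub>k\<close>; the defining identity is the Koszul formula for
  constant-coefficient (hence commuting) vector fields \<open>v\<close>, \<open>w\<close>, \<open>z\<close>.
\<close>

definition christoffel ::
  "('m, 'e::euclidean_space) metric \<Rightarrow> ('m, 'e) chart \<Rightarrow> 'e \<Rightarrow> 'e \<Rightarrow> 'e \<Rightarrow> 'e" where
  "christoffel g c x v w =
     (THE u. \<forall>z. 2 * g c x u z =
        metric_deriv g c x v w z + metric_deriv g c x w v z - metric_deriv g c x z v w)"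

text \<open>
  The components in \<open>c\<close> of \<open>D/dt X\<close> for a vector field along a curve, in terms of the
  position \<open>x\<close> and the velocity \<open>v\<close> of the curve, the components \<open>X\<close> of the field, and their time
  derivative \<open>dX\<close>, all in the chart \<open>c\<close> and at one time. For \<open>D/dt\<close> of the velocity itself, \<open>X = v\<close>
  and \<open>dX\<close> is the second derivative of the coordinates of the curve.
\<close>

definition cov_deriv ::
  "('m, 'e::euclidean_space) metric \<Rightarrow> ('m, 'e) chart \<Rightarrow> 'e \<Rightarrow> 'e \<Rightarrow> 'e \<Rightarrow> 'e \<Rightarrow> 'e" where
  "cov_deriv g c x v X dX = dX + christoffel g c x v X"

section \<open>Geodesics\<close>

text \<open>
  Since \<open>y\<close> is continuous, it stays in the domain of \<open>c\<close> for times in \<open>J\<close> close to \<open>t\<close>, so the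
  values of \<open>coord c\<close> off the domain do not enter the derivatives.
\<close>

definition locally_geodesic_on ::
  "'m::topological_space set \<Rightarrow> ('m, 'e::euclidean_space) chart set \<Rightarrow> ('m, 'e) metric
     \<Rightarrow> real set \<Rightarrow> (real \<Rightarrow> 'm) \<Rightarrow> bool" where
  "locally_geodesic_on M \<A> g J y \<longleftrightarrow>
     continuous_on J y \<and> y ` J \<subseteq> M \<and>
     (\<forall>c\<in>\<A>. \<exists>v a. \<forall>t\<in>J. y t \<in> chart_dom c \<longrightarrow>
        ((coord c \<circ> y) has_vector_derivative v t) (at t within J) \<and>
        (v has_vector_derivative a t) (at t within J) \<and>
        cov_deriv g c (coord c (y t)) (v t) (v t) (a t) = 0)"

definition closed_geodesic_curve ::
  "'m::topological_space set \<Rightarrow> ('m, 'e::euclidean_space) chart set \<Rightarrow> ('m, 'e) metric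
     \<Rightarrow> 'm set \<Rightarrow> bool" where
  "closed_geodesic_curve M \<A> g C \<longleftrightarrow>
     (\<exists>\<gamma>. locally_geodesic_on M \<A> g UNIV \<gamma> \<and> (\<exists>p>0. \<forall>t. \<gamma> (t + p) = \<gamma> t) \<and>
          \<not> \<gamma> constant_on UNIV \<and> C = range \<gamma>)"

section \<open>Sobolev curves\<close>

definition test_function :: "real \<Rightarrow> real \<Rightarrow> (real \<Rightarrow> real) \<Rightarrow> bool" where
  "test_function a b \<phi> \<longleftrightarrow>
     smooth_on UNIV \<phi> \<and> (\<exists>K. compact K \<and> K \<subseteq> {a<..<b} \<and> (\<forall>t. t \<notin> K \<longrightarrow> \<phi> t = 0))"

definition locally_integrable :: "real \<Rightarrow> real \<Rightarrow> (real \<Rightarrow> 'e::euclidean_space) \<Rightarrow> bool" where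
  "locally_integrable a b u \<longleftrightarrow> (\<forall>r s. a < r \<and> s < b \<longrightarrow> set_integrable lebesgue {r..s} u)"

definition has_weak_derivative ::
  "real \<Rightarrow> real \<Rightarrow> (real \<Rightarrow> 'e::euclidean_space) \<Rightarrow> (real \<Rightarrow> 'e) \<Rightarrow> bool" where
  "has_weak_derivative a b u v \<longleftrightarrow>
     locally_integrable a b u \<and> locally_integrable a b v \<and>
     (\<forall>\<phi>. test_function a b \<phi> \<longrightarrow>
        (LINT t:{a<..<b}|lebesgue. deriv \<phi> t *\<^sub>R u t) = - (LINT t:{a<..<b}|lebesgue. \<phi> t *\<^sub>R v t))"

definition L2_on :: "real \<Rightarrow> real \<Rightarrow> (real \<Rightarrow> 'e::euclidean_space) \<Rightarrow> bool" where
  "L2_on a b u \<longleftrightarrow>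
     set_borel_measurable lebesgue {a<..<b} u \<and>
     set_integrable lebesgue {a<..<b} (\<lambda>t. (norm (u t))\<^sup>2)"

definition W22_on :: "real \<Rightarrow> real \<Rightarrow> (real \<Rightarrow> 'e::euclidean_space) \<Rightarrow> bool" where
  "W22_on a b u \<longleftrightarrow>
     (\<exists>v w. has_weak_derivative a b u v \<and> has_weak_derivative a b v w \<and>
            L2_on a b u \<and> L2_on a b v \<and> L2_on a b w)"

text \<open>
  A \<open>W\<^sup>2\<^sup>,\<^sup>2\<close> curve is represented by its continuous representative, for which point values make
  sense.
\<close>

definition W22_curve ::
  "'m::topological_space set \<Rightarrow> ('m, 'e::euclidean_space) chart set \<Rightarrow> (real \<Rightarrow> 'm) \<Rightarrow> bool" where
  "W22_curve M \<A> y \<longleftrightarrow>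
     continuous_on {0..1} y \<and> y ` {0..1} \<subseteq> M \<and>
     (\<forall>c\<in>\<A>. \<forall>a b. 0 \<le> a \<and> a < b \<and> b \<le> 1 \<and> y ` {a..b} \<subseteq> chart_dom c \<longrightarrow>
        W22_on a b (coord c \<circ> y))"

section \<open>The spline energy\<close>

text \<open>
  \<open>f\<close> is the integrand \<open>g(D/dt y', D/dt y')\<close> of the energy if it is given by the coordinate
  expression almost everywhere on every time interval that \<open>y\<close> spends in a chart. The coordinate
  expressions agree almost everywhere on overlaps, and finitely many such intervals cover
  \<open>[0,1]\<close>, so a \<open>W\<^sup>2\<^sup>,\<^sup>2\<close> curve has an integrand, unique almost everywhere on \<open>[0,1]\<close>.
\<close>

definition spline_integrand ::
  "('m, 'e::euclidean_space) chart set \<Rightarrow> ('m, 'e) metric \<Rightarrow> (real \<Rightarrow> 'm) \<Rightarrow> (real \<Rightarrow> real) \<Rightarrow> bool" where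
  "spline_integrand \<A> g y f \<longleftrightarrow>
     (\<forall>c\<in>\<A>. \<forall>a b. 0 \<le> a \<and> a < b \<and> b \<le> 1 \<and> y ` {a..b} \<subseteq> chart_dom c \<longrightarrow>
        (\<exists>v w. has_weak_derivative a b (coord c \<circ> y) v \<and> has_weak_derivative a b v w \<and>
           (AE t in lebesgue. t \<in> {a<..<b} \<longrightarrow>
              f t = g c (coord c (y t)) (cov_deriv g c (coord c (y t)) (v t) (v t) (w t))
                                        (cov_deriv g c (coord c (y t)) (v t) (v t) (w t)))))"

definition spline_energy ::
  "('m, 'e::euclidean_space) chart set \<Rightarrow> ('m, 'e) metric \<Rightarrow> (real \<Rightarrow> 'm) \<Rightarrow> ennreal" where
  "spline_energy \<A> g y =
     (\<integral>\<^sup>+ t\<in>{0..1}. ennreal ((SOME f. spline_integrand \<A> g y f) t) \<partial>lebesgue)"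

end

theory Submission
  imports Defs
begin

text \<open>
  Minimizers fail to exist because the infimum of the energy is zero, while a curve of energy zero
  is a geodesic and thereby far too rigid to satisfy the constraints.

  Let \<open>\<gamma>\<close> be a periodic geodesic of period \<open>p\<close> with image \<open>C\<close> and \<open>\<gamma> r = y1\<close>. The constraints are
  \<open>y 0 = y 1 = y1\<close> and \<open>y \<theta> = \<gamma> \<sigma>\<close> for an irrational \<open>\<theta>\<close> in \<open>(0,1)\<close>. A curve \<open>\<gamma> \<circ> \<phi>\<close> satisfies them
  if \<open>\<phi> 0 = r\<close>, \<open>\<phi> 1 = r + k p\<close> and \<open>\<phi> \<theta> = \<sigma> + m p\<close> with integers \<open>k\<close>, \<open>m\<close>. As \<open>\<gamma>\<close> does not
  accelerate, the acceleration of \<open>\<gamma> \<circ> \<phi>\<close> is \<open>\<phi>''\<close> times the velocity of \<open>\<gamma>\<close>, whose length is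
  constant. Let \<open>\<phi>\<close> be the affine function with the right end values plus a multiple of \<open>t (1 - t)\<close>
  that corrects its value at \<open>\<theta>\<close>. Then the energy is proportional to the square of the defect
  \<open>\<sigma> + m p - r - k p \<theta>\<close>, which Kronecker's theorem makes as small as desired
  (\<open>geodesic_loops_small_energy\<close>).

  A minimizer would therefore have energy zero. Such a curve is locally geodesic
  (\<open>zero_energy_imp_geodesic\<close>), so by hypothesis it runs inside \<open>C\<close>, and then it is an affine
  reparametrization of \<open>\<gamma>\<close> (\<open>geodesic_inside_curve\<close>). Its value at \<open>\<theta>\<close> is \<open>\<gamma> (s + (s' - s) \<theta>)\<close> for
  two parameters \<open>s\<close>, \<open>s'\<close> at which \<open>\<gamma>\<close> passes through \<open>y1\<close>. There are only countably many such
  parameters, because the fibres of \<open>\<gamma>\<close> are countable (\<open>geodesic_fibre_countable\<close>), so \<open>\<sigma>\<close> can be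
  chosen such that \<open>\<gamma> \<sigma>\<close> is none of these values.

  Two layers support this argument. In one variable, a function with an integrable weak derivative is
  an indefinite integral (\<open>weak_derivative_imp_primitive\<close>), which turns \<open>W\<^sup>2\<^sup>,\<^sup>2\<close> curves into \<open>C\<^sup>1\<close>
  curves with absolutely continuous velocity and gives the regularity of curves of energy zero. On
  the manifold, the transformation law of the Christoffel symbols (\<open>christoffel_transform\<close>) shows
  that the coordinate expressions of the energy density agree on overlapping charts, so that every
  \<open>W\<^sup>2\<^sup>,\<^sup>2\<close> curve has an integrand; without one, the energy would be an unspecified value. Local
  Lipschitz continuity of the Christoffel symbols (\<open>christoffel_lipschitz\<close>) gives the uniqueness of
  geodesics.
\<close>

section \<open>Smooth test functions on the line\<close>

lemma Ck_on_cmult: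
  fixes f :: "'a::real_normed_vector \<Rightarrow> real"
  assumes "Ck_on k UNIV f"
  shows "Ck_on k UNIV (\<lambda>x. c * f x)"
  using assms
proof (induction k arbitrary: f)
  case 0
  then show ?case by (auto intro!: continuous_intros)
next
  case (Suc k)
  have "frechet_derivative (\<lambda>x. c * f x) (at x) v = c * frechet_derivative f (at x) v" for x v
  proof -
    have "(f has_derivative frechet_derivative f (at x)) (at x)"
      using Suc.prems frechet_derivative_works by auto
    from has_derivative_mult_right[OF this, of c] show ?thesis
      by (metis frechet_derivative_at)
  qed
  then show ?case using Suc by (auto intro!: derivative_intros)
qed

text \<open>
  For functions on the line, one derivative function in place of all directional derivatives.
\<close>

lemma Ck_on_UNIV_SucI:
  fixes f :: "real \<Rightarrow> real"
  assumes "\<And>x. (f has_real_derivative f' x) (at x)" "Ck_on k UNIV f'"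
  shows "Ck_on (Suc k) UNIV f"
proof -
  have "frechet_derivative f (at x) v = v * f' x" for x v
  proof -
    have "(f has_derivative (\<lambda>h. h * f' x)) (at x)"
      using assms(1)[of x] by (simp add: has_field_derivative_def mult_commute_abs)
    then show ?thesis by (metis frechet_derivative_at)
  qed
  moreover have "f differentiable (at x)" for x
    using assms(1) real_differentiable_def by blast
  ultimately show ?thesis
    using Ck_on_cmult[OF assms(2)] by (simp add: mult.commute)
qed

lemma Ck_on_UNIV_SucD:
  fixes f :: "real \<Rightarrow> real"
  assumes "Ck_on (Suc k) UNIV f"
  shows "(f has_real_derivative deriv f x) (at x)" "Ck_on k UNIV (deriv f)"
proof -
  have d: "(f has_real_derivative deriv f x) (at x)" for x
    using assms by (auto simp: DERIV_deriv_iff_real_differentiable)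
  show "(f has_real_derivative deriv f x) (at x)" by (rule d)
  have "frechet_derivative f (at x) 1 = deriv f x" for x
    using frechet_derivative_at[OF d[of x, unfolded has_field_derivative_def]] by (metis mult.right_neutral)
  then show "Ck_on k UNIV (deriv f)"
    using assms[unfolded Ck_on.simps, THEN conjunct2, rule_format, of 1] by simp
qed

lemma Ck_on_Suc_imp: "Ck_on (Suc k) S f \<Longrightarrow> Ck_on k S f"
proof (induction k arbitrary: f)
  case 0
  then show ?case
    by (auto intro!: continuous_at_imp_continuous_on differentiable_imp_continuous_within)
qed simp

lemma Ck_on_mono: "k \<le> l \<Longrightarrow> Ck_on l S f \<Longrightarrow> Ck_on k S f"
  by (induction rule: dec_induct) (auto dest: Ck_on_Suc_imp simp del: Ck_on.simps)

lemma Ck_on_add_real: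
  fixes f h :: "real \<Rightarrow> real"
  assumes "Ck_on k UNIV f" "Ck_on k UNIV h"
  shows "Ck_on k UNIV (\<lambda>x. f x + h x)"
  using assms
proof (induction k arbitrary: f h)
  case 0
  then show ?case by (auto intro!: continuous_intros)
next
  case (Suc k)
  note D = Ck_on_UNIV_SucD[OF Suc.prems(1)] Ck_on_UNIV_SucD[OF Suc.prems(2)]
  show ?case
    by (rule Ck_on_UNIV_SucI[where f' = "\<lambda>x. deriv f x + deriv h x"])
       (rule DERIV_add D Suc.IH)+
qed

lemma Ck_on_mult_real:
  fixes f h :: "real \<Rightarrow> real"
  assumes "Ck_on k UNIV f" "Ck_on k UNIV h"
  shows "Ck_on k UNIV (\<lambda>x. f x * h x)"
  using assms
proof (induction k arbitrary: f h)
  case 0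
  then show ?case by (auto intro!: continuous_intros)
next
  case (Suc k)
  note D = Ck_on_UNIV_SucD[OF Suc.prems(1)] Ck_on_UNIV_SucD[OF Suc.prems(2)]
  show ?case
  proof (rule Ck_on_UNIV_SucI)
    show "((\<lambda>x. f x * h x) has_real_derivative deriv f x * h x + deriv h x * f x) (at x)" for x
      by (rule DERIV_mult D)+
    show "Ck_on k UNIV (\<lambda>x. deriv f x * h x + deriv h x * f x)"
      by (intro Ck_on_add_real Suc.IH D Suc.prems[THEN Ck_on_Suc_imp])
  qed
qed

lemma Ck_on_affine_real:
  fixes f :: "real \<Rightarrow> real"
  assumes "Ck_on k UNIV f"
  shows "Ck_on k UNIV (\<lambda>x. f (c * x + d))"
  using assms
proof (induction k arbitrary: f)
  case 0
  then show ?case by (auto intro!: continuous_on_compose2[of UNIV f] continuous_intros)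
next
  case (Suc k)
  note D = Ck_on_UNIV_SucD[OF Suc.prems(1)]
  show ?case
  proof (rule Ck_on_UNIV_SucI)
    show "((\<lambda>x. f (c * x + d)) has_real_derivative c * deriv f (c * x + d)) (at x)" for x
    proof -
      have "((\<lambda>x. c * x + d) has_real_derivative c) (at x)"
        by (auto intro!: derivative_eq_intros)
      from DERIV_chain2[OF D(1) this] show ?thesis by (simp only: mult.commute)
    qed
    show "Ck_on k UNIV (\<lambda>x. c * deriv f (c * x + d))"
      by (intro Ck_on_cmult Suc.IH D(2))
  qed
qed

text \<open>
  The functions \<open>P (1/x) exp (- 1/x)\<close>, extended by zero to \<open>x \<le> 0\<close>. Admitting all polynomials \<open>P\<close> makes
  the family closed under differentiation, so that smoothness follows by induction on the order.
\<close>

definition flat_exp :: "real poly \<Rightarrow> real \<Rightarrow> real" where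
  "flat_exp P x = (if x > 0 then poly P (1 / x) * exp (- (1 / x)) else 0)"

lemma poly_exp_tendsto_0: "((\<lambda>y::real. poly P y * exp (- y)) \<longlongrightarrow> 0) at_top"
proof -
  have *: "((\<lambda>y::real. y ^ k / exp y) \<longlongrightarrow> 0) at_top" for k
    by (rule tendsto_power_div_exp_0)
  have "((\<lambda>y::real. (\<Sum>i\<le>degree P. coeff P i * (y ^ i / exp y))) \<longlongrightarrow> (\<Sum>i\<le>degree P. coeff P i * 0)) at_top"
    by (intro tendsto_intros *)
  then show ?thesis
    by (simp add: poly_altdef sum_distrib_right exp_minus divide_inverse mult.assoc)
qed

lemma flat_exp_deriv:
  "(flat_exp P has_real_derivative flat_exp (monom 1 2 * (P - pderiv P)) x) (at x)"
proof (cases "x = 0")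
  case False
  show ?thesis
  proof (cases "x > 0")
    case True
    have "((\<lambda>x. poly P (1 / x) * exp (- (1 / x))) has_real_derivative
        flat_exp (monom 1 2 * (P - pderiv P)) x) (at x)"
      using True by (auto intro!: derivative_eq_intros DERIV_chain2[OF poly_DERIV]
          simp: flat_exp_def poly_monom field_simps power2_eq_square)
    moreover have "eventually (\<lambda>t. t > 0) (nhds x)"
      using True by (intro eventually_nhds_in_open[of "{0<..}" x, simplified]) auto
    ultimately show ?thesis
      by (subst DERIV_cong_ev[OF refl _ refl]) (auto simp: flat_exp_def elim!: eventually_mono)
  next
    case x: False
    have "((\<lambda>_. 0) has_real_derivative 0) (at x)" by simp
    moreover have "eventually (\<lambda>t. t < 0) (nhds x)"
      using x \<open>x \<noteq> 0\<close> by (intro eventually_nhds_in_open[of "{..<0}" x, simplified]) auto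
    ultimately show ?thesis using x
      by (subst DERIV_cong_ev[OF refl _ refl, of _ "\<lambda>_. 0"]) (auto simp: flat_exp_def elim!: eventually_mono)
  qed
next
  case True
  have "((\<lambda>y. (flat_exp P y - flat_exp P 0) / (y - 0)) \<longlongrightarrow> 0) (at 0)"
  proof (subst filterlim_at_split, intro conjI)
    show "((\<lambda>y. (flat_exp P y - flat_exp P 0) / (y - 0)) \<longlongrightarrow> 0) (at_left 0)"
      by (rule Lim_transform_eventually[of "\<lambda>_. 0"])
         (auto simp: flat_exp_def eventually_at_filter)
    have "((\<lambda>y. poly (pCons 0 P) (inverse y) * exp (- inverse y)) \<longlongrightarrow> 0) (at_right (0::real))"
      by (rule filterlim_compose[OF poly_exp_tendsto_0 filterlim_inverse_at_top_right])
    then show "((\<lambda>y. (flat_exp P y - flat_exp P 0) / (y - 0)) \<longlongrightarrow> 0) (at_right 0)"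
      by (rule Lim_transform_eventually)
         (auto simp: flat_exp_def eventually_at_filter field_simps)
  qed
  then show ?thesis
    using True by (simp add: has_field_derivative_iff flat_exp_def)
qed

lemma Ck_on_flat_exp: "Ck_on k UNIV (flat_exp P)"
proof (induction k arbitrary: P)
  case 0
  show ?case using flat_exp_deriv by (auto intro!: DERIV_continuous_on)
next
  case (Suc k)
  then show ?case by (intro Ck_on_UNIV_SucI[OF flat_exp_deriv])
qed

text \<open>
  A smooth function supported in \<open>[r,s]\<close>; for large \<open>n\<close> both factors are close to 1 at interior points,
  so these functions approximate the indicator of \<open>(r,s)\<close>.
\<close>

definition plateau :: "real \<Rightarrow> real \<Rightarrow> nat \<Rightarrow> real \<Rightarrow> real" where
  "plateau r s n t = flat_exp 1 (real n * (t - r)) * flat_exp 1 (real n * (s - t))"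

lemma test_function_plateau:
  assumes "a < r" "s < b"
  shows "test_function a b (plateau r s n)"
proof -
  have "Ck_on k UNIV (\<lambda>t. flat_exp 1 (real n * t + (- real n * r)) * flat_exp 1 ((- real n) * t + real n * s))" for k
    by (intro Ck_on_mult_real Ck_on_affine_real Ck_on_flat_exp)
  moreover have "(\<lambda>t. flat_exp 1 (real n * t + (- real n * r)) * flat_exp 1 ((- real n) * t + real n * s)) = plateau r s n"
    by (auto simp: plateau_def algebra_simps)
  ultimately have "smooth_on UNIV (plateau r s n)" by (simp add: smooth_on_def)
  moreover have "\<forall>t. t \<notin> {r..s} \<longrightarrow> plateau r s n t = 0"
    by (auto simp: plateau_def flat_exp_def zero_less_mult_iff)
  ultimately show ?thesis
    unfolding test_function_def using assms by (intro conjI exI[of _ "{r..s}"]) auto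
qed

lemma plateau_bounds: "0 \<le> plateau r s n t" "plateau r s n t \<le> 1"
  by (auto simp: plateau_def flat_exp_def intro!: mult_le_one)

lemma plateau_tendsto: "(\<lambda>n. plateau r s n t) \<longlonglongrightarrow> indicator {r<..<s} t"
proof -
  have *: "(\<lambda>n. flat_exp 1 (real n * x)) \<longlonglongrightarrow> (if x > 0 then 1 else 0)" for x
  proof (cases "x > 0")
    case True
    have "(\<lambda>n. exp (- (inverse x * inverse (real n)))) \<longlonglongrightarrow> exp (- (inverse x * 0))"
      by (intro tendsto_intros lim_inverse_n)
    then have "(\<lambda>n. exp (- (inverse x * inverse (real n)))) \<longlonglongrightarrow> 1" by simp
    moreover have "eventually (\<lambda>n. exp (- (inverse x * inverse (real n))) = flat_exp 1 (real n * x)) sequentially"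
      using eventually_gt_at_top[of 0] by eventually_elim (use True in \<open>auto simp: flat_exp_def field_simps\<close>)
    ultimately show ?thesis using True by (simp add: Lim_transform_eventually)
  next
    case False
    then have "flat_exp 1 (real n * x) = 0" for n by (auto simp: flat_exp_def zero_less_mult_iff)
    then show ?thesis using False by simp
  qed
  have "(\<lambda>n. plateau r s n t) \<longlonglongrightarrow> (if t - r > 0 then 1 else 0) * (if s - t > 0 then 1 else 0)"
    unfolding plateau_def by (intro tendsto_mult *)
  then show ?thesis by (auto simp: indicator_def split: if_splits)
qed

section \<open>Weak derivatives in one variable\<close>

text \<open>
  \<open>V\<close> is absolutely continuous on \<open>[a,b]\<close> with derivative \<open>w\<close>. The integral form avoids any statement on
  pointwise differentiability, which would hold only almost everywhere.
\<close>

definition primitive_on :: "real \<Rightarrow> real \<Rightarrow> (real \<Rightarrow> 'b::euclidean_space) \<Rightarrow> (real \<Rightarrow> 'b) \<Rightarrow> bool" where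
  "primitive_on a b V w \<longleftrightarrow>
     w absolutely_integrable_on {a..b} \<and> (\<forall>t\<in>{a..b}. (w has_integral (V t - V a)) {a..t})"

lemma primitive_on_diff:
  assumes "primitive_on a b V w" "a \<le> s" "s \<le> t" "t \<le> b"
  shows "(w has_integral (V t - V s)) {s..t}"
proof -
  have 1: "(w has_integral (V t - V a)) {a..t}" "(w has_integral (V s - V a)) {a..s}"
    using assms by (auto simp: primitive_on_def)
  have "w integrable_on {s..t}"
    using 1(1) assms by (meson atLeastatMost_subset_iff has_integral_integrable integrable_subinterval_real order_refl)
  then obtain i where i: "(w has_integral i) {s..t}" by blast
  have "(w has_integral (V s - V a) + i) {a..t}"
    by (rule has_integral_combine[OF _ _ 1(2) i]) (use assms in auto)
  then have "V s - V a + i = V t - V a" using 1(1) has_integral_unique by blast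
  then have "i = V t - V s" by (simp add: algebra_simps)
  then show ?thesis using i by simp
qed

lemma primitive_on_subinterval:
  assumes "primitive_on a b V w" "a \<le> c" "c \<le> d" "d \<le> b"
  shows "primitive_on c d V w"
  unfolding primitive_on_def
  using assms primitive_on_diff[OF assms(1)]
  by (auto simp: primitive_on_def intro: set_integrable_subset)

lemma primitive_on_continuous:
  assumes "primitive_on a b V w"
  shows "continuous_on {a..b} V"
proof -
  have "w integrable_on {a..b}"
    using assms by (auto simp: primitive_on_def set_lebesgue_integral_eq_integral(1))
  then have "continuous_on {a..b} (\<lambda>x. V a + integral {a..x} w)"
    by (intro continuous_intros indefinite_integral_continuous_1)
  moreover have "V a + integral {a..x} w = V x" if "x \<in> {a..b}" for x
    using assms that by (auto simp: primitive_on_def dest!: bspec[where x=x] dest: integral_unique)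
  ultimately show ?thesis by (subst continuous_on_cong[OF refl, symmetric])
qed

lemma primitive_on_integral:
  assumes "w absolutely_integrable_on {a..b}"
  shows "primitive_on a b (\<lambda>t. k + integral {a..t} w) w"
  unfolding primitive_on_def
proof (intro conjI ballI assms)
  fix t assume t: "t \<in> {a..b}"
  have "w integrable_on {a..t}"
    by (rule integrable_subinterval_real[of _ a b])
       (use t set_lebesgue_integral_eq_integral(1)[OF assms] in auto)
  then show "(w has_integral k + integral {a..t} w - (k + integral {a..a} w)) {a..t}"
    by (simp add: integrable_integral)
qed

lemma primitive_on_C1:
  fixes F :: "real \<Rightarrow> 'b::euclidean_space"
  assumes "\<And>t. t \<in> {a..b} \<Longrightarrow> (F has_vector_derivative f t) (at t within {a..b})" "continuous_on {a..b} f"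
  shows "primitive_on a b F f"
  unfolding primitive_on_def
proof (intro conjI ballI)
  show "f absolutely_integrable_on {a..b}"
    by (rule absolutely_integrable_continuous_real) (rule assms)
  fix t assume t: "t \<in> {a..b}"
  show "(f has_integral F t - F a) {a..t}"
    by (rule fundamental_theorem_of_calculus)
       (use t in \<open>auto intro!: has_vector_derivative_within_subset[OF assms(1)]\<close>)
qed

lemma primitive_on_has_vector_derivative:
  assumes "primitive_on a b F f" "continuous_on {a..b} f" "t \<in> {a..b}"
  shows "(F has_vector_derivative f t) (at t within {a..b})"
proof -
  have "((\<lambda>u. F a + integral {a..u} f) has_vector_derivative f t) (at t within {a..b})"
    using integral_has_vector_derivative[OF assms(2,3)]
    by (auto intro!: derivative_eq_intros)
  moreover have "F u = F a + integral {a..u} f" if "u \<in> {a..b}" for u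
    using assms(1) that by (auto simp: primitive_on_def dest!: bspec[where x=u] dest: integral_unique)
  ultimately show ?thesis
    by (rule has_vector_derivative_transform[OF assms(3), rotated])
qed

text \<open>
  The product rule for a \<open>C\<^sup>1\<close> factor and an absolutely continuous factor. Let \<open>W\<close> be the difference of the
  product and the integral of its expected derivative, and let \<open>m\<close> be the indefinite integral of
  \<open>norm w\<close>. Then \<open>norm (W t - W s) \<le> 2 K L (t - s) (m t - m s)\<close>, and since \<open>m\<close> is continuous, the derivative
  of \<open>W\<close> is zero everywhere.
\<close>

lemma primitive_on_product:
  fixes prod :: "'a::euclidean_space \<Rightarrow> 'b::euclidean_space \<Rightarrow> 'c::euclidean_space"
  assumes prod: "bounded_bilinear prod"
    and F: "\<And>t. t \<in> {a..b} \<Longrightarrow> (F has_vector_derivative f t) (at t within {a..b})"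
    and f: "continuous_on {a..b} f"
    and V: "primitive_on a b V w"
  shows "primitive_on a b (\<lambda>t. prod (F t) (V t)) (\<lambda>t. prod (f t) (V t) + prod (F t) (w t))"
proof -
  interpret bounded_bilinear prod by (rule prod)
  have cV: "continuous_on {a..b} V" by (rule primitive_on_continuous[OF V])
  have cF: "continuous_on {a..b} F"
    using F by (intro continuous_on_vector_derivative) auto
  have w: "w absolutely_integrable_on {a..b}" using V by (simp add: primitive_on_def)
  have ai: "(\<lambda>t. prod (f t) (V t)) absolutely_integrable_on {a..b}"
    by (intro absolutely_integrable_continuous_real continuous_on f cV)
  have ai2: "(\<lambda>t. prod (F t) (w t)) absolutely_integrable_on {a..b}"
  proof (rule absolutely_integrable_bounded_measurable_product[where h = prod and f = F, OF _ _ _ _ w])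
    show "bilinear prod" by (rule bilinear_conv_bounded_bilinear[THEN iffD2, OF prod])
    show "F \<in> borel_measurable (lebesgue_on {a..b})"
      by (rule continuous_imp_measurable_on_sets_lebesgue[OF cF]) auto
    show "bounded (F ` {a..b})" by (intro compact_imp_bounded compact_continuous_image cF) auto
  qed auto
  define q where "q = (\<lambda>t. prod (f t) (V t) + prod (F t) (w t))"
  have q: "q absolutely_integrable_on {a..b}" unfolding q_def by (intro set_integral_add ai ai2)
  define W where "W = (\<lambda>t. prod (F t) (V t) - integral {a..t} q)"
  define m where "m = (\<lambda>t. integral {a..t} (\<lambda>x. norm (w x)))"
  have nw: "(\<lambda>x. norm (w x)) absolutely_integrable_on {a..b}" by (intro set_integrable_norm w)
  have m: "primitive_on a b m (\<lambda>x. norm (w x))"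
    using primitive_on_integral[OF nw, of 0] by (simp add: m_def)
  have Q: "primitive_on a b (\<lambda>t. integral {a..t} q) q"
    using primitive_on_integral[OF q, of 0] by simp
  have FP: "primitive_on a b F f" by (rule primitive_on_C1[OF F f])
  obtain L where L: "\<And>t. t \<in> {a..b} \<Longrightarrow> norm (f t) \<le> L" "L \<ge> 0"
  proof -
    have "bounded (f ` {a..b})" by (intro compact_imp_bounded compact_continuous_image f) auto
    then obtain L where "\<forall>x\<in>f ` {a..b}. norm x \<le> L" by (auto simp: bounded_iff)
    then show thesis by (intro that[of "max L 0"]) (auto intro: max.coboundedI1)
  qed
  obtain K where K: "\<And>x y. norm (prod x y) \<le> norm x * norm y * K" "K \<ge> 0"
    using nonneg_bounded by blast
  have key: "norm (W t - W s) \<le> (2 * K * L * (t - s)) * (m t - m s)" if st: "a \<le> s" "s \<le> t" "t \<le> b" for s t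
  proof -
    have 1: "(w has_integral V t - V s) {s..t}" by (rule primitive_on_diff[OF V st])
    have 2: "(f has_integral F t - F s) {s..t}" by (rule primitive_on_diff[OF FP st])
    have 3: "(q has_integral integral {a..t} q - integral {a..s} q) {s..t}" by (rule primitive_on_diff[OF Q st])
    have 4: "((\<lambda>x. norm (w x)) has_integral m t - m s) {s..t}" by (rule primitive_on_diff[OF m st])
    have Flip: "norm (F t - F x) \<le> L * (t - s)" if "x \<in> {s..t}" for x
    proof -
      have "norm (F t - F x) \<le> L * norm (t - x)"
        by (rule differentiable_bound[of "{a..b}" F "\<lambda>t h. h *\<^sub>R f t"])
           (use F L st that in \<open>auto simp: has_vector_derivative_def intro!: onorm_le simp: mult.commute[of L] mult_left_mono\<close>)
      also have "\<dots> \<le> L * (t - s)" using that L by (auto intro: mult_left_mono)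
      finally show ?thesis .
    qed
    have Vlip: "norm (V s - V x) \<le> m t - m s" if "x \<in> {s..t}" for x
    proof -
      have x: "s \<le> x" "x \<le> t" using that by auto
      have i: "(w has_integral V x - V s) {s..x}" "((\<lambda>x. norm (w x)) has_integral m x - m s) {s..x}"
        "((\<lambda>x. norm (w x)) has_integral m t - m x) {x..t}"
        using x st primitive_on_diff[OF V, of s x] primitive_on_diff[OF m] by auto
      have "norm (V x - V s) \<le> m x - m s"
        using integral_norm_bound_integral[of w "{s..x}" "\<lambda>x. norm (w x)"] i
        by (auto simp: integral_unique[OF i(1)] integral_unique[OF i(2)])
      also have "\<dots> \<le> m t - m s"
        using has_integral_nonneg[OF i(3)] by simp
      finally show ?thesis by (simp add: norm_minus_commute)
    qed
    have *: "((\<lambda>x. prod (F t) (w x) + prod (f x) (V s) - q x) has_integral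
       prod (F t) (V t - V s) + prod (F t - F s) (V s) - (integral {a..t} q - integral {a..s} q)) {s..t}"
      using has_integral_linear[OF 1 bounded_linear_right[of "F t"]] has_integral_linear[OF 2 bounded_linear_left[of "V s"]]
      by (intro has_integral_diff has_integral_add 3) (simp_all add: o_def)
    have e1: "prod (F t) (V t - V s) + prod (F t - F s) (V s) - (integral {a..t} q - integral {a..s} q) = W t - W s"
      by (simp add: W_def diff_left diff_right)
    have e2: "prod (F t) (w x) + prod (f x) (V s) - q x = prod (F t - F x) (w x) + prod (f x) (V s - V x)" for x
      by (simp add: q_def diff_left diff_right)
    have I: "((\<lambda>x. prod (F t - F x) (w x) + prod (f x) (V s - V x)) has_integral (W t - W s)) {s..t}"
      using * unfolding e1 e2 .
    have J: "((\<lambda>x. K * L * (t - s) * norm (w x) + K * L * (m t - m s)) has_integral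
        K * L * (t - s) * (m t - m s) + (t - s) *\<^sub>R (K * L * (m t - m s))) {s..t}"
      using has_integral_const_real[of "K * L * (m t - m s)" s t] st
      by (intro has_integral_add has_integral_mult_right 4) simp
    have "norm (W t - W s) \<le> K * L * (t - s) * (m t - m s) + (t - s) *\<^sub>R (K * L * (m t - m s))"
    proof -
      have "norm (integral {s..t} (\<lambda>x. prod (F t - F x) (w x) + prod (f x) (V s - V x))) \<le> integral {s..t} (\<lambda>x. K * L * (t - s) * norm (w x) + K * L * (m t - m s))"
      proof (rule integral_norm_bound_integral)
        fix x assume x: "x \<in> {s..t}"
        have "norm (prod (F t - F x) (w x)) \<le> (L * (t - s)) * norm (w x) * K"
          by (rule order.trans[OF K(1)]) (intro mult_right_mono Flip x K norm_ge_zero)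
        moreover have "norm (prod (f x) (V s - V x)) \<le> L * (m t - m s) * K"
          by (rule order.trans[OF K(1)]) (use x st in \<open>intro mult_right_mono mult_mono Vlip L K norm_ge_zero; auto\<close>)
        ultimately show "norm (prod (F t - F x) (w x) + prod (f x) (V s - V x)) \<le> K * L * (t - s) * norm (w x) + K * L * (m t - m s)"
          using norm_triangle_ineq[of "prod (F t - F x) (w x)" "prod (f x) (V s - V x)"] by (simp add: mult_ac)
      qed (use I J in blast)+
      then show ?thesis using integral_unique[OF I] integral_unique[OF J] by simp
    qed
    then show ?thesis by (simp add: algebra_simps)
  qed
  have cm: "continuous_on {a..b} m" by (rule primitive_on_continuous[OF m])
  have "(W has_derivative (\<lambda>h. 0)) (at s within {a..b})" if s: "s \<in> {a..b}" for s
    unfolding has_derivative_within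
  proof (intro conjI bounded_linear_zero)
    show "((\<lambda>t. (1 / norm (t - s)) *\<^sub>R (W t - (W s + 0))) \<longlongrightarrow> 0) (at s within {a..b})"
    proof (rule Lim_null_comparison)
      have "(m \<longlongrightarrow> m s) (at s within {a..b})"
        using cm s by (auto simp: continuous_on_def)
      then have "((\<lambda>t. m t - m s) \<longlongrightarrow> 0) (at s within {a..b})"
        using LIM_zero by blast
      then have "((\<lambda>t. 2 * K * L * \<bar>m t - m s\<bar>) \<longlongrightarrow> 2 * K * L * \<bar>0\<bar>) (at s within {a..b})"
        by (intro tendsto_intros)
      then show "((\<lambda>t. 2 * K * L * \<bar>m t - m s\<bar>) \<longlongrightarrow> 0) (at s within {a..b})"
        by simp
      show "\<forall>\<^sub>F t in at s within {a..b}. norm ((1 / norm (t - s)) *\<^sub>R (W t - (W s + 0))) \<le> 2 * K * L * \<bar>m t - m s\<bar>"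
        unfolding eventually_at_filter
      proof (intro always_eventually allI impI)
        fix t assume t: "t \<noteq> s" "t \<in> {a..b}"
        have "norm (W t - W s) \<le> (2 * K * L * \<bar>t - s\<bar>) * \<bar>m t - m s\<bar>"
        proof (cases "s \<le> t")
          case True
          have "norm (W t - W s) \<le> (2 * K * L * (t - s)) * (m t - m s)" using key[of s t] t s True by auto
          also have "\<dots> \<le> (2 * K * L * \<bar>t - s\<bar>) * \<bar>m t - m s\<bar>" using True L K
            by (auto intro!: mult_left_mono)
          finally show ?thesis .
        next
          case False
          have "norm (W s - W t) \<le> (2 * K * L * (s - t)) * (m s - m t)" using key[of t s] t s False by auto
          also have "\<dots> \<le> (2 * K * L * \<bar>t - s\<bar>) * \<bar>m t - m s\<bar>" using False L K
            by (auto intro!: mult_left_mono)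
          finally show ?thesis by (simp add: norm_minus_commute)
        qed
        moreover have "norm ((1 / norm (t - s)) *\<^sub>R (W t - (W s + 0))) = norm (W t - W s) / \<bar>t - s\<bar>"
          by simp
        ultimately show "norm ((1 / norm (t - s)) *\<^sub>R (W t - (W s + 0))) \<le> 2 * K * L * \<bar>m t - m s\<bar>"
          using t by (simp add: pos_divide_le_eq mult_ac)
      qed
    qed
  qed
  then obtain c where c: "\<And>t. t \<in> {a..b} \<Longrightarrow> W t = c"
    using has_derivative_zero_constant[of "{a..b}" W] by auto
  have "integral {a..t} q = prod (F t) (V t) - prod (F a) (V a)" if "t \<in> {a..b}" for t
    using c[OF that] c[of a] that by (simp add: W_def) (metis add_diff_cancel_left' diff_add_cancel)
  then show ?thesis
    using Q q unfolding primitive_on_def by (simp add: q_def)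
qed

lemma test_function_support:
  assumes "test_function a b \<phi>" "a < b"
  obtains r s where "a < r" "r < s" "s < b" "\<And>t. t \<notin> {r..s} \<Longrightarrow> \<phi> t = 0"
proof -
  obtain K where K: "compact K" "K \<subseteq> {a<..<b}" "\<And>t. t \<notin> K \<Longrightarrow> \<phi> t = 0"
    using assms by (auto simp: test_function_def)
  define K' where "K' = insert ((2 * a + b) / 3) (insert ((a + 2 * b) / 3) K)"
  have K': "compact K'" "K' \<noteq> {}" "K' \<subseteq> {a<..<b}" "(2 * a + b) / 3 \<in> K'" "(a + 2 * b) / 3 \<in> K'"
    using K assms by (auto simp: K'_def)
  obtain r where r: "r \<in> K'" "\<And>t. t \<in> K' \<Longrightarrow> r \<le> t" using compact_attains_inf[OF K'(1,2)] by blast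
  obtain s where s: "s \<in> K'" "\<And>t. t \<in> K' \<Longrightarrow> t \<le> s" using compact_attains_sup[OF K'(1,2)] by blast
  show thesis
  proof (rule that)
    show "a < r" "s < b" using K'(3) r s by auto
    show "r < s" using r(2)[OF K'(4)] s(2)[OF K'(5)] assms by auto
    show "\<phi> t = 0" if "t \<notin> {r..s}" for t
      using that K(3)[of t] r(2)[of t] s(2)[of t] by (auto simp: K'_def)
  qed
qed

lemma test_function_deriv:
  assumes "test_function a b \<phi>"
  shows "(\<phi> has_real_derivative deriv \<phi> t) (at t)" "continuous_on A (deriv \<phi>)" "continuous_on A \<phi>"
proof -
  have C: "Ck_on (Suc 0) UNIV \<phi>" using assms by (auto simp: test_function_def smooth_on_def)
  show "(\<phi> has_real_derivative deriv \<phi> t) (at t)" by (rule Ck_on_UNIV_SucD[OF C])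
  show "continuous_on A (deriv \<phi>)"
    using Ck_on_UNIV_SucD(2)[OF C] continuous_on_subset by auto
  show "continuous_on A \<phi>"
    using Ck_on_Suc_imp[OF C] continuous_on_subset by auto
qed

lemma test_function_deriv_support:
  assumes "test_function a b \<phi>" "\<And>t. t \<notin> {r..s} \<Longrightarrow> \<phi> t = 0" "t \<notin> {r..s}"
  shows "deriv \<phi> t = 0"
proof -
  have "open (- {r..s})" by (auto intro!: open_Compl)
  then have "((\<lambda>_. 0) has_real_derivative deriv \<phi> t) (at t)"
    by (rule has_field_derivative_transform_within_open[OF test_function_deriv(1)[OF assms(1)]])
       (use assms in auto)
  then show ?thesis using DERIV_const DERIV_unique by blast
qed

lemma test_integral:
  fixes z :: "real \<Rightarrow> 'b::euclidean_space"
  assumes "locally_integrable a b z" "a < r" "r \<le> s" "s < b"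
    and "continuous_on UNIV h" "\<And>t. t \<notin> {r..s} \<Longrightarrow> h t = (0::real)"
  shows "set_integrable lebesgue {a<..<b} (\<lambda>t. h t *\<^sub>R z t)"
    and "(LINT t:{a<..<b}|lebesgue. h t *\<^sub>R z t) = integral {r..s} (\<lambda>t. h t *\<^sub>R z t)"
proof -
  have "(\<lambda>t. h t *\<^sub>R z t) absolutely_integrable_on {r..s}"
  proof (rule absolutely_integrable_bounded_measurable_product[where h = scaleR])
    show "bilinear (scaleR :: real \<Rightarrow> 'b \<Rightarrow> 'b)"
      by (simp add: bilinear_conv_bounded_bilinear bounded_bilinear_scaleR)
    have c: "continuous_on {r..s} h" using assms(5) continuous_on_subset by blast
    show "h \<in> borel_measurable (lebesgue_on {r..s})"
      by (rule continuous_imp_measurable_on_sets_lebesgue[OF c]) auto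
    show "bounded (h ` {r..s})" by (intro compact_imp_bounded compact_continuous_image c) auto
    show "z absolutely_integrable_on {r..s}" using assms by (auto simp: locally_integrable_def)
  qed auto
  note ai = this
  have eq: "indicator {r..s} t *\<^sub>R (h t *\<^sub>R z t) = indicator {a<..<b} t *\<^sub>R (h t *\<^sub>R z t)" for t
    using assms(2,3,4) assms(6)[of t] by (auto simp: indicator_def)
  show "set_integrable lebesgue {a<..<b} (\<lambda>t. h t *\<^sub>R z t)"
    using ai unfolding set_integrable_def eq .
  have "(LINT t:{a<..<b}|lebesgue. h t *\<^sub>R z t) = (LINT t:{r..s}|lebesgue. h t *\<^sub>R z t)"
    unfolding set_lebesgue_integral_def eq ..
  then show "(LINT t:{a<..<b}|lebesgue. h t *\<^sub>R z t) = integral {r..s} (\<lambda>t. h t *\<^sub>R z t)"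
    using set_lebesgue_integral_eq_integral(2)[OF ai] by simp
qed

lemma locally_integrable_diff:
  "locally_integrable a b u \<Longrightarrow> locally_integrable a b v \<Longrightarrow> locally_integrable a b (\<lambda>t. u t - v t)"
  by (auto simp: locally_integrable_def intro!: set_integral_diff)

lemma locally_integrable_continuous:
  "continuous_on {a..b} u \<Longrightarrow> locally_integrable a b u"
  by (auto simp: locally_integrable_def intro!: absolutely_integrable_continuous_real
      elim!: continuous_on_subset)

lemma locally_integrable_absolutely:
  "u absolutely_integrable_on {a..b} \<Longrightarrow> locally_integrable a b u"
  by (auto simp: locally_integrable_def elim!: set_integrable_subset)

lemma sigma_finite_lebesgue: "sigma_finite_measure (lebesgue :: real measure)"
proof (rule sigma_finite_measure.intro)
  show "\<exists>A. countable A \<and> A \<subseteq> sets (lebesgue :: real measure) \<and> \<Union> A = space lebesgue \<and> (\<forall>a\<in>A. emeasure lebesgue a \<noteq> \<infinity>)"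
  proof (rule exI[of _ "range (\<lambda>n. {- real n..real n})"], intro conjI ballI)
    have "\<exists>n. x \<in> {- real n..real n}" for x
    proof -
      obtain n where "\<bar>x\<bar> \<le> real n" using real_arch_simple by blast
      then have "x \<in> {- real n..real n}" by auto
      then show ?thesis by blast
    qed
    then show "(\<Union>n. {- real n..real n}) = space lebesgue" by auto
  qed auto
qed

text \<open>
  Half-lines are stable under intersection and generate the Borel sets, so the integral over every Borel
  set, and hence over every Lebesgue set, is zero.
\<close>

lemma AE_zero_of_halfline_integrals:
  fixes z :: "real \<Rightarrow> 'b::euclidean_space"
  assumes z: "integrable lebesgue z"
    and half: "\<And>x. (LINT t:{..<x}|lebesgue. z t) = 0" and total: "(LINT t|lebesgue. z t) = 0"
  shows "AE t in lebesgue. z t = 0"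
proof (rule sigma_finite_measure.density_zero[OF sigma_finite_lebesgue z])
  fix A :: "real set" assume "A \<in> sets lebesgue"
  then obtain S N N' where A: "A = S \<union> N" "N \<subseteq> N'" "N' \<in> null_sets lborel" "S \<in> sets lborel"
    by (rule sets_completionE)
  have si: "set_integrable lebesgue B z" if "B \<in> sets lebesgue" for B
    using integrable_mult_indicator[OF that z] by (simp add: set_integrable_def)
  have bl: "B \<in> sets lebesgue" if "B \<in> sets borel" for B using that by simp
  have S: "S \<in> sigma_sets UNIV (range lessThan)"
    using A(4) by (simp add: borel_Iio sets_measure_of)
  have "Int_stable (range (lessThan :: real \<Rightarrow> real set))"
  proof (unfold Int_stable_def, intro ballI)
    fix a b :: "real set" assume "a \<in> range lessThan" "b \<in> range lessThan"
    then obtain x y where "a = {..<x}" "b = {..<y}" by auto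
    then have "a \<inter> b = {..<min x y}" by auto
    then show "a \<inter> b \<in> range lessThan" by blast
  qed
  moreover have "range (lessThan :: real \<Rightarrow> real set) \<subseteq> Pow UNIV" by simp
  ultimately have "(LINT t:S|lebesgue. z t) = 0"
    using S
  proof (induction rule: sigma_sets_induct_disjoint)
    case (basic A) then show ?case using half by auto
  next
    case empty show ?case by (simp add: set_lebesgue_integral_def)
  next
    case (compl A)
    have "A \<in> sets borel" using compl(1) by (simp add: borel_Iio sets_measure_of)
    then have "(LINT t:A \<union> (UNIV - A)|lebesgue. z t) = (LINT t:A|lebesgue. z t) + (LINT t:(UNIV - A)|lebesgue. z t)"
      by (intro set_integral_Un si bl) auto
    then show ?case using total compl by (simp add: set_lebesgue_integral_def)
  next
    case (union A)
    have "A i \<in> sets borel" for i using union(2) by (auto simp: borel_Iio sets_measure_of)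
    then have "(LINT t:(\<Union>i. A i)|lebesgue. z t) = (\<Sum>i. (LINT t:(A i)|lebesgue. z t))"
      using union(1) by (intro lebesgue_integral_countable_add si bl) (auto simp: disjoint_family_on_def)
    then show ?case using union by simp
  qed
  moreover have "(LINT t:A|lebesgue. z t) = (LINT t:S|lebesgue. z t)"
  proof (rule set_integral_cong_set)
    have "S \<in> sets lebesgue" using A(4) by auto
    then show "set_borel_measurable lebesgue S z" "set_borel_measurable lebesgue A z"
      using si \<open>A \<in> sets lebesgue\<close> by (auto simp: set_integrable_def set_borel_measurable_def dest: borel_measurable_integrable)
    have "AE x in lborel. x \<notin> N'" using A(3) by (rule AE_not_in)
    then have "AE x in lebesgue. x \<notin> N'" by (rule AE_completion)
    then show "AE x in lebesgue. (x \<in> S) = (x \<in> A)" by eventually_elim (use A in auto)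
  qed
  ultimately show "(LINT t:A|lebesgue. z t) = 0" by simp
qed

text \<open>
  Countably many compact subintervals exhaust the open interval.
\<close>

lemma AE_on_open_interval:
  assumes "\<And>r s. a < r \<Longrightarrow> r < s \<Longrightarrow> s < b \<Longrightarrow> AE t in lebesgue. t \<in> {r..s} \<longrightarrow> P t"
  shows "AE t in lebesgue. t \<in> {a<..<b} \<longrightarrow> P (t::real)"
proof -
  have "AE t in lebesgue. \<forall>n. t \<in> {a + 1 / Suc n .. b - 1 / Suc n} \<longrightarrow> P t"
  proof (subst AE_all_countable, intro allI)
    fix n
    consider "a + 1 / Suc n < b - 1 / Suc n" | "b - 1 / Suc n < a + 1 / Suc n" | "a + 1 / Suc n = b - 1 / Suc n" by linarith
    then show "AE t in lebesgue. t \<in> {a + 1 / Suc n .. b - 1 / Suc n} \<longrightarrow> P t"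
    proof cases
      case 3
      have "AE t in lebesgue. t \<noteq> a + 1 / Suc n"
        by (rule AE_I'[of "{a + 1 / Suc n}"]) (auto simp: negligible_iff_null_sets[symmetric])
      then show ?thesis by eventually_elim (use 3 in auto)
    next
      case 1 then show ?thesis by (intro assms) auto
    qed auto
  qed
  then show ?thesis
  proof eventually_elim
    case (elim t)
    show ?case
    proof
      assume t: "t \<in> {a<..<b}"
      then have "0 < min (t - a) (b - t)" by auto
      then obtain n where n: "inverse (real (Suc n)) < min (t - a) (b - t)" using reals_Archimedean by blast
      show "P t" using elim[rule_format, of n] n by (auto simp: field_simps)
    qed
  qed
qed

text \<open>
  The fundamental lemma of the calculus of variations. Testing with plateaus and passing to the limit by
  dominated convergence shows that the integral over every subinterval is zero.
\<close>

lemma fundamental_lemma: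
  fixes z :: "real \<Rightarrow> 'b::euclidean_space"
  assumes z: "locally_integrable a b z"
    and orth: "\<And>\<psi>. test_function a b \<psi> \<Longrightarrow> (LINT t:{a<..<b}|lebesgue. \<psi> t *\<^sub>R z t) = 0"
  shows "AE t in lebesgue. t \<in> {a<..<b} \<longrightarrow> z t = 0"
proof (rule AE_on_open_interval)
  have zero: "(LINT t:{r<..<s}|lebesgue. z t) = 0" if rs: "a < r" "r < s" "s < b" for r s
  proof -
    define w where "w t = indicator {r..s} t *\<^sub>R z t" for t
    have w: "integrable lebesgue w"
      using z rs unfolding locally_integrable_def set_integrable_def w_def by blast
    have "(\<lambda>n. LINT t|lebesgue. plateau r s n t *\<^sub>R w t) \<longlonglongrightarrow> (LINT t|lebesgue. indicator {r<..<s} t *\<^sub>R w t)"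
    proof (rule integral_dominated_convergence[where w = "\<lambda>t. norm (w t)"])
      show "(\<lambda>t. indicator {r<..<s} t *\<^sub>R w t) \<in> borel_measurable lebesgue"
        by (rule borel_measurable_integrable, rule integrable_mult_indicator) (auto intro!: w)
      show "(\<lambda>t. plateau r s n t *\<^sub>R w t) \<in> borel_measurable lebesgue" for n
      proof (intro borel_measurable_scaleR borel_measurable_integrable[OF w])
        have "plateau r s n \<in> borel_measurable borel"
          using rs by (intro borel_measurable_continuous_onI test_function_deriv(3) test_function_plateau)
        then show "plateau r s n \<in> borel_measurable lebesgue"
          by (intro measurable_completion) simp
      qed
      show "AE t in lebesgue. (\<lambda>n. plateau r s n t *\<^sub>R w t) \<longlonglongrightarrow> indicator {r<..<s} t *\<^sub>R w t"
        by (intro AE_I2 tendsto_intros plateau_tendsto)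
      show "AE t in lebesgue. norm (plateau r s n t *\<^sub>R w t) \<le> norm (w t)" for n
        using plateau_bounds by (intro AE_I2) (auto intro!: mult_left_le_one_le)
    qed (use w in auto)
    moreover have "(LINT t|lebesgue. plateau r s n t *\<^sub>R w t) = 0" for n
    proof -
      have "plateau r s n t *\<^sub>R w t = indicator {a<..<b} t *\<^sub>R (plateau r s n t *\<^sub>R z t)" for t
        using rs by (auto simp: w_def indicator_def plateau_def flat_exp_def zero_less_mult_iff)
      then show ?thesis
        using orth[OF test_function_plateau[OF rs(1,3)], of n] by (simp add: set_lebesgue_integral_def)
    qed
    ultimately have "(LINT t|lebesgue. indicator {r<..<s} t *\<^sub>R w t) = 0"
      using LIMSEQ_unique[OF _ tendsto_const] by (metis (no_types, lifting) ext LIMSEQ_const_iff)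
    moreover have "indicator {r<..<s} t *\<^sub>R w t = indicator {r<..<s} t *\<^sub>R z t" for t
      by (auto simp: w_def indicator_def)
    ultimately show ?thesis by (simp add: set_lebesgue_integral_def)
  qed
  fix r s assume rs: "a < r" "r < s" "s < b"
  define w where "w t = indicator {r<..<s} t *\<^sub>R z t" for t
  have "set_integrable lebesgue {r..s} z"
    using z rs unfolding locally_integrable_def by blast
  then have "set_integrable lebesgue {r<..<s} z" by (rule set_integrable_subset) auto
  then have w: "integrable lebesgue w" unfolding set_integrable_def w_def[abs_def] .
  have "AE t in lebesgue. w t = 0"
  proof (rule AE_zero_of_halfline_integrals[OF w])
    show "(LINT t|lebesgue. w t) = 0" using zero[OF rs] by (simp add: w_def set_lebesgue_integral_def)
    fix x
    have *: "indicator {..<x} t *\<^sub>R w t = indicator {r<..<min s x} t *\<^sub>R z t" for t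
      by (auto simp: w_def indicator_def)
    show "(LINT t:{..<x}|lebesgue. w t) = 0"
    proof (cases "r < min s x")
      case True
      then show ?thesis using zero[of r "min s x"] rs by (simp add: set_lebesgue_integral_def *)
    next
      case False
      then have "indicator {r<..<min s x} t *\<^sub>R z t = 0" for t by (auto simp: indicator_def)
      then show ?thesis by (simp only: set_lebesgue_integral_def *) simp
    qed
  qed
  moreover have "AE t in lebesgue. t \<noteq> r" "AE t in lebesgue. t \<noteq> s"
    by (rule AE_I'[of "{r}"] AE_I'[of "{s}"]; auto simp: negligible_iff_null_sets[symmetric])+
  ultimately show "AE t in lebesgue. t \<in> {r..s} \<longrightarrow> z t = 0"
    by eventually_elim (auto simp: w_def indicator_def split: if_splits)
qed

text \<open>
  Mean value zero is what makes the antiderivative that vanishes to the left of the support vanish to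
  the right of it as well.
\<close>

lemma test_function_antiderivative:
  assumes \<psi>: "test_function a b \<psi>" and ab: "a < b" and zero: "(LINT t:{a<..<b}|lebesgue. \<psi> t) = 0"
  obtains \<phi> where "test_function a b \<phi>" "deriv \<phi> = \<psi>"
proof -
  obtain r s where rs: "a < r" "r < s" "s < b" and supp: "\<And>t. t \<notin> {r..s} \<Longrightarrow> \<psi> t = 0"
    using test_function_support[OF \<psi> ab] by blast
  have c: "continuous_on A \<psi>" for A using test_function_deriv(3)[OF \<psi>] .
  have "integral {r..s} \<psi> = 0"
    using test_integral(2)[of a b "\<lambda>_. 1::real" r s \<psi>] zero rs c supp
    by (simp add: locally_integrable_continuous)
  define \<phi> where "\<phi> t = integral {a..t} \<psi>" for t
  have D: "(\<phi> has_real_derivative \<psi> t) (at t)" for t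
  proof (cases "t < r")
    case True
    have "((\<lambda>_. 0) has_real_derivative \<psi> t) (at t)" using supp[of t] True by simp
    then show ?thesis
    proof (rule has_field_derivative_transform_within_open)
      show "open {..<r}" "t \<in> {..<r}" using True by auto
      fix u assume "u \<in> {..<r}"
      then have "integral {a..u} \<psi> = integral {a..u} (\<lambda>_. 0)"
        by (intro integral_cong supp) auto
      then show "0 = \<phi> u" by (simp add: \<phi>_def)
    qed
  next
    case False
    have "((\<lambda>u. integral {a..u} \<psi>) has_vector_derivative \<psi> t) (at t within {a..t+1})"
      using False rs by (intro integral_has_vector_derivative c) auto
    then have "(\<phi> has_real_derivative \<psi> t) (at t within {a..t+1})"
      unfolding \<phi>_def[abs_def] by (simp add: has_real_derivative_iff_has_vector_derivative)
    moreover have "at t within {a..t+1} = at t"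
      using False rs by (intro at_within_interior) (auto simp: interior_atLeastAtMost_real)
    ultimately show ?thesis by simp
  qed
  have der: "deriv \<phi> = \<psi>" using D by (auto intro: DERIV_imp_deriv)
  have "\<phi> t = 0" if "t \<notin> {r..s}" for t
  proof (cases "t < r")
    case True
    then have "integral {a..t} \<psi> = integral {a..t} (\<lambda>_. 0)"
      by (intro integral_cong supp) auto
    then show ?thesis by (simp add: \<phi>_def)
  next
    case False
    then have t: "s < t" using that by auto
    have "integral {a..t} \<psi> = integral {r..s} \<psi>"
      by (rule integral_spike_set)
         (use supp rs t in \<open>auto intro!: negligible_subset[OF negligible_empty]\<close>)
    then show ?thesis using \<open>integral {r..s} \<psi> = 0\<close> by (simp add: \<phi>_def)
  qed
  moreover have "Ck_on k UNIV \<phi>" for k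
  proof (cases k)
    case 0
    then show ?thesis using DERIV_continuous_on[of UNIV \<phi> \<psi>] D by auto
  next
    case (Suc j)
    then show ?thesis using \<psi> by (auto simp: test_function_def smooth_on_def intro!: Ck_on_UNIV_SucI[OF D] simp del: Ck_on.simps)
  qed
  ultimately have "test_function a b \<phi>"
    unfolding test_function_def smooth_on_def using rs by (intro conjI allI exI[of _ "{r..s}"]) auto
  then show thesis using that der by blast
qed

lemma test_function_combination:
  assumes "test_function a b \<psi>" "test_function a b \<theta>"
  shows "test_function a b (\<lambda>t. \<psi> t + c * \<theta> t)"
proof -
  obtain K L where "compact K" "K \<subseteq> {a<..<b}" "\<And>t. t \<notin> K \<Longrightarrow> \<psi> t = 0"
      "compact L" "L \<subseteq> {a<..<b}" "\<And>t. t \<notin> L \<Longrightarrow> \<theta> t = 0"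
    using assms unfolding test_function_def by metis
  then have "\<exists>K. compact K \<and> K \<subseteq> {a<..<b} \<and> (\<forall>t. t \<notin> K \<longrightarrow> \<psi> t + c * \<theta> t = 0)"
    by (intro exI[of _ "K \<union> L"]) auto
  then show ?thesis
    using assms unfolding test_function_def smooth_on_def
    by (auto intro!: Ck_on_add_real Ck_on_cmult simp del: Ck_on.simps)
qed

lemma test_function_integrable:
  fixes z :: "real \<Rightarrow> 'b::euclidean_space"
  assumes "test_function a b \<psi>" "a < b" "locally_integrable a b z"
  shows "set_integrable lebesgue {a<..<b} (\<lambda>t. \<psi> t *\<^sub>R z t)"
    "set_integrable lebesgue {a<..<b} (\<lambda>t. deriv \<psi> t *\<^sub>R z t)"
proof -
  obtain r s where rs: "a < r" "r < s" "s < b" and supp: "\<And>t. t \<notin> {r..s} \<Longrightarrow> \<psi> t = 0"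
    using test_function_support[OF assms(1,2)] by blast
  show "set_integrable lebesgue {a<..<b} (\<lambda>t. \<psi> t *\<^sub>R z t)"
    by (rule test_integral(1)[OF assms(3) rs(1) _ rs(3)])
       (use rs supp test_function_deriv[OF assms(1)] in auto)
  show "set_integrable lebesgue {a<..<b} (\<lambda>t. deriv \<psi> t *\<^sub>R z t)"
    by (rule test_integral(1)[OF assms(3) rs(1) _ rs(3)])
       (use rs test_function_deriv_support[OF assms(1) supp] test_function_deriv[OF assms(1)] in auto)
qed

text \<open>
  Fix a test function \<open>\<theta>\<close> with nonzero integral. Subtracting a multiple of \<open>\<theta>\<close> from any test function \<open>\<psi>\<close>
  gives one of mean value zero, which is the derivative of a test function and hence orthogonal to \<open>z\<close>.
  So the integral of \<open>\<psi> z\<close> is a fixed multiple of the integral of \<open>\<psi>\<close>.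
\<close>

lemma weak_derivative_zero_imp_constant:
  fixes z :: "real \<Rightarrow> 'b::euclidean_space"
  assumes ab: "a < b" and z: "locally_integrable a b z"
    and orth: "\<And>\<phi>. test_function a b \<phi> \<Longrightarrow> (LINT t:{a<..<b}|lebesgue. deriv \<phi> t *\<^sub>R z t) = 0"
  obtains k where "AE t in lebesgue. t \<in> {a<..<b} \<longrightarrow> z t = k"
proof -
  have one: "locally_integrable a b (\<lambda>_. k :: 'c::euclidean_space)" for k
    by (intro locally_integrable_continuous continuous_intros)
  obtain \<theta> where \<theta>: "test_function a b \<theta>" "(LINT t:{a<..<b}|lebesgue. \<theta> t *\<^sub>R (1::real)) \<noteq> 0"
  proof -
    have "\<not> (AE t in lebesgue. t \<in> {a<..<b} \<longrightarrow> (1::real) = 0)"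
    proof
      assume "AE t in lebesgue. t \<in> {a<..<b} \<longrightarrow> (1::real) = 0"
      then have "AE t in lebesgue. t \<notin> {a<..<b}" by simp
      then have "{a<..<b} \<in> null_sets lebesgue" by (simp add: AE_iff_null_sets)
      then have "negligible {a<..<b}" by (simp add: negligible_iff_null_sets)
      then show False using open_not_negligible[of "{a<..<b}"] ab by auto
    qed
    then show thesis using fundamental_lemma[OF one[of "1::real"]] that by blast
  qed
  define c where "c = (LINT t:{a<..<b}|lebesgue. \<theta> t *\<^sub>R (1::real))"
  define k where "k = (1 / c) *\<^sub>R (LINT t:{a<..<b}|lebesgue. \<theta> t *\<^sub>R z t)"
  have "AE t in lebesgue. t \<in> {a<..<b} \<longrightarrow> z t - k = 0"
  proof (rule fundamental_lemma)
    show "locally_integrable a b (\<lambda>t. z t - k)" by (intro locally_integrable_diff z one)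
    fix \<psi> assume \<psi>: "test_function a b \<psi>"
    define d where "d = (LINT t:{a<..<b}|lebesgue. \<psi> t *\<^sub>R (1::real))"
    define \<eta> where "\<eta> t = \<psi> t + (- d / c) * \<theta> t" for t
    have \<eta>: "test_function a b \<eta>" unfolding \<eta>_def by (rule test_function_combination[OF \<psi> \<theta>(1)])
    have lin: "(LINT t:{a<..<b}|lebesgue. \<eta> t *\<^sub>R y t) =
       (LINT t:{a<..<b}|lebesgue. \<psi> t *\<^sub>R y t) + (- d / c) *\<^sub>R (LINT t:{a<..<b}|lebesgue. \<theta> t *\<^sub>R y t)"
      if y: "locally_integrable a b y" for y :: "real \<Rightarrow> 'c::euclidean_space"
    proof -
      have "(LINT t:{a<..<b}|lebesgue. \<psi> t *\<^sub>R y t + (- d / c) *\<^sub>R (\<theta> t *\<^sub>R y t)) =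
         (LINT t:{a<..<b}|lebesgue. \<psi> t *\<^sub>R y t) + (LINT t:{a<..<b}|lebesgue. (- d / c) *\<^sub>R (\<theta> t *\<^sub>R y t))"
        by (intro set_integral_add set_integrable_scaleR_right test_function_integrable[OF \<psi> ab y]
             test_function_integrable[OF \<theta>(1) ab y] impI)
      moreover have "\<psi> t *\<^sub>R y t + (- d / c) *\<^sub>R (\<theta> t *\<^sub>R y t) = \<eta> t *\<^sub>R y t" for t
        by (simp add: \<eta>_def algebra_simps)
      ultimately show ?thesis by (simp only: set_integral_scaleR_right)
    qed
    have "(LINT t:{a<..<b}|lebesgue. \<eta> t *\<^sub>R (1::real)) = 0"
      using lin[OF one[of "1::real"]] \<theta>(2) by (simp add: d_def c_def)
    then obtain \<phi> where \<phi>: "test_function a b \<phi>" "deriv \<phi> = \<eta>"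
      using test_function_antiderivative[OF \<eta> ab] by auto
    have "(LINT t:{a<..<b}|lebesgue. \<psi> t *\<^sub>R z t) = d *\<^sub>R k"
      using lin[OF z] orth[OF \<phi>(1)] \<phi>(2) by (simp add: k_def)
    moreover have "(LINT t:{a<..<b}|lebesgue. \<psi> t *\<^sub>R k) = d *\<^sub>R k"
      using test_function_integrable(1)[OF \<psi> ab one[of "1::real"]]
      unfolding d_def set_integrable_def set_lebesgue_integral_def
      by (simp flip: integral_scaleR_left)
    ultimately show "(LINT t:{a<..<b}|lebesgue. \<psi> t *\<^sub>R (z t - k)) = 0"
      using set_integral_diff(2)[OF test_function_integrable(1)[OF \<psi> ab z] test_function_integrable(1)[OF \<psi> ab one[of k]]]
      by (simp add: scaleR_diff_right)
  qed
  then show thesis by (intro that[of k]) simp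
qed

lemma has_weak_derivative_unique:
  assumes "has_weak_derivative a b u v" "has_weak_derivative a b u v'" "a < b"
  shows "AE t in lebesgue. t \<in> {a<..<b} \<longrightarrow> v t = v' t"
proof -
  have l: "locally_integrable a b v" "locally_integrable a b v'"
    using assms by (auto simp: has_weak_derivative_def)
  have "AE t in lebesgue. t \<in> {a<..<b} \<longrightarrow> v t - v' t = 0"
  proof (rule fundamental_lemma)
    fix \<psi> assume \<psi>: "test_function a b \<psi>"
    show "(LINT t:{a<..<b}|lebesgue. \<psi> t *\<^sub>R (v t - v' t)) = 0"
      using set_integral_diff(2)[OF test_function_integrable(1)[OF \<psi> assms(3) l(1)] test_function_integrable(1)[OF \<psi> assms(3) l(2)]]
        assms(1,2) \<psi> unfolding has_weak_derivative_def by (simp add: scaleR_diff_right)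
  qed (intro locally_integrable_diff l)
  then show ?thesis by simp
qed

text \<open>
  This rests on the completeness of Lebesgue measure.
\<close>

lemma borel_measurable_lebesgue_cong_AE:
  fixes f g :: "'a::euclidean_space \<Rightarrow> 'b::topological_space"
  assumes "f \<in> borel_measurable lebesgue" "AE t in lebesgue. f t = g t"
  shows "g \<in> borel_measurable lebesgue"
proof (rule borel_measurableI)
  fix S :: "'b set" assume "open S"
  then have "f -` S \<inter> space lebesgue \<in> sets lebesgue" using assms(1) by (meson borel_open measurable_sets)
  moreover have "AE t in lebesgue. t \<in> f -` S \<inter> space lebesgue \<longleftrightarrow> t \<in> g -` S \<inter> space lebesgue"
    using assms(2) by eventually_elim auto
  ultimately show "g -` S \<inter> space lebesgue \<in> sets lebesgue"
    using completion.in_sets_AE by blast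
qed

lemma locally_integrable_cong_AE:
  assumes "locally_integrable a b u" "AE t in lebesgue. t \<in> {a<..<b} \<longrightarrow> u t = u' t"
  shows "locally_integrable a b u'"
  unfolding locally_integrable_def
proof (intro allI impI)
  fix r s assume rs: "a < r \<and> s < b"
  have i: "integrable lebesgue (\<lambda>t. indicator {r..s} t *\<^sub>R u t)"
    using assms(1) rs by (auto simp: locally_integrable_def set_integrable_def)
  have ae: "AE t in lebesgue. indicator {r..s} t *\<^sub>R u t = indicator {r..s} t *\<^sub>R u' t"
    using assms(2) by eventually_elim (use rs in \<open>auto simp: indicator_def\<close>)
  have m: "(\<lambda>t. indicator {r..s} t *\<^sub>R u' t) \<in> borel_measurable lebesgue"
    by (rule borel_measurable_lebesgue_cong_AE[OF borel_measurable_integrable[OF i] ae])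
  show "set_integrable lebesgue {r..s} u'"
    unfolding set_integrable_def using integrable_cong_AE_imp[OF i m] ae by (simp add: eq_commute[of _ "indicator _ _ *\<^sub>R u _"])
qed

lemma set_integral_cong_AE_lebesgue:
  fixes f g :: "real \<Rightarrow> 'b::euclidean_space"
  assumes "AE t in lebesgue. t \<in> A \<longrightarrow> f t = g t"
  shows "(LINT t:A|lebesgue. f t) = (LINT t:A|lebesgue. g t)"
proof -
  define F where "F t = indicator A t *\<^sub>R f t" for t
  define G where "G t = indicator A t *\<^sub>R g t" for t
  have ae: "AE t in lebesgue. F t = G t"
    using assms by eventually_elim (auto simp: F_def G_def indicator_def)
  then have ae': "AE t in lebesgue. G t = F t" by eventually_elim simp
  have "(LINT t|lebesgue. F t) = (LINT t|lebesgue. G t)"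
  proof (cases "F \<in> borel_measurable lebesgue")
    case True
    then show ?thesis
      using ae borel_measurable_lebesgue_cong_AE[OF True ae] by (intro integral_cong_AE)
  next
    case False
    then have "G \<notin> borel_measurable lebesgue"
      using borel_measurable_lebesgue_cong_AE[OF _ ae'] by blast
    then have "\<not> integrable lebesgue F" "\<not> integrable lebesgue G"
      using False borel_measurable_integrable by blast+
    then show ?thesis by (simp add: not_integrable_integral_eq)
  qed
  then show ?thesis by (simp add: F_def G_def set_lebesgue_integral_def)
qed

lemma has_weak_derivative_cong_AE:
  assumes "has_weak_derivative a b u v"
    and u: "AE t in lebesgue. t \<in> {a<..<b} \<longrightarrow> u t = u' t"
    and v: "AE t in lebesgue. t \<in> {a<..<b} \<longrightarrow> v t = v' t"
  shows "has_weak_derivative a b u' v'"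
proof -
  have "(LINT t:{a<..<b}|lebesgue. h t *\<^sub>R u t) = (LINT t:{a<..<b}|lebesgue. h t *\<^sub>R u' t)" for h :: "real \<Rightarrow> real"
    by (rule set_integral_cong_AE_lebesgue) (use u in eventually_elim, simp)
  moreover have "(LINT t:{a<..<b}|lebesgue. h t *\<^sub>R v t) = (LINT t:{a<..<b}|lebesgue. h t *\<^sub>R v' t)" for h :: "real \<Rightarrow> real"
    by (rule set_integral_cong_AE_lebesgue) (use v in eventually_elim, simp)
  ultimately show ?thesis
    using assms(1) locally_integrable_cong_AE[OF _ u] locally_integrable_cong_AE[OF _ v]
    by (simp add: has_weak_derivative_def)
qed

text \<open>
  Integration by parts: the product with a test function is a primitive that vanishes at both ends.
\<close>

lemma primitive_on_has_weak_derivative: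
  assumes P: "primitive_on a b V w" and ab: "a < b"
  shows "has_weak_derivative a b V w"
  unfolding has_weak_derivative_def
proof (intro conjI allI impI)
  show lV: "locally_integrable a b V"
    by (rule locally_integrable_continuous[OF primitive_on_continuous[OF P]])
  show lw: "locally_integrable a b w"
    using P by (auto simp: primitive_on_def intro: locally_integrable_absolutely)
  fix \<phi> assume \<phi>: "test_function a b \<phi>"
  obtain r s where rs: "a < r" "r < s" "s < b" and supp: "\<And>t. t \<notin> {r..s} \<Longrightarrow> \<phi> t = 0"
    using test_function_support[OF \<phi> ab] by blast
  have "primitive_on a b (\<lambda>t. \<phi> t *\<^sub>R V t) (\<lambda>t. deriv \<phi> t *\<^sub>R V t + \<phi> t *\<^sub>R w t)"
    using test_function_deriv[OF \<phi>]
    by (intro primitive_on_product[OF bounded_bilinear_scaleR _ _ P])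
       (auto simp: has_real_derivative_iff_has_vector_derivative intro: has_vector_derivative_at_within)
  then have "((\<lambda>t. deriv \<phi> t *\<^sub>R V t + \<phi> t *\<^sub>R w t) has_integral \<phi> b *\<^sub>R V b - \<phi> a *\<^sub>R V a) {a..b}"
    using ab by (auto simp: primitive_on_def)
  moreover have "\<phi> a = 0" "\<phi> b = 0" using supp rs by auto
  ultimately have "((\<lambda>t. deriv \<phi> t *\<^sub>R V t + \<phi> t *\<^sub>R w t) has_integral 0) {a<..<b}"
    by (simp add: has_integral_Icc_iff_Ioo)
  moreover have "set_integrable lebesgue {a<..<b} (\<lambda>t. deriv \<phi> t *\<^sub>R V t)"
    "set_integrable lebesgue {a<..<b} (\<lambda>t. \<phi> t *\<^sub>R w t)"
    by (rule test_function_integrable[OF \<phi> ab] lV lw)+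
  moreover note set_integral_add[OF this] set_lebesgue_integral_eq_integral(2)[OF set_integral_add(1)[OF this]]
  ultimately have "(LINT t:{a<..<b}|lebesgue. deriv \<phi> t *\<^sub>R V t) + (LINT t:{a<..<b}|lebesgue. \<phi> t *\<^sub>R w t) = 0"
    using integral_unique by (metis (no_types, lifting))
  then show "(LINT t:{a<..<b}|lebesgue. deriv \<phi> t *\<^sub>R V t) = - (LINT t:{a<..<b}|lebesgue. \<phi> t *\<^sub>R w t)"
    by (simp add: eq_neg_iff_add_eq_0)
qed

text \<open>
  The difference of \<open>v\<close> and the indefinite integral of \<open>w\<close> has weak derivative zero.
\<close>

lemma weak_derivative_imp_primitive:
  assumes ab: "a < b" and weak: "has_weak_derivative a b v w" and w: "w absolutely_integrable_on {a..b}"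
  obtains V where "primitive_on a b V w" "AE t in lebesgue. t \<in> {a<..<b} \<longrightarrow> v t = V t"
proof -
  define W where "W t = integral {a..t} w" for t
  have W: "primitive_on a b W w" using primitive_on_integral[OF w, of 0] by (simp add: W_def[abs_def])
  have wW: "has_weak_derivative a b W w" by (rule primitive_on_has_weak_derivative[OF W ab])
  have l: "locally_integrable a b v" "locally_integrable a b W"
    using weak wW by (auto simp: has_weak_derivative_def)
  obtain k where k: "AE t in lebesgue. t \<in> {a<..<b} \<longrightarrow> v t - W t = k"
  proof (rule weak_derivative_zero_imp_constant[OF ab locally_integrable_diff[OF l]])
    fix \<phi> assume \<phi>: "test_function a b \<phi>"
    show "(LINT t:{a<..<b}|lebesgue. deriv \<phi> t *\<^sub>R (v t - W t)) = 0"
      using set_integral_diff(2)[OF test_function_integrable(2)[OF \<phi> ab l(1)] test_function_integrable(2)[OF \<phi> ab l(2)]]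
        weak wW \<phi> unfolding has_weak_derivative_def by (simp add: scaleR_diff_right)
  qed
  show thesis
  proof (rule that[of "\<lambda>t. k + W t"])
    show "primitive_on a b (\<lambda>t. k + W t) w" using W by (simp add: primitive_on_def)
    show "AE t in lebesgue. t \<in> {a<..<b} \<longrightarrow> v t = k + W t"
      using k by eventually_elim (auto simp: algebra_simps)
  qed
qed

lemma continuous_AE_eq:
  fixes u U :: "real \<Rightarrow> 'b::euclidean_space"
  assumes ab: "a < b" and c: "continuous_on {a..b} u" "continuous_on {a..b} U"
    and ae: "AE t in lebesgue. t \<in> {a<..<b} \<longrightarrow> u t = U t" and t: "t \<in> {a..b}"
  shows "u t = U t"
proof -
  define d where "d = (\<lambda>t. u t - U t)"
  have cd: "continuous_on {a..b} d" unfolding d_def by (intro continuous_intros c)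
  have "open ({a<..<b} \<inter> d -` (- {0}))"
    by (rule continuous_open_preimage) (auto intro: continuous_on_subset[OF cd])
  moreover have "AE t in lebesgue. t \<notin> {a<..<b} \<inter> d -` (- {0})"
    using ae by eventually_elim (auto simp: d_def)
  then have "negligible ({a<..<b} \<inter> d -` (- {0}))"
    using completion.AE_iff_null_sets by (auto simp: negligible_iff_null_sets completion.null_sets_iff_AE)
  ultimately have "{a<..<b} \<inter> d -` (- {0}) = {}" using open_not_negligible by blast
  then have "d t = 0" if "t \<in> {a<..<b}" for t using that by auto
  then have "d t = 0"
    using continuous_constant_on_closure[of "{a<..<b}" d 0 t] cd t ab by auto
  then show ?thesis by (simp add: d_def)
qed

text \<open>
  Two applications of \<open>weak_derivative_imp_primitive\<close>, to the first derivative and to \<open>u\<close> itself.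
  The derivatives are one-sided at \<open>a\<close> and \<open>b\<close>: the integrability of \<open>w\<close> up to the end points is what
  carries the velocity there.
\<close>

lemma W22_structure:
  assumes ab: "a < b" and u: "continuous_on {a..b} u"
    and uv: "has_weak_derivative a b u v" and vw: "has_weak_derivative a b v w"
    and w: "w absolutely_integrable_on {a..b}"
  obtains V where "primitive_on a b V w"
    "\<And>t. t \<in> {a..b} \<Longrightarrow> (u has_vector_derivative V t) (at t within {a..b})"
    "AE t in lebesgue. t \<in> {a<..<b} \<longrightarrow> v t = V t"
proof -
  obtain V where V: "primitive_on a b V w" "AE t in lebesgue. t \<in> {a<..<b} \<longrightarrow> v t = V t"
    using weak_derivative_imp_primitive[OF ab vw w] by blast
  have cV: "continuous_on {a..b} V" by (rule primitive_on_continuous[OF V(1)])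
  have "has_weak_derivative a b u V"
    by (rule has_weak_derivative_cong_AE[OF uv _ V(2)]) simp
  then obtain U where U: "primitive_on a b U V" "AE t in lebesgue. t \<in> {a<..<b} \<longrightarrow> u t = U t"
    using weak_derivative_imp_primitive[OF ab _ absolutely_integrable_continuous_real[OF cV]] by blast
  have eq: "u t = U t" if "t \<in> {a..b}" for t
    by (rule continuous_AE_eq[OF ab u primitive_on_continuous[OF U(1)] U(2) that])
  show thesis
  proof (rule that[OF V(1) _ V(2)])
    fix t assume t: "t \<in> {a..b}"
    show "(u has_vector_derivative V t) (at t within {a..b})"
      by (rule has_vector_derivative_transform[OF t eq primitive_on_has_vector_derivative[OF U(1) cV t]])
  qed
qed

lemma L2_on_absolutely_integrable:
  fixes w :: "real \<Rightarrow> 'b::euclidean_space"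
  assumes "L2_on a b w"
  shows "w absolutely_integrable_on {a..b}"
proof -
  have "set_integrable lebesgue {a<..<b} w"
    unfolding set_integrable_def
  proof (rule Bochner_Integration.integrable_bound)
    have "set_integrable lebesgue {a<..<b} (\<lambda>t. 1 + (norm (w t))\<^sup>2)"
      using assms unfolding L2_on_def
      by (intro set_integral_add) (auto intro: set_integrable_subset[of _ "{a..b}"] absolutely_integrable_continuous_real)
    then show "integrable lebesgue (\<lambda>t. indicat_real {a<..<b} t *\<^sub>R (1 + (norm (w t))\<^sup>2))"
      by (simp add: set_integrable_def)
    show "(\<lambda>t. indicat_real {a<..<b} t *\<^sub>R w t) \<in> borel_measurable lebesgue"
      using assms by (simp add: L2_on_def set_borel_measurable_def)
    have "x \<le> 1 + x\<^sup>2" for x :: real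
    proof -
      have "0 \<le> (x - 1/2)\<^sup>2" by simp
      then show ?thesis by (simp add: power2_eq_square algebra_simps)
    qed
    then show "AE t in lebesgue. norm (indicat_real {a<..<b} t *\<^sub>R w t) \<le> norm (indicat_real {a<..<b} t *\<^sub>R (1 + (norm (w t))\<^sup>2))"
      by (intro AE_I2) (auto simp: indicator_def)
  qed
  then show ?thesis
    by (rule absolutely_integrable_spike_set)
       (auto intro: negligible_subset[of "{a, b}"] simp: negligible_insert)
qed

lemma L2_on_continuous:
  fixes w :: "real \<Rightarrow> 'b::euclidean_space"
  assumes "continuous_on {a..b} w"
  shows "L2_on a b w"
proof -
  have 1: "set_integrable lebesgue {a<..<b} w"
    by (rule set_integrable_subset[of _ "{a..b}"]) (auto intro: absolutely_integrable_continuous_real assms)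
  have 2: "set_integrable lebesgue {a<..<b} (\<lambda>t. (norm (w t))\<^sup>2)"
    by (rule set_integrable_subset[of _ "{a..b}"])
       (auto intro!: absolutely_integrable_continuous_real continuous_intros assms)
  show ?thesis
    using borel_measurable_integrable 1 2 by (auto simp: L2_on_def set_integrable_def set_borel_measurable_def)
qed

lemma primitive_on_linear:
  assumes P: "primitive_on a b V w" and h: "bounded_linear (h :: 'b::euclidean_space \<Rightarrow> 'c::euclidean_space)"
  shows "primitive_on a b (\<lambda>t. h (V t)) (\<lambda>t. h (w t))"
  unfolding primitive_on_def
proof (intro conjI ballI)
  show "(\<lambda>t. h (w t)) absolutely_integrable_on {a..b}"
    using P by (intro absolutely_integrable_linear[OF _ h, unfolded o_def]) (simp add: primitive_on_def)
  fix t assume "t \<in> {a..b}"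
  then have "(w has_integral V t - V a) {a..t}" using P by (simp add: primitive_on_def)
  from has_integral_linear[OF this h]
  show "((\<lambda>t. h (w t)) has_integral h (V t) - h (V a)) {a..t}"
    by (simp add: o_def linear_diff[OF bounded_linear.linear[OF h]])
qed

lemma primitive_on_sum:
  assumes "finite I" "\<And>i. i \<in> I \<Longrightarrow> primitive_on a b (V i) (w i)"
  shows "primitive_on a b (\<lambda>t. \<Sum>i\<in>I. V i t) (\<lambda>t. \<Sum>i\<in>I. w i t)"
  unfolding primitive_on_def
proof (intro conjI ballI)
  show "(\<lambda>t. \<Sum>i\<in>I. w i t) absolutely_integrable_on {a..b}"
    using assms by (intro absolutely_integrable_sum) (auto simp: primitive_on_def)
  fix t assume "t \<in> {a..b}"
  then show "((\<lambda>t. \<Sum>i\<in>I. w i t) has_integral (\<Sum>i\<in>I. V i t) - (\<Sum>i\<in>I. V i a)) {a..t}"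
    unfolding sum_subtractf[symmetric] using assms by (intro has_integral_sum) (auto simp: primitive_on_def)
qed

lemma primitive_on_cong:
  assumes "primitive_on a b V w" "\<And>t. t \<in> {a..b} \<Longrightarrow> V t = V' t" "\<And>t. t \<in> {a..b} \<Longrightarrow> w t = w' t"
  shows "primitive_on a b V' w'"
  unfolding primitive_on_def
proof (intro conjI ballI)
  show "w' absolutely_integrable_on {a..b}"
    using assms(1,3) set_integrable_cong[of lebesgue lebesgue "{a..b}" "{a..b}" w w'] by (simp add: primitive_on_def)
  fix t assume t: "t \<in> {a..b}"
  then have "V t = V' t" "V a = V' a" using assms(2) by auto
  moreover have "(w has_integral V t - V a) {a..t}" using assms(1) t by (simp add: primitive_on_def)
  ultimately have "(w has_integral V' t - V' a) {a..t}" by simp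
  then show "(w' has_integral V' t - V' a) {a..t}"
    by (rule has_integral_eq[rotated]) (use assms(3) t in auto)
qed

section \<open>Symmetry of second derivatives\<close>

lemma Ck_on_1D:
  assumes "Ck_on (Suc k) U f" "x \<in> U"
  shows "(f has_derivative frechet_derivative f (at x)) (at x)"
  using assms by (simp add: frechet_derivative_works)

lemma Ck_on_continuous: "Ck_on k S f \<Longrightarrow> continuous_on S f"
  using Ck_on_mono[of 0 k S f] by simp

lemma Ck_on_frechet: "Ck_on (Suc k) S f \<Longrightarrow> Ck_on k S (\<lambda>x. frechet_derivative f (at x) v)"
  by simp

lemma frechet_derivative_linear_at:
  assumes "Ck_on (Suc k) U f" "x \<in> U"
  shows "linear (frechet_derivative f (at x))"
  by (rule has_derivative_linear[OF Ck_on_1D[OF assms]])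

text \<open>
  The mean value theorem, applied once in direction \<open>v\<close> and once in direction \<open>w\<close>.
\<close>

lemma second_difference_mean_value:
  fixes f :: "'a::real_normed_vector \<Rightarrow> real"
  assumes U: "open U" and f: "Ck_on 2 U f" and t: "t > 0"
    and sub: "\<And>p q. p \<in> {0..t} \<Longrightarrow> q \<in> {0..t} \<Longrightarrow> x + p *\<^sub>R v + q *\<^sub>R w \<in> U"
  obtains p q where "p \<in> {0..t}" "q \<in> {0..t}"
    "f (x + t *\<^sub>R v + t *\<^sub>R w) - f (x + t *\<^sub>R v) - f (x + t *\<^sub>R w) + f x =
      t\<^sup>2 * frechet_derivative (\<lambda>y. frechet_derivative f (at y) v) (at (x + p *\<^sub>R v + q *\<^sub>R w)) w"
proof -
  have f1: "Ck_on (Suc (Suc 0)) U f" using f by (simp add: numeral_2_eq_2 del: Ck_on.simps)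
  define h where "h p = f (x + p *\<^sub>R v + t *\<^sub>R w) - f (x + p *\<^sub>R v)" for p
  have hd: "(h has_derivative (\<lambda>d. frechet_derivative f (at (x + p *\<^sub>R v + t *\<^sub>R w)) (d *\<^sub>R v)
        - frechet_derivative f (at (x + p *\<^sub>R v)) (d *\<^sub>R v))) (at p)" if p: "p \<in> {0..t}" for p
    unfolding h_def
  proof (intro has_derivative_diff)
    show "((\<lambda>p. f (x + p *\<^sub>R v + t *\<^sub>R w)) has_derivative (\<lambda>d. frechet_derivative f (at (x + p *\<^sub>R v + t *\<^sub>R w)) (d *\<^sub>R v))) (at p)"
      by (rule has_derivative_compose[of "\<lambda>p. x + p *\<^sub>R v + t *\<^sub>R w", OF _ Ck_on_1D[OF f1]])
         (use sub[OF p, of t] t in \<open>auto intro!: derivative_eq_intros\<close>)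
    show "((\<lambda>p. f (x + p *\<^sub>R v)) has_derivative (\<lambda>d. frechet_derivative f (at (x + p *\<^sub>R v)) (d *\<^sub>R v))) (at p)"
      by (rule has_derivative_compose[of "\<lambda>p. x + p *\<^sub>R v", OF _ Ck_on_1D[OF f1]])
         (use sub[OF p, of 0] t in \<open>auto intro!: derivative_eq_intros\<close>)
  qed
  obtain p where p: "p \<in> {0<..<t}" "h t - h 0 = frechet_derivative f (at (x + p *\<^sub>R v + t *\<^sub>R w)) ((t - 0) *\<^sub>R v)
        - frechet_derivative f (at (x + p *\<^sub>R v)) ((t - 0) *\<^sub>R v)"
    using mvt_simple[OF t, where f = h, OF has_derivative_at_withinI[OF hd]] by auto
  have p': "p \<in> {0..t}" using p(1) by auto
  define F where "F = (\<lambda>y. frechet_derivative f (at y) v)"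
  have F: "Ck_on (Suc 0) U F" unfolding F_def by (rule Ck_on_frechet[OF f1])
  define k where "k q = F (x + p *\<^sub>R v + q *\<^sub>R w)" for q
  have kd: "(k has_derivative (\<lambda>d. frechet_derivative F (at (x + p *\<^sub>R v + q *\<^sub>R w)) (d *\<^sub>R w))) (at q)"
    if q: "q \<in> {0..t}" for q
    unfolding k_def
    by (rule has_derivative_compose[of "\<lambda>q. x + p *\<^sub>R v + q *\<^sub>R w", OF _ Ck_on_1D[OF F]])
       (use sub[OF p' q] in \<open>auto intro!: derivative_eq_intros\<close>)
  obtain q where q: "q \<in> {0<..<t}" "k t - k 0 = frechet_derivative F (at (x + p *\<^sub>R v + q *\<^sub>R w)) ((t - 0) *\<^sub>R w)"
    using mvt_simple[OF t, where f = k, OF has_derivative_at_withinI[OF kd]] by auto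
  have q': "q \<in> {0..t}" using q(1) by auto
  note l = linear_scale[OF frechet_derivative_linear_at[OF f1]]
  have "h t - h 0 = t * (k t - k 0)"
    using l[OF sub[OF p', of t], of t v] l[OF sub[OF p', of 0], of t v] p(2) t
    by (simp add: k_def F_def right_diff_distrib)
  moreover have "k t - k 0 = t * frechet_derivative F (at (x + p *\<^sub>R v + q *\<^sub>R w)) w"
    using q(2) linear_scale[OF frechet_derivative_linear_at[OF F sub[OF p' q']], of t w] by simp
  ultimately show thesis
    using p' q' that by (simp add: h_def F_def power2_eq_square algebra_simps)
qed

text \<open>
  The second difference is symmetric in \<open>v\<close> and \<open>w\<close>. For small \<open>t\<close> it is \<open>t\<^sup>2\<close> times either mixed
  derivative at a nearby point, so by continuity both mixed derivatives agree at \<open>x\<close>.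
\<close>

lemma second_derivative_symmetric_real:
  fixes f :: "'a::real_normed_vector \<Rightarrow> real"
  assumes U: "open U" and f: "Ck_on 2 U f" and x: "x \<in> U"
  shows "frechet_derivative (\<lambda>y. frechet_derivative f (at y) v) (at x) w =
         frechet_derivative (\<lambda>y. frechet_derivative f (at y) w) (at x) v"
proof (rule ccontr)
  define A where "A = (\<lambda>v w x. frechet_derivative (\<lambda>y. frechet_derivative f (at y) v) (at x) w)"
  assume "\<not> ?thesis"
  then have ne: "A v w x \<noteq> A w v x" by (simp add: A_def)
  have f1: "Ck_on (Suc (Suc 0)) U f" using f by (simp add: numeral_2_eq_2 del: Ck_on.simps)
  have cA: "isCont (A v w) x" for v w
  proof -
    have "continuous_on U (A v w)" unfolding A_def
      using Ck_on_frechet[OF Ck_on_frechet[OF f1]] by simp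
    then show ?thesis using U x continuous_on_eq_continuous_at by blast
  qed
  define e where "e = dist (A v w x) (A w v x) / 2"
  have e: "e > 0" using ne by (simp add: e_def)
  obtain d1 where d1: "d1 > 0" "\<And>y. dist y x < d1 \<Longrightarrow> dist (A v w y) (A v w x) < e"
    using cA[of v w] e unfolding continuous_at_eps_delta by blast
  obtain d2 where d2: "d2 > 0" "\<And>y. dist y x < d2 \<Longrightarrow> dist (A w v y) (A w v x) < e"
    using cA[of w v] e unfolding continuous_at_eps_delta by blast
  obtain d3 where d3: "d3 > 0" "\<And>y. dist y x < d3 \<Longrightarrow> y \<in> U"
    using U x by (meson open_dist)
  define d where "d = min d1 (min d2 d3)"
  have d: "d > 0" "\<And>y. dist y x < d \<Longrightarrow> y \<in> U" using d1(1) d2(1) d3 by (auto simp: d_def)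
  define t where "t = d / (2 * (norm v + norm w + 1))"
  have n: "norm v + norm w + 1 > 0" by (simp add: add_nonneg_pos)
  have t: "t > 0" using d n by (auto simp: t_def)
  have near: "dist (x + p *\<^sub>R v + q *\<^sub>R w) x < d" if "p \<in> {0..t}" "q \<in> {0..t}" for p q
  proof -
    have "dist (x + p *\<^sub>R v + q *\<^sub>R w) x = norm (p *\<^sub>R v + q *\<^sub>R w)" by (simp add: dist_norm)
    also have "\<dots> \<le> p * norm v + q * norm w"
      using norm_triangle_ineq[of "p *\<^sub>R v" "q *\<^sub>R w"] that by simp
    also have "\<dots> \<le> t * norm v + t * norm w"
      using that by (intro add_mono mult_right_mono) auto
    also have "\<dots> < t * (2 * (norm v + norm w + 1))"
      using t n by (simp add: algebra_simps add_strict_increasing2)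
    also have "\<dots> = d" using n by (simp add: t_def)
    finally show ?thesis .
  qed
  obtain p q where pq: "p \<in> {0..t}" "q \<in> {0..t}"
    "f (x + t *\<^sub>R v + t *\<^sub>R w) - f (x + t *\<^sub>R v) - f (x + t *\<^sub>R w) + f x = t\<^sup>2 * A v w (x + p *\<^sub>R v + q *\<^sub>R w)"
    using second_difference_mean_value[OF U f t, of x v w] near d(2) unfolding A_def by blast
  have near': "dist (x + p *\<^sub>R w + q *\<^sub>R v) x < d" if "p \<in> {0..t}" "q \<in> {0..t}" for p q
    using near[OF that(2,1)] by (simp add: add_ac)
  obtain p' q' where pq': "p' \<in> {0..t}" "q' \<in> {0..t}"
    "f (x + t *\<^sub>R w + t *\<^sub>R v) - f (x + t *\<^sub>R w) - f (x + t *\<^sub>R v) + f x = t\<^sup>2 * A w v (x + p' *\<^sub>R w + q' *\<^sub>R v)"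
    using second_difference_mean_value[OF U f t, of x w v] near' d(2) unfolding A_def by blast
  have "t\<^sup>2 * A v w (x + p *\<^sub>R v + q *\<^sub>R w) = t\<^sup>2 * A w v (x + p' *\<^sub>R w + q' *\<^sub>R v)"
    using pq(3) pq'(3) by (simp add: algebra_simps)
  then have "A v w (x + p *\<^sub>R v + q *\<^sub>R w) = A w v (x + p' *\<^sub>R w + q' *\<^sub>R v)"
    using t by simp
  moreover have "dist (A v w (x + p *\<^sub>R v + q *\<^sub>R w)) (A v w x) < e"
    using near[OF pq(1,2)] by (intro d1) (simp add: d_def)
  moreover have "dist (A w v (x + p' *\<^sub>R w + q' *\<^sub>R v)) (A w v x) < e"
    using near'[OF pq'(1,2)] by (intro d2) (simp add: d_def)
  ultimately have "dist (A v w x) (A w v x) < e + e"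
    using dist_triangle_less_add dist_commute by metis
  then show False by (simp add: e_def)
qed

lemma frechet_derivative_inner:
  assumes "f differentiable (at x)"
  shows "frechet_derivative (\<lambda>y. f y \<bullet> b) (at x) v = frechet_derivative f (at x) v \<bullet> b"
proof -
  have "(f has_derivative frechet_derivative f (at x)) (at x)"
    using assms frechet_derivative_works by blast
  from has_derivative_inner_left[OF this, of b] show ?thesis
    by (metis frechet_derivative_at)
qed

lemma frechet_derivative_cong_open:
  assumes "open U" "x \<in> U" "\<And>y. y \<in> U \<Longrightarrow> f y = h y" "f differentiable (at x)"
  shows "frechet_derivative f (at x) = frechet_derivative h (at x)"
proof -
  have "(f has_derivative frechet_derivative f (at x)) (at x)"
    using assms frechet_derivative_works by blast
  then have "(h has_derivative frechet_derivative f (at x)) (at x)"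
    by (rule has_derivative_transform_within_open[OF _ assms(1,2)]) (use assms in auto)
  then show ?thesis by (rule frechet_derivative_at)
qed

lemma second_derivative_symmetric:
  fixes f :: "'a::real_normed_vector \<Rightarrow> 'b::euclidean_space"
  assumes U: "open U" and f: "Ck_on 2 U f" and x: "x \<in> U"
  shows "frechet_derivative (\<lambda>y. frechet_derivative f (at y) v) (at x) w =
         frechet_derivative (\<lambda>y. frechet_derivative f (at y) w) (at x) v"
proof (rule euclidean_eqI)
  fix b :: 'b assume "b \<in> Basis"
  have f1: "Ck_on (Suc (Suc 0)) U f" using f by (simp add: numeral_2_eq_2 del: Ck_on.simps)
  have d1: "f differentiable (at y)" if "y \<in> U" for y
    using f1 that by simp
  have d2: "(\<lambda>y. frechet_derivative f (at y) v) differentiable (at y)" if "y \<in> U" for y v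
    using f1 that by simp
  have d2b: "(\<lambda>y. frechet_derivative f (at y) v \<bullet> b) differentiable (at y)" if "y \<in> U" for y v
    using d2[OF that] by (intro differentiable_inner differentiable_const)
  have eq: "frechet_derivative (\<lambda>y. frechet_derivative (\<lambda>y. f y \<bullet> b) (at y) v) (at y) w
      = frechet_derivative (\<lambda>y. frechet_derivative f (at y) v) (at y) w \<bullet> b" if "y \<in> U" for v w y
  proof -
    have "frechet_derivative (\<lambda>y. frechet_derivative f (at y) v \<bullet> b) (at y) =
       frechet_derivative (\<lambda>y. frechet_derivative (\<lambda>y. f y \<bullet> b) (at y) v) (at y)"
      by (rule frechet_derivative_cong_open[OF U that])
         (simp_all add: frechet_derivative_inner[OF d1] d2b[OF that])
    then show ?thesis using frechet_derivative_inner[OF d2[OF that]] by metis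
  qed
  have "Ck_on 2 U (\<lambda>y. f y \<bullet> b)"
  proof -
    have "continuous_on U (\<lambda>y. frechet_derivative (\<lambda>y. frechet_derivative (\<lambda>y. f y \<bullet> b) (at y) v) (at y) w)" for v w
    proof (rule continuous_on_eq)
      show "continuous_on U (\<lambda>y. frechet_derivative (\<lambda>y. frechet_derivative f (at y) v) (at y) w \<bullet> b)"
        using f1 by (auto intro!: continuous_intros)
    qed (simp add: eq)
    moreover have "(\<lambda>y. frechet_derivative (\<lambda>y. f y \<bullet> b) (at y) v) differentiable (at y)" if y: "y \<in> U" for v y
    proof -
      obtain D where "((\<lambda>y. frechet_derivative f (at y) v \<bullet> b) has_derivative D) (at y)"
        using d2b[OF y] by (auto simp: differentiable_def)
      then have "((\<lambda>y. frechet_derivative (\<lambda>y. f y \<bullet> b) (at y) v) has_derivative D) (at y)"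
        by (rule has_derivative_transform_within_open[OF _ U y]) (use d1 frechet_derivative_inner in metis)
      then show ?thesis by (auto simp: differentiable_def)
    qed
    moreover have "(\<lambda>y. f y \<bullet> b) differentiable (at y)" if "y \<in> U" for y
      using d1[OF that] by (intro differentiable_inner differentiable_const)
    ultimately show ?thesis by (simp add: numeral_2_eq_2)
  qed
  from second_derivative_symmetric_real[OF U this x, of v w]
  show "frechet_derivative (\<lambda>y. frechet_derivative f (at y) v) (at x) w \<bullet> b =
         frechet_derivative (\<lambda>y. frechet_derivative f (at y) w) (at x) v \<bullet> b"
    by (simp add: eq[OF x])
qed

section \<open>Metrics in one chart\<close>

text \<open>
  What a Riemannian metric provides in one chart with coordinate domain \<open>U\<close>.
\<close>

definition local_metric ::
  "'e::euclidean_space set \<Rightarrow> ('m, 'e) metric \<Rightarrow> ('m, 'e) chart \<Rightarrow> bool" where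
  "local_metric U g c \<longleftrightarrow> open U \<and>
     (\<forall>x\<in>U. bilinear (g c x) \<and> (\<forall>v w. g c x v w = g c x w v) \<and> (\<forall>v. v \<noteq> 0 \<longrightarrow> g c x v v > 0)) \<and>
     (\<forall>v w. smooth_on U (\<lambda>x. g c x v w))"

lemma bilinear_expand:
  fixes h :: "'a::euclidean_space \<Rightarrow> 'b::euclidean_space \<Rightarrow> real"
  assumes "bilinear h"
  shows "h v w = (\<Sum>i\<in>Basis. \<Sum>j\<in>Basis. (v \<bullet> i) * (w \<bullet> j) * h i j)"
proof -
  have l: "linear (\<lambda>x. h x y)" "linear (h x)" for x y using assms by (auto simp: bilinear_def)
  have "h v w = h (\<Sum>i\<in>Basis. (v \<bullet> i) *\<^sub>R i) w" by (simp add: euclidean_representation)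
  also have "\<dots> = (\<Sum>i\<in>Basis. (v \<bullet> i) * h i w)"
    by (simp add: linear_sum[OF l(1)] linear_scale[OF l(1)] del: euclidean_representation)
  also have "\<dots> = (\<Sum>i\<in>Basis. (v \<bullet> i) * h i (\<Sum>j\<in>Basis. (w \<bullet> j) *\<^sub>R j))" by (simp add: euclidean_representation)
  also have "\<dots> = (\<Sum>i\<in>Basis. \<Sum>j\<in>Basis. (v \<bullet> i) * (w \<bullet> j) * h i j)"
    by (simp add: linear_sum[OF l(2)] linear_scale[OF l(2)] sum_distrib_left mult.assoc del: euclidean_representation)
  finally show ?thesis .
qed

lemma linear_expand:
  fixes h :: "'a::euclidean_space \<Rightarrow> real"
  assumes "linear h"
  shows "h v = (\<Sum>i\<in>Basis. (v \<bullet> i) * h i)"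
proof -
  have "h v = h (\<Sum>i\<in>Basis. (v \<bullet> i) *\<^sub>R i)" by (simp add: euclidean_representation)
  also have "\<dots> = (\<Sum>i\<in>Basis. (v \<bullet> i) * h i)"
    by (simp add: linear_sum[OF assms] linear_scale[OF assms] del: euclidean_representation)
  finally show ?thesis .
qed

text \<open>
  Boundedness is part of the notion because only bounded Lipschitz functions are closed under products.
\<close>

definition bounded_lipschitz :: "'a::metric_space set \<Rightarrow> ('a \<Rightarrow> real) \<Rightarrow> bool" where
  "bounded_lipschitz S f \<longleftrightarrow>
     (\<exists>L B. L \<ge> 0 \<and> (\<forall>x\<in>S. \<bar>f x\<bar> \<le> B) \<and> (\<forall>x\<in>S. \<forall>y\<in>S. \<bar>f x - f y\<bar> \<le> L * dist x y))"

lemma bounded_lipschitz_const: "bounded_lipschitz S (\<lambda>_. k)"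
  unfolding bounded_lipschitz_def by (rule exI[of _ 0], rule exI[of _ "\<bar>k\<bar>"]) auto

lemma bounded_lipschitz_add:
  assumes "bounded_lipschitz S f" "bounded_lipschitz S h"
  shows "bounded_lipschitz S (\<lambda>x. f x + h x)"
proof -
  obtain L B where 1: "L \<ge> 0" "\<And>x. x \<in> S \<Longrightarrow> \<bar>f x\<bar> \<le> B" "\<And>x y. x \<in> S \<Longrightarrow> y \<in> S \<Longrightarrow> \<bar>f x - f y\<bar> \<le> L * dist x y"
    using assms(1) unfolding bounded_lipschitz_def by blast
  obtain M C where 2: "M \<ge> 0" "\<And>x. x \<in> S \<Longrightarrow> \<bar>h x\<bar> \<le> C" "\<And>x y. x \<in> S \<Longrightarrow> y \<in> S \<Longrightarrow> \<bar>h x - h y\<bar> \<le> M * dist x y"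
    using assms(2) unfolding bounded_lipschitz_def by blast
  have "\<bar>f x + h x\<bar> \<le> B + C" if "x \<in> S" for x using 1(2)[OF that] 2(2)[OF that] by linarith
  moreover have "\<bar>f x + h x - (f y + h y)\<bar> \<le> (L + M) * dist x y" if "x \<in> S" "y \<in> S" for x y
    using 1(3)[OF that] 2(3)[OF that] by (simp add: distrib_right)
  ultimately show ?thesis
    unfolding bounded_lipschitz_def using 1(1) 2(1) by (intro exI[of _ "L + M"] exI[of _ "B + C"]) auto
qed

lemma bounded_lipschitz_mult:
  assumes "bounded_lipschitz S f" "bounded_lipschitz S h"
  shows "bounded_lipschitz S (\<lambda>x. f x * h x)"
proof -
  obtain L B where 1: "L \<ge> 0" "\<And>x. x \<in> S \<Longrightarrow> \<bar>f x\<bar> \<le> B" "\<And>x y. x \<in> S \<Longrightarrow> y \<in> S \<Longrightarrow> \<bar>f x - f y\<bar> \<le> L * dist x y"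
    using assms(1) unfolding bounded_lipschitz_def by blast
  obtain M C where 2: "M \<ge> 0" "\<And>x. x \<in> S \<Longrightarrow> \<bar>h x\<bar> \<le> C" "\<And>x y. x \<in> S \<Longrightarrow> y \<in> S \<Longrightarrow> \<bar>h x - h y\<bar> \<le> M * dist x y"
    using assms(2) unfolding bounded_lipschitz_def by blast
  have 3: "\<bar>f x * h x\<bar> \<le> \<bar>B\<bar> * \<bar>C\<bar>" if "x \<in> S" for x
    unfolding abs_mult using 1(2)[OF that] 2(2)[OF that] by (intro mult_mono) auto
  have "\<bar>f x * h x - f y * h y\<bar> \<le> (\<bar>B\<bar> * M + \<bar>C\<bar> * L) * dist x y" if "x \<in> S" "y \<in> S" for x y
  proof -
    have "f x * h x - f y * h y = f x * (h x - h y) + h y * (f x - f y)" by (simp add: algebra_simps)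
    also have "\<bar>\<dots>\<bar> \<le> \<bar>f x\<bar> * \<bar>h x - h y\<bar> + \<bar>h y\<bar> * \<bar>f x - f y\<bar>"
      unfolding abs_mult[symmetric] by (rule abs_triangle_ineq)
    also have "\<dots> \<le> \<bar>B\<bar> * (M * dist x y) + \<bar>C\<bar> * (L * dist x y)"
      using 1(2)[OF that(1)] 2(2)[OF that(2)] 1(3)[OF that] 2(3)[OF that]
      by (intro add_mono mult_mono) auto
    finally show ?thesis by (simp add: algebra_simps)
  qed
  then show ?thesis
    unfolding bounded_lipschitz_def using 1(1) 2(1) 3
    by (intro exI[of _ "\<bar>B\<bar> * M + \<bar>C\<bar> * L"] exI[of _ "\<bar>B\<bar> * \<bar>C\<bar>"]) auto
qed

lemma bounded_lipschitz_sum: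
  assumes "finite I" "\<And>i. i \<in> I \<Longrightarrow> bounded_lipschitz S (f i)"
  shows "bounded_lipschitz S (\<lambda>x. \<Sum>i\<in>I. f i x)"
  using assms by (induction I) (auto intro: bounded_lipschitz_const bounded_lipschitz_add)

lemma bounded_lipschitz_cmult: "bounded_lipschitz S f \<Longrightarrow> bounded_lipschitz S (\<lambda>x. k * f x)"
  by (rule bounded_lipschitz_mult[OF bounded_lipschitz_const])

lemma bounded_lipschitz_cong:
  "(\<And>x. x \<in> S \<Longrightarrow> f x = h x) \<Longrightarrow> bounded_lipschitz S h \<Longrightarrow> bounded_lipschitz S f"
  unfolding bounded_lipschitz_def by simp

lemma bounded_lipschitz_fst:
  assumes "bounded_lipschitz A f" shows "bounded_lipschitz (A \<times> B) (\<lambda>p. f (fst p))"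
proof -
  obtain L C where 1: "L \<ge> 0" "\<And>x. x \<in> A \<Longrightarrow> \<bar>f x\<bar> \<le> C" "\<And>x y. x \<in> A \<Longrightarrow> y \<in> A \<Longrightarrow> \<bar>f x - f y\<bar> \<le> L * dist x y"
    using assms(1) unfolding bounded_lipschitz_def by blast
  have "\<bar>f (fst p) - f (fst q)\<bar> \<le> L * dist p q" if "p \<in> A \<times> B" "q \<in> A \<times> B" for p q
    using 1(3)[of "fst p" "fst q"] that mult_left_mono[OF dist_fst_le 1(1), of p q] by (auto simp: mem_Times_iff)
  then show ?thesis
    unfolding bounded_lipschitz_def using 1(1,2) by (intro exI[of _ L] exI[of _ C]) auto
qed

lemma bounded_lipschitz_coordinate:
  assumes "i \<in> Basis" shows "bounded_lipschitz (A \<times> cball 0 R) (\<lambda>p. snd p \<bullet> (i :: 'e::euclidean_space))"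
proof -
  have "\<bar>snd p \<bullet> i\<bar> \<le> R" if "p \<in> A \<times> cball 0 R" for p
    using Basis_le_norm[OF assms, of "snd p"] that by (auto simp: mem_Times_iff)
  moreover have "\<bar>snd p \<bullet> i - snd q \<bullet> i\<bar> \<le> 1 * dist p q" for p q :: "'a \<times> 'e"
    using Basis_le_norm[OF assms, of "snd p - snd q"] dist_snd_le[of p q] by (simp add: dist_norm inner_diff_left)
  ultimately show ?thesis
    unfolding bounded_lipschitz_def by (intro exI[of _ 1] exI[of _ R]) auto
qed

text \<open>
  On a compact ball the partial derivatives are bounded, and a ball is convex.
\<close>

lemma C1_bounded_lipschitz:
  fixes f :: "'e::euclidean_space \<Rightarrow> real"
  assumes "Ck_on (Suc 0) U f" "cball x r \<subseteq> U"
  shows "bounded_lipschitz (cball x r) f"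
proof -
  let ?D = "\<lambda>y. frechet_derivative f (at y)"
  have bd: "\<exists>B. \<forall>y\<in>cball x r. \<bar>h y\<bar> \<le> B" if "continuous_on U h" for h :: "'e \<Rightarrow> real"
  proof -
    have "bounded (h ` cball x r)"
      by (intro compact_imp_bounded compact_continuous_image) (auto intro: continuous_on_subset[OF that assms(2)])
    then show ?thesis by (auto simp: bounded_iff)
  qed
  have "\<forall>i. \<exists>B. \<forall>y\<in>cball x r. \<bar>?D y i\<bar> \<le> B"
    using assms(1) by (auto intro!: bd)
  then obtain M where M: "\<And>i y. y \<in> cball x r \<Longrightarrow> \<bar>?D y i\<bar> \<le> M i" by metis
  obtain B where B: "\<And>y. y \<in> cball x r \<Longrightarrow> \<bar>f y\<bar> \<le> B" using bd[OF Ck_on_continuous[OF assms(1)]] by blast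
  define L where "L = (\<Sum>i\<in>Basis. \<bar>M i\<bar>)"
  have L: "\<bar>f y - f z\<bar> \<le> L * dist y z" if "y \<in> cball x r" "z \<in> cball x r" for y z
  proof -
    have "norm (f y - f z) \<le> L * norm (y - z)"
    proof (rule differentiable_bound[of "cball x r" f ?D, OF convex_cball])
      fix y assume y: "y \<in> cball x r"
      then have yU: "y \<in> U" using assms(2) by blast
      show "(f has_derivative ?D y) (at y within cball x r)"
        using Ck_on_1D[OF assms(1) yU] by (rule has_derivative_at_withinI)
      show "onorm (?D y) \<le> L"
      proof (rule onorm_le)
        fix v
        have "?D y v = (\<Sum>i\<in>Basis. (v \<bullet> i) * ?D y i)"
          by (rule linear_expand[OF frechet_derivative_linear_at[OF assms(1) yU]])
        also have "\<bar>\<dots>\<bar> \<le> (\<Sum>i\<in>Basis. \<bar>M i\<bar> * norm v)"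
        proof (rule order.trans[OF sum_abs], rule sum_mono)
          fix i :: 'e assume "i \<in> Basis"
          then have "\<bar>v \<bullet> i\<bar> * \<bar>?D y i\<bar> \<le> norm v * \<bar>M i\<bar>"
            using M[OF y, of i] by (intro mult_mono Basis_le_norm) auto
          then show "\<bar>v \<bullet> i * ?D y i\<bar> \<le> \<bar>M i\<bar> * norm v" by (simp add: abs_mult mult.commute)
        qed
        finally show "norm (?D y v) \<le> L * norm v" by (simp add: L_def sum_distrib_right)
      qed
    qed (use that in auto)
    then show ?thesis by (simp add: dist_norm)
  qed
  have "L \<ge> 0" by (simp add: L_def sum_nonneg)
  then show ?thesis unfolding bounded_lipschitz_def using L B by blast
qed

context
  fixes g :: "('m, 'e::euclidean_space) metric" and c :: "('m, 'e) chart" and U :: "'e set"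
  assumes lm: "local_metric U g c"
begin

lemma lm_open: "open U" and lm_bilinear: "x \<in> U \<Longrightarrow> bilinear (g c x)"
  and lm_sym: "x \<in> U \<Longrightarrow> g c x v w = g c x w v"
  and lm_pos: "x \<in> U \<Longrightarrow> v \<noteq> 0 \<Longrightarrow> g c x v v > 0"
  and lm_Ck: "Ck_on k U (\<lambda>x. g c x v w)"
  using lm by (auto simp: local_metric_def smooth_on_def)

lemma lm_linear: "x \<in> U \<Longrightarrow> linear (g c x v)" "x \<in> U \<Longrightarrow> linear (\<lambda>w. g c x w v)"
  using lm_bilinear by (auto simp: bilinear_def)

lemma lm_has_derivative:
  "x \<in> U \<Longrightarrow> ((\<lambda>x. g c x v w) has_derivative (\<lambda>z. metric_deriv g c x z v w)) (at x)"
  unfolding metric_deriv_def using Ck_on_1D[OF lm_Ck] by auto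

lemma metric_deriv_linear: "x \<in> U \<Longrightarrow> linear (\<lambda>z. metric_deriv g c x z v w)"
  using lm_has_derivative has_derivative_linear by blast

lemma metric_deriv_expand:
  assumes x: "x \<in> U"
  shows "metric_deriv g c x z v w = (\<Sum>i\<in>Basis. \<Sum>j\<in>Basis. (v \<bullet> i) * (w \<bullet> j) * metric_deriv g c x z i j)"
proof -
  have "((\<lambda>x. \<Sum>i\<in>Basis. \<Sum>j\<in>Basis. (v \<bullet> i) * (w \<bullet> j) * g c x i j) has_derivative
     (\<lambda>z. \<Sum>i\<in>Basis. \<Sum>j\<in>Basis. (v \<bullet> i) * (w \<bullet> j) * metric_deriv g c x z i j)) (at x)"
    by (intro has_derivative_sum has_derivative_mult_right lm_has_derivative x)
  then have "((\<lambda>x. g c x v w) has_derivative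
     (\<lambda>z. \<Sum>i\<in>Basis. \<Sum>j\<in>Basis. (v \<bullet> i) * (w \<bullet> j) * metric_deriv g c x z i j)) (at x)"
    by (rule has_derivative_transform_within_open[OF _ lm_open x])
       (rule bilinear_expand[OF lm_bilinear, symmetric])
  from fun_cong[OF frechet_derivative_at[OF this], of z] show ?thesis
    by (simp add: metric_deriv_def[of g c x z v w])
qed

text \<open>
  The Leibniz rule for the inner product of two vector fields along a curve, in coordinates. It also
  covers the derivative of the metric along a straight line, which is used for the change of coordinates.
\<close>

lemma metric_along_curve:
  assumes X: "(X has_vector_derivative X') (at t within S)" and A: "(A has_vector_derivative A') (at t within S)"
    and B: "(B has_vector_derivative B') (at t within S)" and sub: "X ` S \<subseteq> U" and t: "t \<in> S"
  shows "((\<lambda>t. g c (X t) (A t) (B t)) has_vector_derivative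
     metric_deriv g c (X t) X' (A t) (B t) + g c (X t) A' (B t) + g c (X t) (A t) B') (at t within S)"
proof -
  have x: "X t \<in> U" using sub t by auto
  have d: "((\<lambda>t. \<Sum>i\<in>Basis. \<Sum>j\<in>Basis. (A t \<bullet> i) * (B t \<bullet> j) * g c (X t) i j) has_vector_derivative
     (\<Sum>i\<in>Basis. \<Sum>j\<in>Basis. (A t \<bullet> i) * (B t \<bullet> j) * metric_deriv g c (X t) X' i j
        + ((A t \<bullet> i) * (B' \<bullet> j) + (A' \<bullet> i) * (B t \<bullet> j)) * g c (X t) i j)) (at t within S)"
  proof (intro has_vector_derivative_sum)
    fix i j :: 'e
    have a: "((\<lambda>t. A t \<bullet> i) has_vector_derivative A' \<bullet> i) (at t within S)"
      "((\<lambda>t. B t \<bullet> j) has_vector_derivative B' \<bullet> j) (at t within S)"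
      using bounded_linear.has_vector_derivative[OF bounded_linear_inner_left] A B by auto
    have b: "((\<lambda>t. g c (X t) i j) has_vector_derivative metric_deriv g c (X t) X' i j) (at t within S)"
    proof -
      have "((\<lambda>t. g c (X t) i j) has_derivative (\<lambda>h. metric_deriv g c (X t) (h *\<^sub>R X') i j)) (at t within S)"
        using X unfolding has_vector_derivative_def
        by (rule has_derivative_compose) (rule lm_has_derivative[OF x])
      then show ?thesis
        unfolding has_vector_derivative_def using linear_scale[OF metric_deriv_linear[OF x]] by simp
    qed
    show "((\<lambda>t. (A t \<bullet> i) * (B t \<bullet> j) * g c (X t) i j) has_vector_derivative
       (A t \<bullet> i) * (B t \<bullet> j) * metric_deriv g c (X t) X' i j
        + ((A t \<bullet> i) * (B' \<bullet> j) + (A' \<bullet> i) * (B t \<bullet> j)) * g c (X t) i j) (at t within S)"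
      by (intro has_vector_derivative_mult a b)
  qed
  have e: "(\<Sum>i\<in>Basis. \<Sum>j\<in>Basis. (A t \<bullet> i) * (B t \<bullet> j) * metric_deriv g c (X t) X' i j
        + ((A t \<bullet> i) * (B' \<bullet> j) + (A' \<bullet> i) * (B t \<bullet> j)) * g c (X t) i j) =
     metric_deriv g c (X t) X' (A t) (B t) + g c (X t) A' (B t) + g c (X t) (A t) B'"
    unfolding metric_deriv_expand[OF x, of X' "A t" "B t"] bilinear_expand[OF lm_bilinear[OF x], of A' "B t"]
      bilinear_expand[OF lm_bilinear[OF x], of "A t" B'] sum.distrib[symmetric]
    by (intro sum.cong refl) (simp only: distrib_right distrib_left ac_simps)
  show ?thesis
    using d unfolding e
    by (rule has_vector_derivative_transform[OF t, rotated]) (use sub in \<open>auto intro!: bilinear_expand lm_bilinear\<close>)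
qed

text \<open>
  The representation theorem for linear functionals, here for the inner product \<open>g c x\<close>: lowering an
  index is an injective linear map and therefore onto.
\<close>

lemma metric_representation:
  assumes x: "x \<in> U" and l: "linear l"
  shows "\<exists>!u. \<forall>z. g c x u z = l z"
proof -
  define T where "T u = (\<Sum>b\<in>Basis. g c x u b *\<^sub>R b)" for u
  have T: "linear T"
  proof (rule linearI)
    show "T (u + v) = T u + T v" for u v
      using linear_add[OF lm_linear(2)[OF x]] by (simp add: T_def sum.distrib scaleR_add_left)
    show "T (k *\<^sub>R u) = k *\<^sub>R T u" for k u
      using linear_scale[OF lm_linear(2)[OF x]] by (simp add: T_def scaleR_sum_right)
  qed
  have Tb: "T u \<bullet> b = g c x u b" if "b \<in> Basis" for u b
    using that by (simp add: T_def inner_sum_left inner_Basis if_distrib cong: if_cong)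
  have inj: "inj T"
  proof (rule linear_injective_0[OF T, THEN iffD2], intro allI impI)
    fix u assume "T u = 0"
    then have "g c x u b = 0" if "b \<in> Basis" for b using Tb[OF that, of u] by simp
    note z = this
    have "g c x u u = (\<Sum>b\<in>Basis. (u \<bullet> b) * g c x u b)"
      by (rule linear_expand[OF lm_linear(1)[OF x]])
    then have "g c x u u = 0" using z by simp
    then show "u = 0" using lm_pos[OF x, of u] by force
  qed
  obtain u where "T u = (\<Sum>b\<in>Basis. l b *\<^sub>R b)"
    using linear_injective_imp_surjective[OF T inj] by (metis surj_def)
  then have "g c x u b = l b" if "b \<in> Basis" for b
    using Tb[OF that, of u] that by (simp add: inner_sum_left inner_Basis if_distrib cong: if_cong)
  note ub = this
  have u: "\<forall>z. g c x u z = l z"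
  proof
    fix z
    have "g c x u z = (\<Sum>b\<in>Basis. (z \<bullet> b) * g c x u b)"
      by (rule linear_expand[OF lm_linear(1)[OF x]])
    also have "\<dots> = (\<Sum>b\<in>Basis. (z \<bullet> b) * l b)" using ub by simp
    also have "\<dots> = l z" by (rule linear_expand[OF l, symmetric])
    finally show "g c x u z = l z" .
  qed
  show ?thesis
  proof (rule ex1I[of _ u], rule u)
    fix v assume "\<forall>z. g c x v z = l z"
    then have "T v = T u" using u by (simp add: T_def)
    then show "v = u" using inj by (simp add: inj_eq)
  qed
qed

text \<open>
  Half of the right-hand side of the Koszul formula for equal arguments, the only case that occurs in the
  covariant derivative of a velocity.
\<close>

definition koszul :: "'e \<Rightarrow> 'e \<Rightarrow> 'e \<Rightarrow> real" where
  "koszul x v z = metric_deriv g c x v v z - metric_deriv g c x z v v / 2"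

text \<open>
  The description operator in the definition of the Christoffel symbols is meaningful because the
  Koszul expression is linear in \<open>z\<close>.
\<close>

lemma christoffel_iff:
  assumes x: "x \<in> U"
  shows "u = christoffel g c x v v \<longleftrightarrow> (\<forall>z. g c x u z = koszul x v z)"
proof -
  have "linear (koszul x v)"
  proof (rule linearI)
    have l: "linear (metric_deriv g c x v v)"
    proof (rule linearI)
      show "metric_deriv g c x v v (a + b) = metric_deriv g c x v v a + metric_deriv g c x v v b" for a b
        by (subst (1 2 3) metric_deriv_expand[OF x]) (simp add: inner_add_left algebra_simps sum.distrib)
      show "metric_deriv g c x v v (k *\<^sub>R a) = k *\<^sub>R metric_deriv g c x v v a" for k a
        by (subst (1 2) metric_deriv_expand[OF x]) (simp add: sum_distrib_left algebra_simps)
    qed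
    show "koszul x v (a + b) = koszul x v a + koszul x v b" for a b
      using linear_add[OF l] linear_add[OF metric_deriv_linear[OF x]] by (simp add: koszul_def add_divide_distrib)
    show "koszul x v (k *\<^sub>R a) = k *\<^sub>R koszul x v a" for k a
      using linear_scale[OF l] linear_scale[OF metric_deriv_linear[OF x]] by (simp add: koszul_def algebra_simps)
  qed
  then have E: "\<exists>!u. \<forall>z. g c x u z = koszul x v z" by (rule metric_representation[OF x])
  have eq: "2 * g c x u z = metric_deriv g c x v v z + metric_deriv g c x v v z - metric_deriv g c x z v v
     \<longleftrightarrow> g c x u z = koszul x v z" for u z
    by (auto simp: koszul_def)
  show ?thesis
    unfolding christoffel_def eq using theI'[OF E] the1_equality[OF E, symmetric] by blast
qed

lemma christoffel_koszul:
  assumes "x \<in> U" shows "g c x (christoffel g c x v v) z = koszul x v z"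
  using christoffel_iff[OF assms] by blast

text \<open>
  Homogeneity of degree two; this is why affine reparametrizations of geodesics are geodesics.
\<close>

lemma christoffel_scale:
  assumes x: "x \<in> U"
  shows "christoffel g c x (k *\<^sub>R v) (k *\<^sub>R v) = k\<^sup>2 *\<^sub>R christoffel g c x v v"
proof (rule sym, subst christoffel_iff[OF x], intro allI)
  fix z
  have s: "metric_deriv g c x y (k *\<^sub>R v) (l *\<^sub>R w) = k * l * metric_deriv g c x y v w" for y k l v w
    by (subst (1 2) metric_deriv_expand[OF x]) (simp add: sum_distrib_left algebra_simps)
  have "koszul x (k *\<^sub>R v) z = k\<^sup>2 * koszul x v z"
    using s[of _ k v 1 z] linear_scale[OF metric_deriv_linear[OF x], of k v v z]
    by (simp add: koszul_def s linear_scale[OF metric_deriv_linear[OF x]] power2_eq_square algebra_simps)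
  then show "g c x (k\<^sup>2 *\<^sub>R christoffel g c x v v) z = koszul x (k *\<^sub>R v) z"
    using linear_scale[OF lm_linear(2)[OF x]] christoffel_koszul[OF x, of v z] by simp
qed

text \<open>
  The geodesic equation cancels the derivative of the metric in the Leibniz rule.
\<close>

lemma geodesic_speed_constant:
  assumes X: "(X has_vector_derivative V t) (at t within S)" and V: "(V has_vector_derivative a) (at t within S)"
    and geo: "cov_deriv g c (X t) (V t) (V t) a = 0" and sub: "X ` S \<subseteq> U" and t: "t \<in> S"
  shows "((\<lambda>t. g c (X t) (V t) (V t)) has_vector_derivative 0) (at t within S)"
proof -
  have x: "X t \<in> U" using sub t by auto
  have a: "a = - christoffel g c (X t) (V t) (V t)"
    using geo by (simp add: cov_deriv_def eq_neg_iff_add_eq_0)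
  have "g c (X t) a (V t) = - koszul (X t) (V t) (V t)"
    using a christoffel_koszul[OF x] linear_neg[OF lm_linear(2)[OF x]] by metis
  moreover have "g c (X t) (V t) a = g c (X t) a (V t)" by (rule lm_sym[OF x])
  ultimately show ?thesis
    using metric_along_curve[OF X V V sub t] by (simp add: koszul_def)
qed

lemma metric_continuous_on:
  assumes "continuous_on S X" "continuous_on S A" "continuous_on S B" "X ` S \<subseteq> U"
  shows "continuous_on S (\<lambda>s. g c (X s) (A s) (B s))"
proof -
  have "continuous_on S (\<lambda>s. \<Sum>i\<in>Basis. \<Sum>j\<in>Basis. (A s \<bullet> i) * (B s \<bullet> j) * g c (X s) i j)"
    using assms by (intro continuous_intros continuous_on_compose2[OF Ck_on_continuous[OF lm_Ck[of 0]]]) auto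
  then show ?thesis
    by (rule continuous_on_eq) (use assms(4) in \<open>auto intro!: bilinear_expand[symmetric] lm_bilinear\<close>)
qed

text \<open>
  By homogeneity it is enough to take the minimum over the compact set \<open>K\<close> times the unit sphere.
\<close>

lemma metric_uniformly_positive:
  assumes K: "compact K" "K \<subseteq> U"
  obtains m where "m > 0" "\<And>x z. x \<in> K \<Longrightarrow> m * (norm z)\<^sup>2 \<le> g c x z z"
proof (cases "K = {}")
  case True then show thesis using that[of 1] by simp
next
  case False
  let ?S = "K \<times> sphere (0::'e) 1"
  have "sphere (0::'e) 1 \<noteq> {}" by simp
  then have "?S \<noteq> {}" using False by blast
  moreover have "compact ?S" by (intro compact_Times K) simp
  moreover have "continuous_on ?S (\<lambda>p. g c (fst p) (snd p) (snd p))"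
    by (intro metric_continuous_on continuous_intros) (use K(2) in auto)
  ultimately obtain p where p: "p \<in> ?S" "\<And>q. q \<in> ?S \<Longrightarrow> g c (fst p) (snd p) (snd p) \<le> g c (fst q) (snd q) (snd q)"
    using continuous_attains_inf[of ?S "\<lambda>p. g c (fst p) (snd p) (snd p)"] by blast
  have "norm (snd p) = 1" "fst p \<in> U" using p(1) K(2) by (auto simp: mem_Times_iff)
  then have pos: "0 < g c (fst p) (snd p) (snd p)" by (intro lm_pos) auto
  show thesis
  proof (rule that[OF pos])
    fix x z assume x: "x \<in> K"
    then have xU: "x \<in> U" using K by blast
    show "g c (fst p) (snd p) (snd p) * (norm z)\<^sup>2 \<le> g c x z z"
    proof (cases "z = 0")
      case True
      then show ?thesis using linear_0[OF lm_linear(1)[OF xU]] by simp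
    next
      case False
      define y where "y = z /\<^sub>R norm z"
      have "(x, y) \<in> ?S" using x False by (simp add: y_def)
      from p(2)[OF this] have "g c (fst p) (snd p) (snd p) \<le> g c x y y" by simp
      moreover have "z = norm z *\<^sub>R y" using False by (simp add: y_def)
      then have "g c x z z = (norm z)\<^sup>2 * g c x y y"
        using linear_scale[OF lm_linear(1)[OF xU]] linear_scale[OF lm_linear(2)[OF xU]]
        by (metis mult.assoc power2_eq_square real_scaleR_def)
      ultimately show ?thesis by (simp add: mult.commute[of _ "(norm z)\<^sup>2"] mult_left_mono)
    qed
  qed
qed

lemma koszul_expand:
  assumes x: "x \<in> U"
  shows "koszul x v z =
    (\<Sum>k\<in>Basis. \<Sum>i\<in>Basis. \<Sum>j\<in>Basis. (v \<bullet> k) * ((v \<bullet> i) * ((z \<bullet> j) * metric_deriv g c x k i j)))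
    - (\<Sum>k\<in>Basis. \<Sum>i\<in>Basis. \<Sum>j\<in>Basis. (z \<bullet> k) * ((v \<bullet> i) * ((v \<bullet> j) * metric_deriv g c x k i j))) / 2"
proof -
  have "metric_deriv g c x y v w =
     (\<Sum>k\<in>Basis. \<Sum>i\<in>Basis. \<Sum>j\<in>Basis. (y \<bullet> k) * ((v \<bullet> i) * ((w \<bullet> j) * metric_deriv g c x k i j)))" for y v w
  proof -
    have "metric_deriv g c x y v w = (\<Sum>k\<in>Basis. (y \<bullet> k) * metric_deriv g c x k v w)"
      by (rule linear_expand[OF metric_deriv_linear[OF x]])
    also have "\<dots> = (\<Sum>k\<in>Basis. (y \<bullet> k) * (\<Sum>i\<in>Basis. \<Sum>j\<in>Basis. (v \<bullet> i) * (w \<bullet> j) * metric_deriv g c x k i j))"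
      by (intro sum.cong refl arg_cong[where f = "(*) _"] metric_deriv_expand[OF x])
    finally show ?thesis by (simp add: sum_distrib_left mult.assoc)
  qed
  note e = this
  show ?thesis by (simp only: koszul_def e[of v v z] e[of z v v])
qed

lemma metric_deriv_Ck: "Ck_on k U (\<lambda>x. metric_deriv g c x z v w)"
  unfolding metric_deriv_def by (rule Ck_on_frechet[OF lm_Ck])

lemma koszul_bounded_lipschitz:
  assumes "cball x r \<subseteq> U"
  shows "bounded_lipschitz (cball x r \<times> cball (0::'e) R) (\<lambda>p. koszul (fst p) (snd p) z)"
proof (rule bounded_lipschitz_cong)
  fix p assume "p \<in> cball x r \<times> cball (0::'e) R"
  then have "fst p \<in> U" using assms by auto
  then show "koszul (fst p) (snd p) z =
    (\<Sum>k\<in>Basis. \<Sum>i\<in>Basis. \<Sum>j\<in>Basis. (snd p \<bullet> k) * ((snd p \<bullet> i) * ((z \<bullet> j) * metric_deriv g c (fst p) k i j)))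
    + (- 1 / 2) * (\<Sum>k\<in>Basis. \<Sum>i\<in>Basis. \<Sum>j\<in>Basis. (z \<bullet> k) * ((snd p \<bullet> i) * ((snd p \<bullet> j) * metric_deriv g c (fst p) k i j)))"
    by (simp add: koszul_expand)
next
  have md: "bounded_lipschitz (cball x r \<times> cball 0 R) (\<lambda>p. metric_deriv g c (fst p) k i j)" for k i j
    by (rule bounded_lipschitz_fst[OF C1_bounded_lipschitz[OF metric_deriv_Ck assms]])
  show "bounded_lipschitz (cball x r \<times> cball 0 R) (\<lambda>p.
    (\<Sum>k\<in>Basis. \<Sum>i\<in>Basis. \<Sum>j\<in>Basis. (snd p \<bullet> k) * ((snd p \<bullet> i) * ((z \<bullet> j) * metric_deriv g c (fst p) k i j)))
    + (- 1 / 2) * (\<Sum>k\<in>Basis. \<Sum>i\<in>Basis. \<Sum>j\<in>Basis. (z \<bullet> k) * ((snd p \<bullet> i) * ((snd p \<bullet> j) * metric_deriv g c (fst p) k i j))))"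
    by (intro bounded_lipschitz_add bounded_lipschitz_sum bounded_lipschitz_cmult finite_Basis
         bounded_lipschitz_mult[OF bounded_lipschitz_coordinate] md)
qed

text \<open>
  The Christoffel symbols are the solution \<open>u\<close> of \<open>g c x u z = koszul x v z\<close>. Both sides are Lipschitz in
  \<open>x\<close> and \<open>v\<close>, and uniform positivity of the metric, tested with \<open>z\<close> equal to the difference of two
  solutions, transfers this to the solutions.
\<close>

lemma christoffel_lipschitz:
  assumes x: "x \<in> U"
  obtains r L where "r > 0" "L \<ge> 0" "cball x r \<subseteq> U"
    "\<And>p q. p \<in> cball x r \<times> cball 0 R \<Longrightarrow> q \<in> cball x r \<times> cball 0 R \<Longrightarrow>
       norm (christoffel g c (fst p) (snd p) (snd p) - christoffel g c (fst q) (snd q) (snd q)) \<le> L * dist p q"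
proof -
  obtain r where r: "r > 0" "cball x r \<subseteq> U"
    using lm_open x open_contains_cball by metis
  let ?K = "cball x r" and ?S = "cball x r \<times> cball (0::'e) R"
  let ?G = "\<lambda>p :: 'e \<times> 'e. christoffel g c (fst p) (snd p) (snd p)"
  obtain m where m: "m > 0" "\<And>y z. y \<in> ?K \<Longrightarrow> m * (norm z)\<^sup>2 \<le> g c y z z"
    using metric_uniformly_positive[of ?K] r by auto
  have "\<forall>z. \<exists>L B. L \<ge> 0 \<and> (\<forall>p\<in>?S. \<bar>koszul (fst p) (snd p) z\<bar> \<le> B) \<and>
      (\<forall>p\<in>?S. \<forall>q\<in>?S. \<bar>koszul (fst p) (snd p) z - koszul (fst q) (snd q) z\<bar> \<le> L * dist p q)"
    using koszul_bounded_lipschitz[OF r(2), of R] unfolding bounded_lipschitz_def by blast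
  then obtain LK BK where LK: "\<And>z. LK z \<ge> (0::real)" "\<And>p z. p \<in> ?S \<Longrightarrow> \<bar>koszul (fst p) (snd p) z\<bar> \<le> BK z"
    "\<And>p q z. p \<in> ?S \<Longrightarrow> q \<in> ?S \<Longrightarrow> \<bar>koszul (fst p) (snd p) z - koszul (fst q) (snd q) z\<bar> \<le> LK z * dist p q"
    by metis
  have "\<forall>i j. \<exists>L. L \<ge> 0 \<and> (\<forall>y\<in>?K. \<forall>z\<in>?K. \<bar>g c y i j - g c z i j\<bar> \<le> L * dist y z)"
    using C1_bounded_lipschitz[OF lm_Ck r(2)] unfolding bounded_lipschitz_def by blast
  then obtain LG where LG: "\<And>i j. LG i j \<ge> (0::real)"
    "\<And>i j y z. y \<in> ?K \<Longrightarrow> z \<in> ?K \<Longrightarrow> \<bar>g c y i j - g c z i j\<bar> \<le> LG i j * dist y z" by metis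
  define LK' where "LK' = (\<Sum>b\<in>Basis. LK b)"
  define BK' where "BK' = (\<Sum>b\<in>Basis. \<bar>BK b\<bar>)"
  define LG' where "LG' = (\<Sum>i\<in>Basis. \<Sum>j\<in>Basis. LG i j)"
  have nn: "LK' \<ge> 0" "BK' \<ge> 0" "LG' \<ge> 0"
    using LK LG by (auto simp: LK'_def BK'_def LG'_def intro!: sum_nonneg)
  have kl: "linear (koszul y v)" if "y \<in> U" for y v
  proof -
    have "koszul y v = g c y (christoffel g c y v v)"
      by (rule ext) (simp add: christoffel_koszul[OF that])
    then show ?thesis using lm_linear(1)[OF that] by simp
  qed
  have sumb: "\<bar>l z\<bar> \<le> (\<Sum>b\<in>Basis. B b) * norm z"
    if l: "linear l" and B: "\<And>b. b \<in> Basis \<Longrightarrow> \<bar>l b\<bar> \<le> B b" for l :: "'e \<Rightarrow> real" and B z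
  proof -
    have "\<bar>l z\<bar> = \<bar>\<Sum>b\<in>Basis. (z \<bullet> b) * l b\<bar>" using linear_expand[OF l, of z] by simp
    also have "\<dots> \<le> (\<Sum>b\<in>Basis. B b * norm z)"
    proof (rule order.trans[OF sum_abs], rule sum_mono)
      fix b :: 'e assume b: "b \<in> Basis"
      have "\<bar>z \<bullet> b\<bar> * \<bar>l b\<bar> \<le> norm z * B b"
        using b B[OF b] by (intro mult_mono Basis_le_norm) auto
      then show "\<bar>z \<bullet> b * l b\<bar> \<le> B b * norm z" by (simp add: abs_mult mult.commute)
    qed
    finally show ?thesis by (simp add: sum_distrib_right)
  qed
  have bound: "norm (?G p) \<le> BK' / m" if p: "p \<in> ?S" for p
  proof -
    have pK: "fst p \<in> ?K" and pU: "fst p \<in> U" using p r by auto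
    have "m * (norm (?G p))\<^sup>2 \<le> koszul (fst p) (snd p) (?G p)"
      using m(2)[OF pK] christoffel_koszul[OF pU] by metis
    also have "\<dots> \<le> BK' * norm (?G p)"
      using sumb[OF kl[OF pU, where v = "snd p"], where B = "\<lambda>b. \<bar>BK b\<bar>" and z = "?G p"] LK(2)[OF p] unfolding BK'_def
      by (meson abs_ge_self order_trans)
    finally have "norm (?G p) * (m * norm (?G p)) \<le> norm (?G p) * BK'" by (simp add: power2_eq_square mult_ac)
    then have "m * norm (?G p) \<le> BK'"
      using nn(2) by (cases "norm (?G p) = 0") auto
    then show ?thesis using m(1) by (simp add: field_simps)
  qed
  show thesis
  proof (rule that[of r "(LK' + LG' * (BK' / m)) / m"])
    show "r > 0" "cball x r \<subseteq> U" by (rule r)+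
    show "(LK' + LG' * (BK' / m)) / m \<ge> 0" using nn m(1) by simp
    fix p q assume p: "p \<in> ?S" and q: "q \<in> ?S"
    have pK: "fst p \<in> ?K" "fst q \<in> ?K" and pU: "fst p \<in> U" "fst q \<in> U" using p q r by auto
    define z where "z = ?G p - ?G q"
    have "g c (fst p) z z = g c (fst p) (?G p) z - g c (fst p) (?G q) z"
      unfolding z_def using linear_diff[OF lm_linear(2)[OF pU(1)]] by simp
    also have "\<dots> = (koszul (fst p) (snd p) z - koszul (fst q) (snd q) z) + (g c (fst q) (?G q) z - g c (fst p) (?G q) z)"
      using christoffel_koszul[OF pU(1)] christoffel_koszul[OF pU(2)] by simp
    also have "\<dots> \<le> LK' * dist p q * norm z + LG' * dist p q * (BK' / m) * norm z"
    proof (rule add_mono)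
      have "linear (\<lambda>z. koszul (fst p) (snd p) z - koszul (fst q) (snd q) z)"
        by (intro linear_compose_sub kl pU)
      from sumb[OF this, where B = "\<lambda>b. LK b * dist p q" and z = z]
      show "koszul (fst p) (snd p) z - koszul (fst q) (snd q) z \<le> LK' * dist p q * norm z"
        using LK(3)[OF p q] by (simp add: LK'_def sum_distrib_right)
      have "g c (fst q) (?G q) z - g c (fst p) (?G q) z =
          (\<Sum>i\<in>Basis. \<Sum>j\<in>Basis. (?G q \<bullet> i) * (z \<bullet> j) * (g c (fst q) i j - g c (fst p) i j))"
        unfolding bilinear_expand[OF lm_bilinear[OF pU(1)], of "?G q" z] bilinear_expand[OF lm_bilinear[OF pU(2)], of "?G q" z]
        by (simp add: sum_subtractf right_diff_distrib)
      also have "\<dots> \<le> (\<Sum>i\<in>Basis. \<Sum>j\<in>Basis. (BK' / m) * norm z * (LG i j * dist p q))"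
      proof (intro sum_mono)
        fix i j :: 'e assume ij: "i \<in> Basis" "j \<in> Basis"
        have "\<bar>g c (fst q) i j - g c (fst p) i j\<bar> \<le> LG i j * dist p q"
          using LG(2)[OF pK(2,1), of i j] mult_left_mono[OF dist_fst_le[of q p] LG(1)[of i j]] by (simp add: dist_commute)
        then have "\<bar>?G q \<bullet> i\<bar> * \<bar>z \<bullet> j\<bar> * \<bar>g c (fst q) i j - g c (fst p) i j\<bar> \<le> (BK' / m) * norm z * (LG i j * dist p q)"
          using Basis_le_norm[OF ij(1), of "?G q"] bound[OF q] Basis_le_norm[OF ij(2), of z] m nn
          by (intro mult_mono) auto
        then show "(?G q \<bullet> i) * (z \<bullet> j) * (g c (fst q) i j - g c (fst p) i j) \<le> (BK' / m) * norm z * (LG i j * dist p q)"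
          unfolding abs_mult[symmetric] by linarith
      qed
      also have "\<dots> = LG' * dist p q * (BK' / m) * norm z"
        by (simp add: LG'_def sum_distrib_left sum_distrib_right mult_ac)
      finally show "g c (fst q) (?G q) z - g c (fst p) (?G q) z \<le> LG' * dist p q * (BK' / m) * norm z" .
    qed
    finally have "m * (norm z)\<^sup>2 \<le> LK' * dist p q * norm z + LG' * dist p q * (BK' / m) * norm z"
      using m(2)[OF pK(1), of z] by simp
    then have "norm z * (m * norm z) \<le> norm z * ((LK' + LG' * (BK' / m)) * dist p q)"
      by (simp add: power2_eq_square algebra_simps)
    then have "m * norm z \<le> (LK' + LG' * (BK' / m)) * dist p q"
      using nn m(1) by (cases "norm z = 0") auto
    then have "norm z \<le> ((LK' + LG' * (BK' / m)) * dist p q) / m"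
      using m(1) by (simp add: pos_le_divide_eq mult.commute)
    then show "norm (?G p - ?G q) \<le> (LK' + LG' * (BK' / m)) / m * dist p q"
      by (simp add: z_def)
  qed
qed

lemma christoffel_continuous_on:
  assumes "continuous_on S X" "continuous_on S V" "X ` S \<subseteq> U"
  shows "continuous_on S (\<lambda>s. christoffel g c (X s) (V s) (V s))"
proof -
  let ?G = "\<lambda>p :: 'e \<times> 'e. christoffel g c (fst p) (snd p) (snd p)"
  have "isCont ?G p" if pU: "fst p \<in> U" for p
  proof -
    obtain r L where r: "r > 0" "L \<ge> 0" "cball (fst p) r \<subseteq> U" and L: "\<And>p' q. p' \<in> cball (fst p) r \<times> cball 0 (norm (snd p) + 1) \<Longrightarrow>
        q \<in> cball (fst p) r \<times> cball 0 (norm (snd p) + 1) \<Longrightarrow> norm (?G p' - ?G q) \<le> L * dist p' q"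
      by (rule christoffel_lipschitz[OF pU, where R = "norm (snd p) + 1"]) blast
    define S where "S = ball (fst p) r \<times> ball (0::'e) (norm (snd p) + 1)"
    have "L-lipschitz_on S ?G"
      by (rule lipschitz_onI) (use L r in \<open>auto simp: S_def dist_norm\<close>)
    then have "continuous_on S ?G" by (rule lipschitz_on_continuous_on)
    moreover have "open S" by (auto simp: S_def open_Times)
    moreover have "p \<in> S" using r by (auto simp: S_def mem_Times_iff)
    ultimately show ?thesis using continuous_on_eq_continuous_at by blast
  qed
  then have "continuous_on (U \<times> UNIV) ?G"
    by (auto intro!: continuous_at_imp_continuous_on)
  then have "continuous_on S (\<lambda>s. ?G (X s, V s))"
    by (rule continuous_on_compose2) (use assms in \<open>auto intro!: continuous_intros\<close>)
  then show ?thesis by simp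
qed

end

section \<open>Change of coordinates\<close>

text \<open>
  Two charts are compared by a map \<open>\<tau>\<close> on an open set \<open>W\<close> that is isometric for their metrics.
\<close>

context
  fixes g :: "('m, 'e::euclidean_space) metric" and c d :: "('m, 'e) chart" and U U' W :: "'e set"
    and \<tau> :: "'e \<Rightarrow> 'e"
  assumes lmc: "local_metric U g c" and lmd: "local_metric U' g d"
    and W: "open W" "W \<subseteq> U" "\<tau> ` W \<subseteq> U'" and C2: "Ck_on 2 W \<tau>"
    and iso: "\<And>x v w. x \<in> W \<Longrightarrow>
      g c x v w = g d (\<tau> x) (frechet_derivative \<tau> (at x) v) (frechet_derivative \<tau> (at x) w)"
begin

abbreviation (input) D\<tau> where "D\<tau> x \<equiv> frechet_derivative \<tau> (at x)"
abbreviation (input) D2\<tau> where "D2\<tau> x v \<equiv> frechet_derivative (\<lambda>y. frechet_derivative \<tau> (at y) v) (at x)"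

lemma C2_Suc: "Ck_on (Suc (Suc 0)) W \<tau>"
  using C2 by (simp add: numeral_2_eq_2 del: Ck_on.simps)

lemma transition_D: "x \<in> W \<Longrightarrow> (\<tau> has_derivative D\<tau> x) (at x)"
  "x \<in> W \<Longrightarrow> ((\<lambda>y. D\<tau> y v) has_derivative D2\<tau> x v) (at x)"
  by (rule Ck_on_1D[OF C2_Suc] Ck_on_1D[OF Ck_on_frechet[OF C2_Suc]]; assumption)+

text \<open>
  Both sides are the derivative at \<open>t = 0\<close> of the metric at \<open>x + t z\<close>, computed in the two charts.
\<close>

lemma metric_deriv_transform:
  assumes x: "x \<in> W"
  shows "metric_deriv g c x z v w = metric_deriv g d (\<tau> x) (D\<tau> x z) (D\<tau> x v) (D\<tau> x w)
    + g d (\<tau> x) (D2\<tau> x v z) (D\<tau> x w) + g d (\<tau> x) (D\<tau> x v) (D2\<tau> x w z)"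
proof -
  define S where "S = (\<lambda>t. x + t *\<^sub>R z) -` W"
  have S: "open S" "0 \<in> S"
    unfolding S_def using x by (auto intro!: open_vimage W continuous_intros)
  have X: "((\<lambda>t. x + t *\<^sub>R z) has_vector_derivative z) (at 0 within S)"
    by (auto intro!: derivative_eq_intros)
  have comp: "((\<lambda>t. h (x + t *\<^sub>R z)) has_vector_derivative h' z) (at 0 within S)"
    if "(h has_derivative h') (at x)" for h h' :: "'e \<Rightarrow> 'e"
  proof -
    have "((\<lambda>t. h (x + t *\<^sub>R z)) has_derivative (\<lambda>t. h' (t *\<^sub>R z))) (at 0 within S)"
      using X unfolding has_vector_derivative_def
      by (rule has_derivative_compose) (use that in simp)
    then show ?thesis
      unfolding has_vector_derivative_def using linear_scale[OF has_derivative_linear[OF that]] by simp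
  qed
  have 1: "((\<lambda>t. g c (x + t *\<^sub>R z) v w) has_vector_derivative metric_deriv g c x z v w) (at 0 within S)"
  proof -
    have sub: "(\<lambda>t. x + t *\<^sub>R z) ` S \<subseteq> U" using W(2) by (auto simp: S_def)
    have "x \<in> U" using W(2) x by blast
    then show ?thesis
      using metric_along_curve[OF lmc X has_vector_derivative_const has_vector_derivative_const sub S(2), of v w]
        linear_0[OF lm_linear(1)[OF lmc]] linear_0[OF lm_linear(2)[OF lmc]] by simp
  qed
  have 2: "((\<lambda>t. g d (\<tau> (x + t *\<^sub>R z)) (D\<tau> (x + t *\<^sub>R z) v) (D\<tau> (x + t *\<^sub>R z) w)) has_vector_derivative
      metric_deriv g d (\<tau> x) (D\<tau> x z) (D\<tau> x v) (D\<tau> x w)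
    + g d (\<tau> x) (D2\<tau> x v z) (D\<tau> x w) + g d (\<tau> x) (D\<tau> x v) (D2\<tau> x w z)) (at 0 within S)"
    using metric_along_curve[OF lmd comp[OF transition_D(1)[OF x]] comp[OF transition_D(2)[OF x, of v]]
        comp[OF transition_D(2)[OF x, of w]] _ S(2)] W(3)
    by (auto simp: S_def)
  have "((\<lambda>t. g c (x + t *\<^sub>R z) v w) has_vector_derivative
      metric_deriv g d (\<tau> x) (D\<tau> x z) (D\<tau> x v) (D\<tau> x w)
    + g d (\<tau> x) (D2\<tau> x v z) (D\<tau> x w) + g d (\<tau> x) (D\<tau> x v) (D2\<tau> x w z)) (at 0 within S)"
    by (rule has_vector_derivative_transform[OF S(2) _ 2]) (use iso in \<open>auto simp: S_def\<close>)
  with 1 show ?thesis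
    unfolding at_within_open[OF S(2,1)] by (rule vector_derivative_unique_at)
qed

text \<open>
  The differential of an isometry is injective, and domain and target have the same dimension.
\<close>

lemma transition_surj:
  assumes x: "x \<in> W" shows "surj (D\<tau> x)"
proof -
  have l: "linear (D\<tau> x)" by (rule has_derivative_linear[OF transition_D(1)[OF x]])
  have "inj (D\<tau> x)"
  proof (rule linear_injective_0[OF l, THEN iffD2], intro allI impI)
    fix v assume 0: "D\<tau> x v = 0"
    have "\<tau> x \<in> U'" using W(3) x by blast
    then have "g c x v v = 0" unfolding iso[OF x] 0 using linear_0[OF lm_linear(1)[OF lmd]] by blast
    then show "v = 0" using lm_pos[OF lmc, of x v] W(2) x by force
  qed
  then show ?thesis by (rule linear_inj_imp_surj[OF l])
qed

text \<open>
  Insert \<open>metric_deriv_transform\<close> into the Koszul formula. The symmetry of the second derivative of \<open>\<tau>\<close>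
  cancels all its occurrences except one.
\<close>

lemma christoffel_transform:
  assumes x: "x \<in> W"
  shows "christoffel g d (\<tau> x) (D\<tau> x v) (D\<tau> x v) = D\<tau> x (christoffel g c x v v) - D2\<tau> x v v"
proof (rule sym, subst christoffel_iff[OF lmd])
  show "\<tau> x \<in> U'" using W(3) x by blast
  have xU: "x \<in> U" using W(2) x by blast
  note l = lm_linear[OF lmd \<open>\<tau> x \<in> U'\<close>]
  show "\<forall>z. g d (\<tau> x) (D\<tau> x (christoffel g c x v v) - D2\<tau> x v v) z = koszul g d (\<tau> x) (D\<tau> x v) z"
  proof
    fix z'
    obtain z where z: "z' = D\<tau> x z" using transition_surj[OF x] by (auto simp: surj_def)
    have "g d (\<tau> x) (D\<tau> x (christoffel g c x v v)) z' = koszul g c x v z"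
      using iso[OF x] christoffel_koszul[OF lmc xU] z by simp
    also have "\<dots> = koszul g d (\<tau> x) (D\<tau> x v) z' + g d (\<tau> x) (D2\<tau> x v v) z'
      + g d (\<tau> x) (D\<tau> x v) (D2\<tau> x z v) - (g d (\<tau> x) (D2\<tau> x v z) (D\<tau> x v) + g d (\<tau> x) (D\<tau> x v) (D2\<tau> x v z)) / 2"
      unfolding koszul_def[OF lmc] koszul_def[OF lmd] metric_deriv_transform[OF x] z by (simp add: add_divide_distrib)
    also have "D2\<tau> x z v = D2\<tau> x v z"
      by (rule second_derivative_symmetric[OF W(1) C2 x])
    also have "g d (\<tau> x) (D2\<tau> x v z) (D\<tau> x v) = g d (\<tau> x) (D\<tau> x v) (D2\<tau> x v z)"
      by (rule lm_sym[OF lmd \<open>\<tau> x \<in> U'\<close>])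
    finally show "g d (\<tau> x) (D\<tau> x (christoffel g c x v v) - D2\<tau> x v v) z' = koszul g d (\<tau> x) (D\<tau> x v) z'"
      using linear_diff[OF l(2)] by simp
  qed
qed

text \<open>
  The second derivatives in \<open>christoffel_transform\<close> and in the chain rule for the acceleration cancel:
  the covariant derivative transforms as a vector, and so its length is the same in both charts.
\<close>

lemma cov_deriv_transform:
  assumes x: "x \<in> W"
  shows "g d (\<tau> x) (cov_deriv g d (\<tau> x) (D\<tau> x v) (D\<tau> x v) (D2\<tau> x v v + D\<tau> x w))
                   (cov_deriv g d (\<tau> x) (D\<tau> x v) (D\<tau> x v) (D2\<tau> x v v + D\<tau> x w))
       = g c x (cov_deriv g c x v v w) (cov_deriv g c x v v w)"
proof -
  have "cov_deriv g d (\<tau> x) (D\<tau> x v) (D\<tau> x v) (D2\<tau> x v v + D\<tau> x w) = D\<tau> x (cov_deriv g c x v v w)"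
    using christoffel_transform[OF x, of v] linear_add[OF has_derivative_linear[OF transition_D(1)[OF x]]]
    by (simp add: cov_deriv_def)
  then show ?thesis using iso[OF x] by simp
qed

end

section \<open>Auxiliary facts on functions of one real variable\<close>

lemma vector_derivative_within_unique:
  fixes f :: "real \<Rightarrow> 'b::real_normed_vector"
  assumes "a < b" "t \<in> {a..b}" "(f has_vector_derivative u) (at t within {a..b})" "(f has_vector_derivative v) (at t within {a..b})"
  shows "u = v"
  using vector_derivative_unique_within_closed_interval[of a b t f u v] assms by (simp add: box_real)

lemma lebesgue_measurable_indicator_continuous:
  fixes h :: "real \<Rightarrow> 'b::euclidean_space"
  assumes "continuous_on {a..b} h"
  shows "(\<lambda>t. indicator {a..b} t *\<^sub>R h t) \<in> borel_measurable lebesgue"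
  by (intro measurable_completion, simp)
     (intro borel_measurable_continuous_on_indicator assms, simp)

lemma has_vector_derivative_reparam:
  assumes "(h has_vector_derivative h') (at (\<phi> t))" "(\<phi> has_real_derivative \<phi>') (at t within S)"
  shows "((\<lambda>s. h (\<phi> s)) has_vector_derivative \<phi>' *\<^sub>R h') (at t within S)"
proof -
  have "(\<phi> has_vector_derivative \<phi>') (at t within S)"
    using assms(2) by (simp add: has_real_derivative_iff_has_vector_derivative)
  moreover have "(h has_vector_derivative h') (at (\<phi> t) within \<phi> ` S)"
    using assms(1) by (rule has_vector_derivative_at_within)
  ultimately show ?thesis using vector_diff_chain_within[of \<phi> \<phi>' t S h h'] by (simp add: o_def)
qed

lemma has_vector_derivative_slope:
  fixes f :: "real \<Rightarrow> 'b::real_normed_vector"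
  assumes "(f has_vector_derivative v) (at t within S)"
  shows "((\<lambda>s. (1 / (s - t)) *\<^sub>R (f s - f t)) \<longlongrightarrow> v) (at t within S)"
proof -
  have "((\<lambda>s. (1 / norm (s - t)) *\<^sub>R (f s - (f t + (s - t) *\<^sub>R v))) \<longlongrightarrow> 0) (at t within S)"
    using assms unfolding has_vector_derivative_def has_derivative_within by blast
  then have "((\<lambda>s. norm ((1 / norm (s - t)) *\<^sub>R (f s - (f t + (s - t) *\<^sub>R v)))) \<longlongrightarrow> 0) (at t within S)"
    by (rule tendsto_norm_zero)
  moreover have "eventually (\<lambda>s. norm ((1 / norm (s - t)) *\<^sub>R (f s - (f t + (s - t) *\<^sub>R v)))
      = norm ((1 / (s - t)) *\<^sub>R (f s - f t) - v)) (at t within S)"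
    unfolding eventually_at_filter
  proof (intro always_eventually allI impI)
    fix s assume "s \<noteq> t" "s \<in> S"
    then have "(1 / (s - t)) *\<^sub>R (f s - f t) - v = (1 / (s - t)) *\<^sub>R (f s - (f t + (s - t) *\<^sub>R v))"
      by (simp add: scaleR_diff_right scaleR_add_right)
    then show "norm ((1 / norm (s - t)) *\<^sub>R (f s - (f t + (s - t) *\<^sub>R v))) = norm ((1 / (s - t)) *\<^sub>R (f s - f t) - v)"
      by simp
  qed
  ultimately have "((\<lambda>s. norm ((1 / (s - t)) *\<^sub>R (f s - f t) - v)) \<longlongrightarrow> 0) (at t within S)"
    by (rule Lim_transform_eventually)
  from tendsto_norm_zero_cancel[OF this] show ?thesis by (rule LIM_zero_cancel)
qed

text \<open>
  Kronecker's theorem for fractional parts, in the form of an inhomogeneous approximation.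
\<close>

lemma irrational_multiples_dense:
  fixes \<theta> x \<eta> :: real
  assumes "\<theta> \<notin> \<rat>" "\<eta> > 0"
  obtains k :: nat and m :: int where "\<bar>x + m - k * \<theta>\<bar> < \<eta>"
proof -
  have "frac x \<in> closure (range (\<lambda>n. frac (real n * \<theta>)))"
    using Kronecker_approx_1[OF assms(1)] frac_ge_0[of x] frac_lt_1[of x] by simp
  then obtain n where n: "dist (frac (real n * \<theta>)) (frac x) < \<eta>"
    using assms(2) by (auto simp: closure_approachable)
  have "x + of_int (\<lfloor>real n * \<theta>\<rfloor> - \<lfloor>x\<rfloor>) - real n * \<theta> = frac x - frac (real n * \<theta>)"
    by (simp add: frac_def)
  then show thesis using n by (intro that[of "\<lfloor>real n * \<theta>\<rfloor> - \<lfloor>x\<rfloor>" n]) (simp add: dist_real_def abs_minus_commute)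
qed

section \<open>Charts along a curve\<close>

locale riemannian =
  fixes M :: "'m::{t2_space, second_countable_topology} set"
    and \<A> :: "('m, 'e::euclidean_space) chart set"
    and g :: "('m, 'e) metric"
  assumes rm: "riemannian_manifold M \<A> g"
begin

lemma chart_facts:
  assumes "c \<in> \<A>"
  shows "openin (top_of_set M) (chart_dom c)" "open (coord c ` chart_dom c)"
    "homeomorphism (chart_dom c) (coord c ` chart_dom c) (coord c) (inv_into (chart_dom c) (coord c))"
    "continuous_on (chart_dom c) (coord c)" "inj_on (coord c) (chart_dom c)"
    "chart_dom c \<subseteq> M"
proof -
  show o: "openin (top_of_set M) (chart_dom c)" "open (coord c ` chart_dom c)"
    and h: "homeomorphism (chart_dom c) (coord c ` chart_dom c) (coord c) (inv_into (chart_dom c) (coord c))"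
    using rm assms unfolding riemannian_manifold_def smooth_manifold_def by blast+
  show "continuous_on (chart_dom c) (coord c)" using h by (rule homeomorphism_cont1)
  show "inj_on (coord c) (chart_dom c)"
    by (rule inj_on_inverseI) (rule homeomorphism_apply1[OF h])
  show "chart_dom c \<subseteq> M" using o(1) by (rule openin_imp_subset)
qed

lemma chart_exists: "p \<in> M \<Longrightarrow> \<exists>c\<in>\<A>. p \<in> chart_dom c"
  using rm unfolding riemannian_manifold_def smooth_manifold_def by blast

lemma chart_local_metric: "c \<in> \<A> \<Longrightarrow> local_metric (coord c ` chart_dom c) g c"
  using rm chart_facts(2) unfolding riemannian_manifold_def riemannian_metric_def local_metric_def by blast

lemma transition_apply:
  "c \<in> \<A> \<Longrightarrow> p \<in> chart_dom c \<Longrightarrow> transition c d (coord c p) = coord d p"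
  by (simp add: transition_def inv_into_f_f[OF chart_facts(5)])

lemma transition_facts:
  assumes "c \<in> \<A>" "d \<in> \<A>"
  defines "W \<equiv> coord c ` (chart_dom c \<inter> chart_dom d)"
  shows "open W" "W \<subseteq> coord c ` chart_dom c" "transition c d ` W \<subseteq> coord d ` chart_dom d"
    "Ck_on 2 W (transition c d)"
    "\<And>x v w. x \<in> W \<Longrightarrow> g c x v w = g d (transition c d x)
      (frechet_derivative (transition c d) (at x) v) (frechet_derivative (transition c d) (at x) w)"
proof -
  have "openin (top_of_set (chart_dom c)) (chart_dom c \<inter> chart_dom d)"
  proof -
    obtain T where T: "open T" "chart_dom d = M \<inter> T"
      using chart_facts(1)[OF assms(2)] by (auto simp: openin_open)
    then have "chart_dom c \<inter> chart_dom d = chart_dom c \<inter> T" using chart_facts(6)[OF assms(1)] by blast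
    then show ?thesis using T(1) openin_open_Int by metis
  qed
  then have "openin (top_of_set (coord c ` chart_dom c)) W"
    unfolding W_def using homeomorphism_imp_open_map[OF chart_facts(3)[OF assms(1)]] by blast
  then show "open W" using chart_facts(2)[OF assms(1)] openin_open_trans by blast
  show "W \<subseteq> coord c ` chart_dom c" by (auto simp: W_def)
  show "transition c d ` W \<subseteq> coord d ` chart_dom d"
  proof
    fix x assume "x \<in> transition c d ` W"
    then obtain p where p: "p \<in> chart_dom c" "p \<in> chart_dom d" "x = transition c d (coord c p)"
      unfolding W_def by blast
    then show "x \<in> coord d ` chart_dom d" using transition_apply[OF assms(1) p(1), of d] by simp
  qed
  show "Ck_on 2 W (transition c d)"
    using rm assms(1,2) unfolding W_def riemannian_manifold_def smooth_manifold_def smooth_on_def by blast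
  show "g c x v w = g d (transition c d x)
      (frechet_derivative (transition c d) (at x) v) (frechet_derivative (transition c d) (at x) w)"
    if xW: "x \<in> W" for x v w
  proof -
    obtain p where p: "p \<in> chart_dom c \<inter> chart_dom d" "x = coord c p" using xW unfolding W_def by blast
    have "g c (coord c p) v w = g d (coord d p)
      (frechet_derivative (transition c d) (at (coord c p)) v) (frechet_derivative (transition c d) (at (coord c p)) w)"
      using rm assms(1,2) p(1) unfolding riemannian_manifold_def riemannian_metric_def by blast
    then show ?thesis using p transition_apply[OF assms(1), of p d] by simp
  qed
qed

text \<open>
  The charts are open only relative to \<open>M\<close>, so the curve has to run in \<open>M\<close>.
\<close>

lemma curve_stays_in_chart:
  fixes J :: "real set"
  assumes "continuous_on J y" "y ` J \<subseteq> M" "c \<in> \<A>" "t \<in> J" "y t \<in> chart_dom c"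
  obtains \<delta> where "\<delta> > 0" "\<And>s. s \<in> J \<Longrightarrow> \<bar>s - t\<bar> < \<delta> \<Longrightarrow> y s \<in> chart_dom c"
proof -
  have "openin (top_of_set J) (J \<inter> y -` chart_dom c)"
    using continuous_openin_preimage[OF assms(1) _ chart_facts(1)[OF assms(3)]] assms(2) by blast
  then show thesis
    using assms(4,5) that by (force simp: openin_euclidean_subtopology_iff dist_real_def)
qed

lemma coord_curve_continuous:
  assumes "continuous_on J y" "c \<in> \<A>" "y ` J \<subseteq> chart_dom c"
  shows "continuous_on J (coord c \<circ> y)"
  using continuous_on_compose2[OF chart_facts(4)[OF assms(2)] assms(1,3)] by (simp add: o_def)

lemma velocity_transform:
  fixes J :: "real set"
  assumes y: "continuous_on J y" "y ` J \<subseteq> M" and c: "c \<in> \<A>" and d: "d \<in> \<A>" and t: "t \<in> J"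
    and yt: "y t \<in> chart_dom c" "y t \<in> chart_dom d"
    and v: "((coord c \<circ> y) has_vector_derivative v) (at t within J)"
  shows "((coord d \<circ> y) has_vector_derivative frechet_derivative (transition c d) (at (coord c (y t))) v) (at t within J)"
proof -
  obtain \<delta> where \<delta>: "\<delta> > 0" "\<And>s. s \<in> J \<Longrightarrow> \<bar>s - t\<bar> < \<delta> \<Longrightarrow> y s \<in> chart_dom c"
    using curve_stays_in_chart[OF y c t yt(1)] by metis
  let ?x = "coord c (y t)"
  have x: "?x \<in> coord c ` (chart_dom c \<inter> chart_dom d)" using yt by auto
  have D: "(transition c d has_derivative frechet_derivative (transition c d) (at ?x)) (at ?x)"
    using Ck_on_1D[OF Ck_on_mono[of "Suc 0" 2, OF _ transition_facts(4)[OF c d]] x] by simp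
  have "((\<lambda>s. transition c d ((coord c \<circ> y) s)) has_derivative
      (\<lambda>h. frechet_derivative (transition c d) (at ?x) (h *\<^sub>R v))) (at t within J)"
    using v unfolding has_vector_derivative_def by (rule has_derivative_compose) (use D in simp)
  then have "((\<lambda>s. transition c d (coord c (y s))) has_vector_derivative
      frechet_derivative (transition c d) (at ?x) v) (at t within J)"
    unfolding has_vector_derivative_def using linear_scale[OF has_derivative_linear[OF D]] by simp
  then show ?thesis
    by (rule has_vector_derivative_transform_within[OF _ \<delta>(1) t])
       (use \<delta>(2) transition_apply[OF c] in \<open>auto simp: dist_real_def\<close>)
qed

section \<open>The spline integrand of a Sobolev curve\<close>

definition accel_energy :: "('m, 'e) chart \<Rightarrow> (real \<Rightarrow> 'm) \<Rightarrow> (real \<Rightarrow> 'e) \<Rightarrow> (real \<Rightarrow> 'e) \<Rightarrow> real \<Rightarrow> real" where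
  "accel_energy c y v w t = g c (coord c (y t)) (cov_deriv g c (coord c (y t)) (v t) (v t) (w t))
                                        (cov_deriv g c (coord c (y t)) (v t) (v t) (w t))"

lemma W22_curve_local:
  assumes y: "W22_curve M \<A> y" and c: "c \<in> \<A>" and ab: "0 \<le> a" "a < b" "b \<le> 1" and sub: "y ` {a..b} \<subseteq> chart_dom c"
  obtains V w where "primitive_on a b V w"
    "\<And>t. t \<in> {a..b} \<Longrightarrow> ((coord c \<circ> y) has_vector_derivative V t) (at t within {a..b})"
    "has_weak_derivative a b (coord c \<circ> y) V" "has_weak_derivative a b V w"
proof -
  obtain v w where vw: "has_weak_derivative a b (coord c \<circ> y) v" "has_weak_derivative a b v w" "L2_on a b w"
    using y c ab sub unfolding W22_curve_def W22_on_def by blast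
  have "continuous_on {a..b} y"
    using y ab unfolding W22_curve_def by (auto elim: continuous_on_subset)
  then have cy: "continuous_on {a..b} (coord c \<circ> y)" by (rule coord_curve_continuous[OF _ c sub])
  obtain V where V: "primitive_on a b V w"
    "\<And>t. t \<in> {a..b} \<Longrightarrow> ((coord c \<circ> y) has_vector_derivative V t) (at t within {a..b})"
    "AE t in lebesgue. t \<in> {a<..<b} \<longrightarrow> v t = V t"
    using W22_structure[OF ab(2) cy vw(1,2) L2_on_absolutely_integrable[OF vw(3)]] by metis
  show thesis
    by (rule that[OF V(1,2) has_weak_derivative_cong_AE[OF vw(1) _ V(3)] primitive_on_has_weak_derivative[OF V(1) ab(2)]])
       simp_all
qed

lemma accel_energy_cong_AE:
  assumes "has_weak_derivative a b u v" "has_weak_derivative a b v w"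
    "has_weak_derivative a b u v'" "has_weak_derivative a b v' w'" "a < b"
  shows "AE t in lebesgue. t \<in> {a<..<b} \<longrightarrow> accel_energy c y v w t = accel_energy c y v' w' t"
proof -
  have v: "AE t in lebesgue. t \<in> {a<..<b} \<longrightarrow> v t = v' t"
    by (rule has_weak_derivative_unique[OF assms(1,3,5)])
  have "has_weak_derivative a b v' w"
    by (rule has_weak_derivative_cong_AE[OF assms(2) v]) simp
  from has_weak_derivative_unique[OF this assms(4,5)] v
  show ?thesis by eventually_elim (simp add: accel_energy_def)
qed

text \<open>
  The velocities in the two charts are related by the differential of the transition map. The chain and
  product rules give the weak derivative of the transformed velocity, which is unique almost everywhere
  and therefore equals \<open>w'\<close>; then \<open>cov_deriv_transform\<close> applies.
\<close>

lemma accel_energy_overlap: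
  assumes c: "c \<in> \<A>" and d: "d \<in> \<A>" and ab: "a < b" and cont: "continuous_on {a..b} y"
    and sub: "y ` {a..b} \<subseteq> chart_dom c" "y ` {a..b} \<subseteq> chart_dom d"
    and V: "primitive_on a b V w"
      "\<And>t. t \<in> {a..b} \<Longrightarrow> ((coord c \<circ> y) has_vector_derivative V t) (at t within {a..b})"
    and V': "primitive_on a b V' w'"
      "\<And>t. t \<in> {a..b} \<Longrightarrow> ((coord d \<circ> y) has_vector_derivative V' t) (at t within {a..b})"
  shows "AE t in lebesgue. t \<in> {a<..<b} \<longrightarrow> accel_energy c y V w t = accel_energy d y V' w' t"
proof -
  define W where "W = coord c ` (chart_dom c \<inter> chart_dom d)"
  define \<tau> where "\<tau> = transition c d"
  note tf = transition_facts[OF c d, folded W_def \<tau>_def]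
  let ?D = "\<lambda>x. frechet_derivative \<tau> (at x)"
  let ?D2 = "\<lambda>x v. frechet_derivative (\<lambda>y. frechet_derivative \<tau> (at y) v) (at x)"
  let ?x = "\<lambda>t. coord c (y t)"
  note lc = chart_local_metric[OF c] and ld = chart_local_metric[OF d]
  have C2: "Ck_on (Suc (Suc 0)) W \<tau>" using tf(4) by (simp add: numeral_2_eq_2 del: Ck_on.simps)
  have xW: "?x t \<in> W" if "t \<in> {a..b}" for t
    unfolding W_def using sub that by blast
  have yM: "y ` {a..b} \<subseteq> M" using sub(1) chart_facts(6)[OF c] by blast
  have V'eq: "V' t = ?D (?x t) (V t)" if t: "t \<in> {a..b}" for t
  proof -
    have yt: "y t \<in> chart_dom c" "y t \<in> chart_dom d" using sub t by blast+
    show ?thesis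
      by (rule vector_derivative_unique_within_closed_interval[of a b t "coord d \<circ> y", unfolded box_real, OF ab _ V'(2)[OF t]])
         (use t velocity_transform[OF cont yM c d t yt V(2)[OF t], folded \<tau>_def] in auto)
  qed
  have cx: "continuous_on {a..b} ?x"
    using coord_curve_continuous[OF cont c sub(1)] by (simp add: o_def)
  have cV: "continuous_on {a..b} V" by (rule primitive_on_continuous[OF V(1)])
  have cD2: "continuous_on {a..b} (\<lambda>t. ?D2 (?x t) i (V t))" for i
  proof -
    have "continuous_on W (\<lambda>x. ?D2 x i j)" for j
      using Ck_on_continuous[OF Ck_on_frechet[OF Ck_on_frechet[OF C2]]] .
    then have "continuous_on {a..b} (\<lambda>t. \<Sum>j\<in>Basis. (V t \<bullet> j) *\<^sub>R ?D2 (?x t) i j)"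
      using xW by (intro continuous_intros continuous_on_compose2[OF _ cx] cV) auto
    moreover have "(\<Sum>j\<in>Basis. (V t \<bullet> j) *\<^sub>R ?D2 (?x t) i j) = ?D2 (?x t) i (V t)" if "t \<in> {a..b}" for t
    proof -
      have l: "linear (?D2 (?x t) i)"
        by (rule frechet_derivative_linear_at[OF Ck_on_frechet[OF C2] xW[OF that]])
      have "?D2 (?x t) i (V t) = ?D2 (?x t) i (\<Sum>j\<in>Basis. (V t \<bullet> j) *\<^sub>R j)" by (simp add: euclidean_representation)
      then show ?thesis by (simp add: linear_sum[OF l] linear_scale[OF l] del: euclidean_representation)
    qed
    ultimately show ?thesis by (rule continuous_on_eq)
  qed
  \<comment> \<open>the transformed velocity as a sum of products of a coordinate of \<open>V\<close> with a \<open>C\<^sup>1\<close> vector\<close>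
  have bil: "bounded_bilinear (\<lambda>(F::'e) r::real. r *\<^sub>R F)"
    using bounded_bilinear.flip[OF bounded_bilinear_scaleR] .
  have P: "primitive_on a b (\<lambda>t. \<Sum>i\<in>Basis. (V t \<bullet> i) *\<^sub>R ?D (?x t) i)
     (\<lambda>t. \<Sum>i\<in>Basis. (V t \<bullet> i) *\<^sub>R ?D2 (?x t) i (V t) + (w t \<bullet> i) *\<^sub>R ?D (?x t) i)"
  proof (intro primitive_on_sum finite_Basis primitive_on_product[OF bil])
    fix i :: 'e
    show "primitive_on a b (\<lambda>t. V t \<bullet> i) (\<lambda>t. w t \<bullet> i)"
      by (rule primitive_on_linear[OF V(1) bounded_linear_inner_left])
    show "continuous_on {a..b} (\<lambda>t. ?D2 (?x t) i (V t))" by (rule cD2)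
    fix t assume t: "t \<in> {a..b}"
    have D: "((\<lambda>x. ?D x i) has_derivative ?D2 (?x t) i) (at (?x t))"
      by (rule Ck_on_1D[OF Ck_on_frechet[OF C2] xW[OF t]])
    have "((\<lambda>s. ?D ((coord c \<circ> y) s) i) has_derivative (\<lambda>h. ?D2 (?x t) i (h *\<^sub>R V t))) (at t within {a..b})"
      using V(2)[OF t] unfolding has_vector_derivative_def by (rule has_derivative_compose) (use D in simp)
    then show "((\<lambda>t. ?D (?x t) i) has_vector_derivative ?D2 (?x t) i (V t)) (at t within {a..b})"
      unfolding has_vector_derivative_def using linear_scale[OF has_derivative_linear[OF D]] by simp
  qed
  have "primitive_on a b V' (\<lambda>t. ?D2 (?x t) (V t) (V t) + ?D (?x t) (w t))"
  proof (rule primitive_on_cong[OF P])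
    fix t assume t: "t \<in> {a..b}"
    have l: "linear (?D (?x t))" by (rule frechet_derivative_linear_at[OF C2 xW[OF t]])
    have e: "?D (?x t) u = (\<Sum>i\<in>Basis. (u \<bullet> i) *\<^sub>R ?D (?x t) i)" for u
    proof -
      have "?D (?x t) u = ?D (?x t) (\<Sum>i\<in>Basis. (u \<bullet> i) *\<^sub>R i)" by (simp add: euclidean_representation)
      then show ?thesis by (simp add: linear_sum[OF l] linear_scale[OF l] del: euclidean_representation)
    qed
    show "(\<Sum>i\<in>Basis. (V t \<bullet> i) *\<^sub>R ?D (?x t) i) = V' t"
      unfolding V'eq[OF t] by (rule e[symmetric])
    have l2: "linear (?D2 (?x t) (V t))"
      by (rule frechet_derivative_linear_at[OF Ck_on_frechet[OF C2] xW[OF t]])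
    have "?D2 (?x t) (V t) (V t) = ?D2 (?x t) (V t) (\<Sum>i\<in>Basis. (V t \<bullet> i) *\<^sub>R i)" by (simp add: euclidean_representation)
    also have "\<dots> = (\<Sum>i\<in>Basis. (V t \<bullet> i) *\<^sub>R ?D2 (?x t) (V t) i)"
      by (simp add: linear_sum[OF l2] linear_scale[OF l2] del: euclidean_representation)
    also have "\<dots> = (\<Sum>i\<in>Basis. (V t \<bullet> i) *\<^sub>R ?D2 (?x t) i (V t))"
      by (intro sum.cong refl arg_cong[where f = "scaleR _"] second_derivative_symmetric[OF tf(1) tf(4) xW[OF t]])
    finally show "(\<Sum>i\<in>Basis. (V t \<bullet> i) *\<^sub>R ?D2 (?x t) i (V t) + (w t \<bullet> i) *\<^sub>R ?D (?x t) i) = ?D2 (?x t) (V t) (V t) + ?D (?x t) (w t)"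
      using e[of "w t"] by (simp add: sum.distrib)
  qed
  from has_weak_derivative_unique[OF primitive_on_has_weak_derivative[OF V'(1) ab] primitive_on_has_weak_derivative[OF this ab] ab]
  show ?thesis
  proof eventually_elim
    case (elim t)
    show ?case
    proof
      assume t: "t \<in> {a<..<b}"
      then have t': "t \<in> {a..b}" by auto
      note CT = cov_deriv_transform[OF lc ld tf(1) tf(2) tf(3) tf(4), OF tf(5) xW[OF t']]
      note E = CT[of "V t" "w t"]
      have "coord d (y t) = \<tau> (?x t)"
        unfolding \<tau>_def by (rule transition_apply[OF c, symmetric]) (use sub t' in blast)
      moreover have "w' t = ?D2 (?x t) (V t) (V t) + ?D (?x t) (w t)" using elim t by blast
      ultimately show "accel_energy c y V w t = accel_energy d y V' w' t"
        using E V'eq[OF t'] by (simp only: accel_energy_def)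
    qed
  qed
qed

lemma rational_chart_interval:
  fixes y :: "real \<Rightarrow> 'm"
  assumes y: "continuous_on {0..1} y" "y ` {0..1} \<subseteq> M" and t: "0 < t" "t < 1"
  obtains p q c where "p \<in> \<rat>" "q \<in> \<rat>" "0 \<le> p" "p < t" "t < q" "q \<le> 1" "c \<in> \<A>" "y ` {p..q} \<subseteq> chart_dom c"
proof -
  have tJ: "t \<in> {0..1}" using t by auto
  obtain c where c: "c \<in> \<A>" "y t \<in> chart_dom c" using chart_exists[of "y t"] y(2) tJ by blast
  obtain \<delta> where \<delta>: "\<delta> > 0" "\<And>s. s \<in> {0..1} \<Longrightarrow> \<bar>s - t\<bar> < \<delta> \<Longrightarrow> y s \<in> chart_dom c"
    using curve_stays_in_chart[OF y c(1) tJ c(2)] by metis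
  obtain p where p: "p \<in> \<rat>" "max 0 (t - \<delta>) < p" "p < t"
    using Rats_dense_in_real[of "max 0 (t - \<delta>)" t] \<delta>(1) t by auto
  obtain q where q: "q \<in> \<rat>" "t < q" "q < min 1 (t + \<delta>)"
    using Rats_dense_in_real[of t "min 1 (t + \<delta>)"] \<delta>(1) t by auto
  have "y ` {p..q} \<subseteq> chart_dom c"
  proof
    fix z assume "z \<in> y ` {p..q}"
    then obtain s where "s \<in> {p..q}" "z = y s" by blast
    then show "z \<in> chart_dom c" using \<delta>(2)[of s] p q by auto
  qed
  then show thesis using that p q c(1) by auto
qed

text \<open>
  Countably many intervals with rational end points, each spent in one chart, cover \<open>(0,1)\<close>.
\<close>

lemma AE_by_chart_intervals:
  fixes y :: "real \<Rightarrow> 'm"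
  assumes y: "continuous_on {0..1} y" "y ` {0..1} \<subseteq> M"
    and P: "\<And>c a b. c \<in> \<A> \<Longrightarrow> 0 \<le> a \<Longrightarrow> a < b \<Longrightarrow> b \<le> 1 \<Longrightarrow> y ` {a..b} \<subseteq> chart_dom c \<Longrightarrow>
      AE t in lebesgue. t \<in> {a<..<b} \<longrightarrow> P t"
  shows "AE t in lebesgue. t \<in> {0..1} \<longrightarrow> P t"
proof -
  define S where "S = {pq \<in> \<rat> \<times> \<rat>. 0 \<le> fst pq \<and> fst pq < snd pq \<and> snd pq \<le> 1 \<and> (\<exists>c\<in>\<A>. y ` {fst pq..snd pq} \<subseteq> chart_dom c)}"
  have "countable S"
    by (rule countable_subset[of _ "\<rat> \<times> \<rat>"]) (auto simp: S_def intro: countable_SIGMA countable_rat)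
  moreover have "AE t in lebesgue. t \<in> {fst pq<..<snd pq} \<longrightarrow> P t" if "pq \<in> S" for pq
  proof -
    obtain c where "c \<in> \<A>" "y ` {fst pq..snd pq} \<subseteq> chart_dom c" using \<open>pq \<in> S\<close> by (auto simp: S_def)
    then show ?thesis using that by (intro P[of c]) (auto simp: S_def)
  qed
  ultimately have "AE t in lebesgue. \<forall>pq\<in>S. t \<in> {fst pq<..<snd pq} \<longrightarrow> P t"
    by (subst AE_ball_countable) auto
  moreover have "AE t in lebesgue. t \<noteq> (0::real)" "AE t in lebesgue. t \<noteq> (1::real)"
    by (rule AE_I'[of "{0}"] AE_I'[of "{1}"]; auto simp: negligible_iff_null_sets[symmetric])+
  ultimately show ?thesis
  proof eventually_elim
    case (elim t)
    show ?case
    proof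
      assume "t \<in> {0..1}"
      then have "0 < t" "t < 1" using elim by auto
      then obtain p q c where "p \<in> \<rat>" "q \<in> \<rat>" "0 \<le> p" "p < t" "t < q" "q \<le> 1" "c \<in> \<A>" "y ` {p..q} \<subseteq> chart_dom c"
        using rational_chart_interval[OF y] by metis
      then have "(p, q) \<in> S" "t \<in> {fst (p, q)<..<snd (p, q)}" by (auto simp: S_def)
      then show "P t" using elim(1) by blast
    qed
  qed
qed

lemma spline_integrand_unique:
  assumes y: "continuous_on {0..1} y" "y ` {0..1} \<subseteq> M"
    and f: "spline_integrand \<A> g y f" "spline_integrand \<A> g y f'"
  shows "AE t in lebesgue. t \<in> {0..1} \<longrightarrow> f t = f' t"
proof (rule AE_by_chart_intervals[OF y])
  fix c a b assume c: "c \<in> \<A>" and ab: "0 \<le> a" "a < b" "b \<le> (1::real)" and sub: "y ` {a..b} \<subseteq> chart_dom c"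
  obtain v w where 1: "has_weak_derivative a b (coord c \<circ> y) v" "has_weak_derivative a b v w"
    "AE t in lebesgue. t \<in> {a<..<b} \<longrightarrow> f t = accel_energy c y v w t"
    using f(1) c ab sub unfolding spline_integrand_def accel_energy_def by blast
  obtain v' w' where 2: "has_weak_derivative a b (coord c \<circ> y) v'" "has_weak_derivative a b v' w'"
    "AE t in lebesgue. t \<in> {a<..<b} \<longrightarrow> f' t = accel_energy c y v' w' t"
    using f(2) c ab sub unfolding spline_integrand_def accel_energy_def by blast
  show "AE t in lebesgue. t \<in> {a<..<b} \<longrightarrow> f t = f' t"
    using accel_energy_cong_AE[OF 1(1,2) 2(1,2) ab(2), of c y] 1(3) 2(3)
    by eventually_elim auto
qed

text \<open>
  Fix a coordinate expression of the density on every rational interval that the curve spends in a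
  chart, and let the integrand use at each time some such interval around it. The choice matters only on
  a null set, because there are countably many intervals and the expressions agree almost everywhere on
  overlaps.
\<close>

lemma spline_integrand_exists:
  assumes y: "W22_curve M \<A> y"
  shows "\<exists>f. spline_integrand \<A> g y f"
proof -
  have cont: "continuous_on {0..1} y" "y ` {0..1} \<subseteq> M" using y by (auto simp: W22_curve_def)
  define Q where "Q = (\<lambda>pq c V w. c \<in> \<A> \<and> y ` {fst pq..snd pq} \<subseteq> chart_dom c \<and>
      primitive_on (fst pq) (snd pq) V w \<and>
      (\<forall>t\<in>{fst pq..snd pq}. ((coord c \<circ> y) has_vector_derivative V t) (at t within {fst pq..snd pq})))"
  define S where "S = {pq \<in> \<rat> \<times> \<rat>. 0 \<le> fst pq \<and> fst pq < snd pq \<and> snd pq \<le> 1 \<and> (\<exists>c\<in>\<A>. y ` {fst pq..snd pq} \<subseteq> chart_dom c)}"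
  have countS: "countable S"
    by (rule countable_subset[of _ "\<rat> \<times> \<rat>"]) (auto simp: S_def intro: countable_SIGMA countable_rat)
  have "\<forall>pq\<in>S. \<exists>c V w. Q pq c V w"
  proof
    fix pq assume pq: "pq \<in> S"
    then obtain c where c: "c \<in> \<A>" "y ` {fst pq..snd pq} \<subseteq> chart_dom c" by (auto simp: S_def)
    obtain V w where "primitive_on (fst pq) (snd pq) V w"
      "\<And>t. t \<in> {fst pq..snd pq} \<Longrightarrow> ((coord c \<circ> y) has_vector_derivative V t) (at t within {fst pq..snd pq})"
    proof -
      have "0 \<le> fst pq" "fst pq < snd pq" "snd pq \<le> 1" using pq by (auto simp: S_def)
      from W22_curve_local[OF y c(1) this c(2)] that show thesis by metis
    qed
    then show "\<exists>c V w. Q pq c V w" using c unfolding Q_def by blast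
  qed
  then obtain cc VV ww where Q: "\<And>pq. pq \<in> S \<Longrightarrow> Q pq (cc pq) (VV pq) (ww pq)" by metis
  \<comment> \<open>a rational interval around \<open>t\<close> that the curve spends in one chart\<close>
  define I where "I t = (SOME pq. pq \<in> S \<and> t \<in> {fst pq<..<snd pq})" for t
  define f where "f t = accel_energy (cc (I t)) y (VV (I t)) (ww (I t)) t" for t
  have "spline_integrand \<A> g y f"
    unfolding spline_integrand_def
  proof (intro ballI allI impI, elim conjE)
    fix c a b assume c: "c \<in> \<A>" and ab: "0 \<le> a" "a < b" "b \<le> 1" and sub: "y ` {a..b} \<subseteq> chart_dom c"
    obtain V w where Vw: "primitive_on a b V w"
      "\<And>t. t \<in> {a..b} \<Longrightarrow> ((coord c \<circ> y) has_vector_derivative V t) (at t within {a..b})"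
      "has_weak_derivative a b (coord c \<circ> y) V" "has_weak_derivative a b V w"
      using W22_curve_local[OF y c ab sub] by metis
    have "AE t in lebesgue. \<forall>pq\<in>S. t \<in> {a<..<b} \<inter> {fst pq<..<snd pq} \<longrightarrow>
        accel_energy (cc pq) y (VV pq) (ww pq) t = accel_energy c y V w t"
    proof (subst AE_ball_countable[OF countS], intro ballI)
      fix pq assume pq: "pq \<in> S"
      define a' where "a' = max a (fst pq)"
      define b' where "b' = min b (snd pq)"
      note QQ = Q[OF pq, unfolded Q_def]
      show "AE t in lebesgue. t \<in> {a<..<b} \<inter> {fst pq<..<snd pq} \<longrightarrow>
        accel_energy (cc pq) y (VV pq) (ww pq) t = accel_energy c y V w t"
      proof (cases "a' < b'")
        case True
        have sub': "{a'..b'} \<subseteq> {a..b}" "{a'..b'} \<subseteq> {fst pq..snd pq}" "{a'..b'} \<subseteq> {0..1}"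
          using ab by (auto simp: a'_def b'_def)
        have "AE t in lebesgue. t \<in> {a'<..<b'} \<longrightarrow>
           accel_energy (cc pq) y (VV pq) (ww pq) t = accel_energy c y V w t"
        proof (rule accel_energy_overlap[OF _ c True])
          show "cc pq \<in> \<A>" using QQ by blast
          show "continuous_on {a'..b'} y" using continuous_on_subset[OF cont(1) sub'(3)] .
          show "y ` {a'..b'} \<subseteq> chart_dom (cc pq)" using QQ sub'(2) by blast
          show "y ` {a'..b'} \<subseteq> chart_dom c" using sub sub'(1) by blast
          show "primitive_on a' b' (VV pq) (ww pq)"
            by (rule primitive_on_subinterval[of "fst pq" "snd pq"]) (use QQ True in \<open>auto simp: a'_def b'_def\<close>)
          show "primitive_on a' b' V w"
            by (rule primitive_on_subinterval[OF Vw(1)]) (use True in \<open>auto simp: a'_def b'_def\<close>)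
          fix t assume "t \<in> {a'..b'}"
          then show "((coord (cc pq) \<circ> y) has_vector_derivative VV pq t) (at t within {a'..b'})"
            "((coord c \<circ> y) has_vector_derivative V t) (at t within {a'..b'})"
            using QQ sub' has_vector_derivative_within_subset Vw(2) by (metis subsetD)+
        qed
        then show ?thesis by eventually_elim (auto simp: a'_def b'_def)
      next
        case False
        then have "{a<..<b} \<inter> {fst pq<..<snd pq} = {}" by (auto simp: a'_def b'_def)
        then show ?thesis by simp
      qed
    qed
    then have "AE t in lebesgue. t \<in> {a<..<b} \<longrightarrow> f t = accel_energy c y V w t"
    proof eventually_elim
      case (elim t)
      show ?case
      proof
        assume t: "t \<in> {a<..<b}"
        then have "0 < t" "t < 1" using ab by auto
        then obtain p q d where "p \<in> \<rat>" "q \<in> \<rat>" "0 \<le> p" "p < t" "t < q" "q \<le> 1" "d \<in> \<A>" "y ` {p..q} \<subseteq> chart_dom d"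
          using rational_chart_interval[OF cont] by metis
        then have "(p, q) \<in> S \<and> t \<in> {fst (p, q)<..<snd (p, q)}" by (auto simp: S_def)
        then have "I t \<in> S \<and> t \<in> {fst (I t)<..<snd (I t)}" unfolding I_def by (rule someI)
        then show "f t = accel_energy c y V w t" using elim t unfolding f_def by blast
      qed
    qed
    then show "\<exists>v w. has_weak_derivative a b (coord c \<circ> y) v \<and> has_weak_derivative a b v w \<and>
           (AE t in lebesgue. t \<in> {a<..<b} \<longrightarrow>
              f t = g c (coord c (y t)) (cov_deriv g c (coord c (y t)) (v t) (v t) (w t))
                                        (cov_deriv g c (coord c (y t)) (v t) (v t) (w t)))"
      unfolding accel_energy_def by (intro exI[of _ V] exI[of _ w] conjI Vw(3,4))
  qed
  then show ?thesis by (intro exI[of _ f])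
qed

section \<open>Curves of energy zero\<close>

text \<open>
  Velocity and acceleration are required as functions on all times spent in the chart, but they are
  determined by the curve, so it suffices to find them near each time.
\<close>

lemma locally_geodesic_onI:
  fixes y :: "real \<Rightarrow> 'm"
  assumes ab: "a < b" and y: "continuous_on {a..b} y" "y ` {a..b} \<subseteq> M"
    and loc: "\<And>c t. c \<in> \<A> \<Longrightarrow> t \<in> {a..b} \<Longrightarrow> y t \<in> chart_dom c \<Longrightarrow>
      \<exists>\<delta>>0. \<exists>V acc. (\<forall>s\<in>{a..b}. \<bar>s - t\<bar> < \<delta> \<longrightarrow> ((coord c \<circ> y) has_vector_derivative V s) (at s within {a..b})) \<and>
        (V has_vector_derivative acc) (at t within {a..b}) \<and> cov_deriv g c (coord c (y t)) (V t) (V t) acc = 0"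
  shows "locally_geodesic_on M \<A> g {a..b} y"
  unfolding locally_geodesic_on_def
proof (intro conjI y ballI)
  fix c assume c: "c \<in> \<A>"
  define v where "v s = vector_derivative (coord c \<circ> y) (at s within {a..b})" for s
  define acc where "acc s = vector_derivative v (at s within {a..b})" for s
  have vd: "vector_derivative h (at s within {a..b}) = u" if "s \<in> {a..b}" "(h has_vector_derivative u) (at s within {a..b})"
    for h :: "real \<Rightarrow> 'e" and s u
    unfolding vector_derivative_def
    by (rule some_equality) (use that vector_derivative_within_unique[OF ab that(1)] in blast)+
  have "((coord c \<circ> y) has_vector_derivative v t) (at t within {a..b}) \<and>
        (v has_vector_derivative acc t) (at t within {a..b}) \<and>
        cov_deriv g c (coord c (y t)) (v t) (v t) (acc t) = 0"
    if t: "t \<in> {a..b}" and yt: "y t \<in> chart_dom c" for t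
  proof -
    obtain \<delta> V A where \<delta>: "\<delta> > 0"
      and V: "\<And>s. s \<in> {a..b} \<Longrightarrow> \<bar>s - t\<bar> < \<delta> \<Longrightarrow> ((coord c \<circ> y) has_vector_derivative V s) (at s within {a..b})"
      and A: "(V has_vector_derivative A) (at t within {a..b})" and z: "cov_deriv g c (coord c (y t)) (V t) (V t) A = 0"
      using loc[OF c t yt] by metis
    have veq: "V s = v s" if "s \<in> {a..b}" "\<bar>s - t\<bar> < \<delta>" for s
      using vd[OF that(1) V[OF that]] by (simp add: v_def)
    have "(v has_vector_derivative A) (at t within {a..b})"
      by (rule has_vector_derivative_transform_within[OF A \<delta> t]) (use veq in \<open>auto simp: dist_real_def\<close>)
    moreover from vd[OF t this] have at: "acc t = A" by (simp add: acc_def)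
    moreover have vt: "V t = v t" using veq[OF t] \<delta> by simp
    moreover have "((coord c \<circ> y) has_vector_derivative V t) (at t within {a..b})" using V[OF t] \<delta> by simp
    ultimately show ?thesis using z by (simp only: simp_thms)
  qed
  then show "\<exists>v a'. \<forall>t\<in>{a..b}. y t \<in> chart_dom c \<longrightarrow>
        ((coord c \<circ> y) has_vector_derivative v t) (at t within {a..b}) \<and>
        (v has_vector_derivative a' t) (at t within {a..b}) \<and>
        cov_deriv g c (coord c (y t)) (v t) (v t) (a' t) = 0"
    by (intro exI[of _ v] exI[of _ acc] ballI impI)
qed

lemma accel_energy_measurable:
  assumes c: "c \<in> \<A>" and cont: "continuous_on {a..b} y" and sub: "y ` {a..b} \<subseteq> chart_dom c"
    and V: "primitive_on a b V w"
  shows "(\<lambda>t. indicator {a..b} t * accel_energy c y V w t) \<in> borel_measurable lebesgue"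
proof -
  note lc = chart_local_metric[OF c]
  let ?x = "\<lambda>t. coord c (y t)"
  have xU: "?x t \<in> coord c ` chart_dom c" if "t \<in> {a..b}" for t using sub that by blast
  have cx: "continuous_on {a..b} ?x"
    using coord_curve_continuous[OF cont c sub] by (simp add: o_def)
  have cV: "continuous_on {a..b} V" by (rule primitive_on_continuous[OF V])
  define \<Gamma> where "\<Gamma> t = christoffel g c (?x t) (V t) (V t)" for t
  have c\<Gamma>: "continuous_on {a..b} \<Gamma>"
    unfolding \<Gamma>_def by (rule christoffel_continuous_on[OF lc cx cV]) (use xU in blast)
  define q where "q t = indicator {a..b} t *\<^sub>R w t + indicator {a..b} t *\<^sub>R \<Gamma> t" for t
  have "set_integrable lebesgue {a..b} w" using V by (simp add: primitive_on_def)
  then have "(\<lambda>t. indicator {a..b} t *\<^sub>R w t) \<in> borel_measurable lebesgue"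
    by (auto simp: set_integrable_def)
  then have q: "q \<in> borel_measurable lebesgue"
    unfolding q_def by (intro borel_measurable_add lebesgue_measurable_indicator_continuous[OF c\<Gamma>])
  have gm: "(\<lambda>t. indicator {a..b} t *\<^sub>R g c (?x t) i j) \<in> borel_measurable lebesgue" for i j
    by (intro lebesgue_measurable_indicator_continuous metric_continuous_on[OF lc cx] continuous_on_const) (use xU in blast)
  have qi: "(\<lambda>t. q t \<bullet> i) \<in> borel_measurable lebesgue" for i
    using q by (rule borel_measurable_inner) simp
  have "(\<lambda>t. \<Sum>i\<in>Basis. \<Sum>j\<in>Basis. (q t \<bullet> i) * (q t \<bullet> j) * (indicator {a..b} t *\<^sub>R g c (?x t) i j)) \<in> borel_measurable lebesgue"
    by (intro borel_measurable_sum borel_measurable_times qi gm)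
  moreover have "(\<Sum>i\<in>Basis. \<Sum>j\<in>Basis. (q t \<bullet> i) * (q t \<bullet> j) * (indicator {a..b} t *\<^sub>R g c (?x t) i j))
      = indicator {a..b} t * accel_energy c y V w t" for t
  proof (cases "t \<in> {a..b}")
    case True
    then have "q t = cov_deriv g c (?x t) (V t) (V t) (w t)" by (simp add: q_def \<Gamma>_def cov_deriv_def)
    then show ?thesis
      using bilinear_expand[OF lm_bilinear[OF lc xU[OF True]], of "q t" "q t"] True by (simp add: accel_energy_def)
  qed simp
  ultimately show ?thesis by simp
qed

text \<open>
  The density is nonnegative and has integral zero, so the covariant acceleration vanishes almost
  everywhere. Thus the weak derivative of the velocity is minus the Christoffel term, which is
  continuous, and so the velocity is continuously differentiable.
\<close>

lemma zero_energy_local: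
  assumes y: "W22_curve M \<A> y" and zero: "spline_energy \<A> g y = 0"
    and c: "c \<in> \<A>" and ab: "0 \<le> a" "a < b" "b \<le> 1" and sub: "y ` {a..b} \<subseteq> chart_dom c"
  obtains V where "\<And>t. t \<in> {a..b} \<Longrightarrow> ((coord c \<circ> y) has_vector_derivative V t) (at t within {a..b})"
    "\<And>t. t \<in> {a..b} \<Longrightarrow> (V has_vector_derivative - christoffel g c (coord c (y t)) (V t) (V t)) (at t within {a..b})"
proof -
  note lc = chart_local_metric[OF c]
  let ?x = "\<lambda>t. coord c (y t)"
  have cont: "continuous_on {a..b} y"
    using y ab unfolding W22_curve_def by (auto elim: continuous_on_subset)
  obtain V w where Vw: "primitive_on a b V w"
    "\<And>t. t \<in> {a..b} \<Longrightarrow> ((coord c \<circ> y) has_vector_derivative V t) (at t within {a..b})"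
    "has_weak_derivative a b (coord c \<circ> y) V" "has_weak_derivative a b V w"
    using W22_curve_local[OF y c ab sub] by metis
  have xU: "?x t \<in> coord c ` chart_dom c" if "t \<in> {a..b}" for t using sub that by blast
  have cx: "continuous_on {a..b} ?x"
    using coord_curve_continuous[OF cont c sub] by (simp add: o_def)
  have cV: "continuous_on {a..b} V" by (rule primitive_on_continuous[OF Vw(1)])
  define \<Gamma> where "\<Gamma> t = christoffel g c (?x t) (V t) (V t)" for t
  have c\<Gamma>: "continuous_on {a..b} \<Gamma>"
    unfolding \<Gamma>_def by (rule christoffel_continuous_on[OF lc cx cV]) (use xU in blast)
  define f where "f = (SOME f. spline_integrand \<A> g y f)"
  have f: "spline_integrand \<A> g y f" unfolding f_def by (rule someI_ex[OF spline_integrand_exists[OF y]])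
  obtain v' w' where vw': "has_weak_derivative a b (coord c \<circ> y) v'" "has_weak_derivative a b v' w'"
    "AE t in lebesgue. t \<in> {a<..<b} \<longrightarrow> f t = accel_energy c y v' w' t"
    using f c ab sub unfolding spline_integrand_def accel_energy_def by blast
  have fe: "AE t in lebesgue. t \<in> {a<..<b} \<longrightarrow> f t = accel_energy c y V w t"
    using vw'(3) accel_energy_cong_AE[OF Vw(3,4) vw'(1,2) ab(2), of c y] by eventually_elim auto
  define k where "k t = indicator {a..b} t * accel_energy c y V w t" for t
  have km: "k \<in> borel_measurable lebesgue"
    unfolding k_def by (rule accel_energy_measurable[OF c cont sub Vw(1)])
  have ne: "AE t in lebesgue. t \<noteq> a" "AE t in lebesgue. t \<noteq> b"
    by (rule AE_I'[of "{a}"] AE_I'[of "{b}"]; auto simp: negligible_iff_null_sets[symmetric])+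
  have "(\<integral>\<^sup>+ t. ennreal (k t) \<partial>lebesgue) \<le> (\<integral>\<^sup>+ t\<in>{0..1}. ennreal (f t) \<partial>lebesgue)"
  proof (rule nn_integral_mono_AE)
    show "AE t in lebesgue. ennreal (k t) \<le> ennreal (f t) * indicator {0..1} t"
      using fe ne by eventually_elim (use ab in \<open>auto simp: k_def indicator_def\<close>)
  qed
  also have "\<dots> = 0" using zero by (simp add: spline_energy_def f_def)
  finally have "AE t in lebesgue. ennreal (k t) = 0"
    using km by (subst nn_integral_0_iff_AE[symmetric]) auto
  then have "AE t in lebesgue. t \<in> {a<..<b} \<longrightarrow> w t = - \<Gamma> t"
  proof eventually_elim
    case (elim t)
    show ?case
    proof
      assume t: "t \<in> {a<..<b}"
      then have t': "t \<in> {a..b}" by auto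
      have "accel_energy c y V w t \<le> 0" using elim t by (simp add: k_def ennreal_eq_0_iff)
      then have "cov_deriv g c (?x t) (V t) (V t) (w t) = 0"
        using lm_pos[OF lc xU[OF t']] unfolding accel_energy_def by (meson not_less)
      then show "w t = - \<Gamma> t" by (simp add: cov_deriv_def \<Gamma>_def eq_neg_iff_add_eq_0)
    qed
  qed
  then have "has_weak_derivative a b V (\<lambda>t. - \<Gamma> t)"
    by (intro has_weak_derivative_cong_AE[OF Vw(4)]) simp_all
  moreover have c\<Gamma>': "continuous_on {a..b} (\<lambda>t. - \<Gamma> t)" by (intro continuous_intros c\<Gamma>)
  ultimately obtain V' where V': "primitive_on a b V' (\<lambda>t. - \<Gamma> t)" "AE t in lebesgue. t \<in> {a<..<b} \<longrightarrow> V t = V' t"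
    using weak_derivative_imp_primitive[OF ab(2)] absolutely_integrable_continuous_real by metis
  have VV': "V t = V' t" if "t \<in> {a..b}" for t
    by (rule continuous_AE_eq[OF ab(2) cV primitive_on_continuous[OF V'(1)] V'(2) that])
  show thesis
  proof (rule that[OF Vw(2)])
    fix t assume t: "t \<in> {a..b}"
    show "(V has_vector_derivative - christoffel g c (coord c (y t)) (V t) (V t)) (at t within {a..b})"
      using has_vector_derivative_transform[OF t VV' primitive_on_has_vector_derivative[OF V'(1) c\<Gamma>' t]]
      by (simp add: \<Gamma>_def)
  qed
qed

lemma zero_energy_imp_geodesic:
  assumes y: "W22_curve M \<A> y" and zero: "spline_energy \<A> g y = 0"
  shows "locally_geodesic_on M \<A> g {0..1} y"
proof (rule locally_geodesic_onI)
  show cont: "continuous_on {0..1} y" "y ` {0..1} \<subseteq> M" using y by (auto simp: W22_curve_def)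
  fix c t assume c: "c \<in> \<A>" and t: "t \<in> {0..1}" and yt: "y t \<in> chart_dom c"
  obtain \<delta> where \<delta>: "\<delta> > 0" "\<And>s. s \<in> {0..1} \<Longrightarrow> \<bar>s - t\<bar> < \<delta> \<Longrightarrow> y s \<in> chart_dom c"
    using curve_stays_in_chart[OF cont c t yt] by metis
  define a where "a = max 0 (t - \<delta> / 2)"
  define b where "b = min 1 (t + \<delta> / 2)"
  have ab: "0 \<le> a" "a < b" "b \<le> 1" using \<delta>(1) t by (auto simp: a_def b_def)
  have "y ` {a..b} \<subseteq> chart_dom c"
  proof
    fix z assume "z \<in> y ` {a..b}"
    then obtain s where s: "s \<in> {a..b}" "z = y s" by blast
    then show "z \<in> chart_dom c" using \<delta>(2)[of s] \<delta>(1) by (auto simp: a_def b_def)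
  qed
  then obtain V where V: "\<And>t. t \<in> {a..b} \<Longrightarrow> ((coord c \<circ> y) has_vector_derivative V t) (at t within {a..b})"
    "\<And>t. t \<in> {a..b} \<Longrightarrow> (V has_vector_derivative - christoffel g c (coord c (y t)) (V t) (V t)) (at t within {a..b})"
    using zero_energy_local[OF y zero c ab] by metis
  have w: "at s within {a..b} = at s within {0..1}" if "s \<in> {0..1}" "\<bar>s - t\<bar> < \<delta> / 2" for s
  proof -
    have "t - \<delta> / 2 < s" "s < t + \<delta> / 2" using that(2) by arith+
    then show ?thesis
      by (intro at_within_nhd[of s "{t - \<delta> / 2<..<t + \<delta> / 2}"]) (use t in \<open>auto simp: a_def b_def\<close>)
  qed
  have m: "s \<in> {a..b}" if "s \<in> {0..1}" "\<bar>s - t\<bar> < \<delta> / 2" for s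
  proof -
    have "t - \<delta> / 2 < s" "s < t + \<delta> / 2" using that(2) by arith+
    then show ?thesis using that(1) by (auto simp: a_def b_def)
  qed
  show "\<exists>\<delta>>0. \<exists>V acc. (\<forall>s\<in>{0..1}. \<bar>s - t\<bar> < \<delta> \<longrightarrow> ((coord c \<circ> y) has_vector_derivative V s) (at s within {0..1})) \<and>
        (V has_vector_derivative acc) (at t within {0..1}) \<and> cov_deriv g c (coord c (y t)) (V t) (V t) acc = 0"
  proof (intro exI conjI ballI impI)
    show "\<delta> / 2 > 0" using \<delta> by simp
    show "((coord c \<circ> y) has_vector_derivative V s) (at s within {0..1})" if "s \<in> {0..1}" "\<bar>s - t\<bar> < \<delta> / 2" for s
      using V(1)[OF m[OF that]] unfolding w[OF that] .
    have t2: "\<bar>t - t\<bar> < \<delta> / 2" using \<delta>(1) by simp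
    show "(V has_vector_derivative - christoffel g c (coord c (y t)) (V t) (V t)) (at t within {0..1})"
      using V(2)[OF m[OF t t2]] unfolding w[OF t t2] .
    show "cov_deriv g c (coord c (y t)) (V t) (V t) (- christoffel g c (coord c (y t)) (V t) (V t)) = 0"
      by (simp add: cov_deriv_def)
  qed
qed simp

section \<open>Uniqueness of geodesics\<close>

text \<open>
  Referring to all charts around the point lets the condition pass from chart to chart along the curves.
\<close>

definition first_order_contact :: "real set \<Rightarrow> (real \<Rightarrow> 'm) \<Rightarrow> (real \<Rightarrow> 'm) \<Rightarrow> real \<Rightarrow> bool" where
  "first_order_contact J y z t \<longleftrightarrow> y t = z t \<and>
     (\<forall>c\<in>\<A>. y t \<in> chart_dom c \<longrightarrow>
       (\<exists>v. ((coord c \<circ> y) has_vector_derivative v) (at t within J) \<and>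
            ((coord c \<circ> z) has_vector_derivative v) (at t within J)))"

lemma first_order_contactI:
  assumes y: "continuous_on J y" "y ` J \<subseteq> M" and z: "continuous_on J z" "z ` J \<subseteq> M" and t: "t \<in> J"
    and c: "c \<in> \<A>" "y t \<in> chart_dom c" "y t = z t"
    and v: "((coord c \<circ> y) has_vector_derivative v) (at t within J)" "((coord c \<circ> z) has_vector_derivative v) (at t within J)"
  shows "first_order_contact J y z t"
  unfolding first_order_contact_def
proof (intro conjI ballI impI c(3))
  fix d assume d: "d \<in> \<A>" "y t \<in> chart_dom d"
  show "\<exists>v. ((coord d \<circ> y) has_vector_derivative v) (at t within J) \<and>
            ((coord d \<circ> z) has_vector_derivative v) (at t within J)"
    using velocity_transform[OF y c(1) d(1) t c(2) d(2) v(1)] velocity_transform[OF z c(1) d(1) t _ _ v(2)] c d by auto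
qed

text \<open>
  In a chart the difference \<open>D\<close> of the two states (position, velocity) satisfies
  \<open>norm D' \<le> (1 + L) norm D\<close> and vanishes at \<open>t\<close>. On an interval of radius less than \<open>1 / (2 (1 + L))\<close> the
  maximum of \<open>norm D\<close> is then at most half of itself.
\<close>

lemma geodesic_local_uniqueness:
  assumes ab: "a < b" and y: "locally_geodesic_on M \<A> g {a..b} y" and z: "locally_geodesic_on M \<A> g {a..b} z"
    and t: "t \<in> {a..b}" and contact: "first_order_contact {a..b} y z t"
  obtains h where "h > 0" "\<And>s. s \<in> {a..b} \<Longrightarrow> \<bar>s - t\<bar> < h \<Longrightarrow> first_order_contact {a..b} y z s"
proof -
  let ?J = "{a..b}"
  have yc: "continuous_on ?J y" "y ` ?J \<subseteq> M" and zc: "continuous_on ?J z" "z ` ?J \<subseteq> M"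
    using y z by (auto simp: locally_geodesic_on_def)
  obtain c where c: "c \<in> \<A>" "y t \<in> chart_dom c" using chart_exists[of "y t"] yc(2) t by blast
  have yz: "y t = z t" using contact by (simp add: first_order_contact_def)
  note lc = chart_local_metric[OF c(1)]
  obtain vy ay where vy: "\<And>s. s \<in> ?J \<Longrightarrow> y s \<in> chart_dom c \<Longrightarrow>
        ((coord c \<circ> y) has_vector_derivative vy s) (at s within ?J) \<and>
        (vy has_vector_derivative ay s) (at s within ?J) \<and> cov_deriv g c (coord c (y s)) (vy s) (vy s) (ay s) = 0"
    using y c(1) unfolding locally_geodesic_on_def by metis
  obtain vz az where vz: "\<And>s. s \<in> ?J \<Longrightarrow> z s \<in> chart_dom c \<Longrightarrow>
        ((coord c \<circ> z) has_vector_derivative vz s) (at s within ?J) \<and>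
        (vz has_vector_derivative az s) (at s within ?J) \<and> cov_deriv g c (coord c (z s)) (vz s) (vz s) (az s) = 0"
    using z c(1) unfolding locally_geodesic_on_def by metis
  have veq: "vy t = vz t"
    using contact vy[OF t c(2)] vz[OF t] yz c vector_derivative_within_unique[OF ab t]
    unfolding first_order_contact_def by metis
  let ?x0 = "coord c (y t)"
  have x0: "?x0 \<in> coord c ` chart_dom c" using c by blast
  obtain r L where r: "r > 0" "L \<ge> 0" "cball ?x0 r \<subseteq> coord c ` chart_dom c"
    and L: "\<And>p q. p \<in> cball ?x0 r \<times> cball 0 (norm (vy t) + 1) \<Longrightarrow> q \<in> cball ?x0 r \<times> cball 0 (norm (vy t) + 1) \<Longrightarrow>
       norm (christoffel g c (fst p) (snd p) (snd p) - christoffel g c (fst q) (snd q) (snd q)) \<le> L * dist p q"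
    by (rule christoffel_lipschitz[OF lc x0, where R = "norm (vy t) + 1"]) blast
  obtain d1 where d1: "d1 > 0" "\<And>s. s \<in> ?J \<Longrightarrow> \<bar>s - t\<bar> < d1 \<Longrightarrow> y s \<in> chart_dom c"
    using curve_stays_in_chart[OF yc c(1) t c(2)] by metis
  obtain d2 where d2: "d2 > 0" "\<And>s. s \<in> ?J \<Longrightarrow> \<bar>s - t\<bar> < d2 \<Longrightarrow> z s \<in> chart_dom c"
    using curve_stays_in_chart[OF zc c(1) t] c(2) yz by metis
  have near: "\<exists>d>0. \<forall>s\<in>?J. \<bar>s - t\<bar> < d \<longrightarrow> dist (h s) (h t) < e"
    if "(h has_vector_derivative h') (at t within ?J)" "e > 0" for h :: "real \<Rightarrow> 'e" and h' e
  proof -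
    have "continuous (at t within ?J) h" using has_vector_derivative_continuous[OF that(1)] .
    then show ?thesis using that(2) unfolding continuous_within_eps_delta by (simp add: dist_real_def)
  qed
  have e1: "\<exists>d>0. \<forall>s\<in>?J. \<bar>s - t\<bar> < d \<longrightarrow> dist (coord c (y s)) ?x0 < r"
    using near[of "coord c \<circ> y" "vy t" r] vy[OF t c(2)] r(1) by simp
  have e2: "\<exists>d>0. \<forall>s\<in>?J. \<bar>s - t\<bar> < d \<longrightarrow> dist (coord c (z s)) ?x0 < r"
    using near[of "coord c \<circ> z" "vz t" r] vz[OF t] c(2) yz r(1) by simp
  have e3: "\<exists>d>0. \<forall>s\<in>?J. \<bar>s - t\<bar> < d \<longrightarrow> dist (vy s) (vy t) < 1"
    using near[of vy "ay t" 1] vy[OF t c(2)] by simp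
  have e4: "\<exists>d>0. \<forall>s\<in>?J. \<bar>s - t\<bar> < d \<longrightarrow> dist (vz s) (vy t) < 1"
    using near[of vz "az t" 1] vz[OF t] c(2) yz veq by simp
  obtain d3 where d3: "d3 > 0" "\<And>s. s \<in> ?J \<Longrightarrow> \<bar>s - t\<bar> < d3 \<Longrightarrow> dist (coord c (y s)) ?x0 < r" using e1 by blast
  obtain d4 where d4: "d4 > 0" "\<And>s. s \<in> ?J \<Longrightarrow> \<bar>s - t\<bar> < d4 \<Longrightarrow> dist (coord c (z s)) ?x0 < r" using e2 by blast
  obtain d5 where d5: "d5 > 0" "\<And>s. s \<in> ?J \<Longrightarrow> \<bar>s - t\<bar> < d5 \<Longrightarrow> dist (vy s) (vy t) < 1" using e3 by blast
  obtain d6 where d6: "d6 > 0" "\<And>s. s \<in> ?J \<Longrightarrow> \<bar>s - t\<bar> < d6 \<Longrightarrow> dist (vz s) (vy t) < 1" using e4 by blast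
  define m where "m = Min {d1, d2, d3, d4, d5, d6, 1 / (2 * (1 + L))}"
  define h where "h = m / 2"
  have m: "m > 0" using d1(1) d2(1) d3(1) d4(1) d5(1) d6(1) r(2) by (simp add: m_def)
  have md: "m \<le> d1" "m \<le> d2" "m \<le> d3" "m \<le> d4" "m \<le> d5" "m \<le> d6" "m \<le> 1 / (2 * (1 + L))"
    unfolding m_def by (rule Min_le; simp)+
  have h: "h > 0" using m by (simp add: h_def)
  have hd: "h < d1" "h < d2" "h < d3" "h < d4" "h < d5" "h < d6" "h \<le> 1 / (2 * (1 + L))"
    using m md by (auto simp: h_def)
  \<comment> \<open>a closed interval, so that the norm of the difference attains its maximum\<close>
  define K where "K = {max a (t - h)..min b (t + h)}"
  have K: "K \<subseteq> ?J" "t \<in> K" "\<And>s. s \<in> K \<Longrightarrow> \<bar>s - t\<bar> \<le> h" using t h by (auto simp: K_def)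
  have KJ: "s \<in> ?J" "\<bar>s - t\<bar> < d1" "\<bar>s - t\<bar> < d2" "\<bar>s - t\<bar> < d3" "\<bar>s - t\<bar> < d4" "\<bar>s - t\<bar> < d5" "\<bar>s - t\<bar> < d6"
    if "s \<in> K" for s using K(1) K(3)[OF that] hd that by auto
  define Y where "Y s = (coord c (y s), vy s)" for s
  define Z where "Z s = (coord c (z s), vz s)" for s
  define D where "D s = Y s - Z s" for s
  define \<Gamma> where "\<Gamma> p = christoffel g c (fst p) (snd p) (snd p)" for p
  have inY: "Y s \<in> cball ?x0 r \<times> cball 0 (norm (vy t) + 1)" and inZ: "Z s \<in> cball ?x0 r \<times> cball 0 (norm (vy t) + 1)"
    if s: "s \<in> K" for s
  proof -
    have n: "norm u \<le> norm (vy t) + 1" if "dist u (vy t) < 1" for u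
      using that norm_triangle_ineq2[of u "vy t"] by (simp add: dist_norm)
    show "Y s \<in> cball ?x0 r \<times> cball 0 (norm (vy t) + 1)" "Z s \<in> cball ?x0 r \<times> cball 0 (norm (vy t) + 1)"
      using d3(2)[OF KJ(1,4)[OF s]] d4(2)[OF KJ(1,5)[OF s]] n[OF d5(2)[OF KJ(1,6)[OF s]]] n[OF d6(2)[OF KJ(1,7)[OF s]]]
      by (auto simp: Y_def Z_def dist_commute)
  qed
  have dD: "(D has_vector_derivative (vy s - vz s, - \<Gamma> (Y s) + \<Gamma> (Z s))) (at s within K)" if s: "s \<in> K" for s
  proof -
    note fy = vy[OF KJ(1)[OF s] d1(2)[OF KJ(1,2)[OF s]]] and fz = vz[OF KJ(1)[OF s] d2(2)[OF KJ(1,3)[OF s]]]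
    have "ay s = - \<Gamma> (Y s)" "az s = - \<Gamma> (Z s)"
      using fy fz by (auto simp: \<Gamma>_def Y_def Z_def cov_deriv_def eq_neg_iff_add_eq_0)
    then have "((\<lambda>s. ((coord c \<circ> y) s - (coord c \<circ> z) s, vy s - vz s)) has_vector_derivative (vy s - vz s, - \<Gamma> (Y s) - - \<Gamma> (Z s))) (at s within ?J)"
      using fy fz by (intro has_vector_derivative_Pair has_vector_derivative_diff) (auto simp: o_def)
    moreover have "(\<lambda>s. ((coord c \<circ> y) s - (coord c \<circ> z) s, vy s - vz s)) = D" by (auto simp: D_def Y_def Z_def)
    ultimately show ?thesis using has_vector_derivative_within_subset[OF _ K(1)] by simp
  qed
  have bound: "norm (vy s - vz s, - \<Gamma> (Y s) + \<Gamma> (Z s)) \<le> (1 + L) * norm (D s)" if s: "s \<in> K" for s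
  proof -
    have "norm (vy s - vz s, - \<Gamma> (Y s) + \<Gamma> (Z s)) \<le> norm (vy s - vz s) + norm (- \<Gamma> (Y s) + \<Gamma> (Z s))"
      by (rule norm_Pair_le)
    also have "norm (vy s - vz s) \<le> norm (D s)"
      using norm_snd_le[of "vy s - vz s" "coord c (y s) - coord c (z s)"] by (simp add: D_def Y_def Z_def)
    also have "norm (- \<Gamma> (Y s) + \<Gamma> (Z s)) = norm (\<Gamma> (Y s) - \<Gamma> (Z s))" using norm_minus_commute[of "\<Gamma> (Y s)" "\<Gamma> (Z s)"] by simp
    also have "\<dots> \<le> L * norm (D s)"
      using L[OF inY[OF s] inZ[OF s]] by (simp add: \<Gamma>_def D_def dist_norm)
    finally show ?thesis by (simp add: algebra_simps)
  qed
  have "compact K" "K \<noteq> {}" using K(2) by (auto simp: K_def)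
  moreover have cD: "continuous_on K (\<lambda>s. norm (D s))"
    using continuous_on_vector_derivative[OF dD] by (intro continuous_intros)
  ultimately obtain s0 where s0: "s0 \<in> K" "\<And>s. s \<in> K \<Longrightarrow> norm (D s) \<le> norm (D s0)"
    using continuous_attains_sup by metis
  have "norm (D s0 - D t) \<le> ((1 + L) * norm (D s0)) * norm (s0 - t)"
  proof (rule differentiable_bound[of K D "\<lambda>s h. h *\<^sub>R (vy s - vz s, - \<Gamma> (Y s) + \<Gamma> (Z s))"])
    show "convex K" by (simp add: K_def)
    fix s assume s: "s \<in> K"
    show "(D has_derivative (\<lambda>h. h *\<^sub>R (vy s - vz s, - \<Gamma> (Y s) + \<Gamma> (Z s)))) (at s within K)"
      using dD[OF s] by (simp only: has_vector_derivative_def)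
    have "norm (vy s - vz s, - \<Gamma> (Y s) + \<Gamma> (Z s)) \<le> (1 + L) * norm (D s0)"
      by (rule order.trans[OF bound[OF s]]) (use s0(2)[OF s] r(2) in \<open>auto intro: mult_left_mono\<close>)
    then have "norm (x *\<^sub>R (vy s - vz s, - \<Gamma> (Y s) + \<Gamma> (Z s))) \<le> (1 + L) * norm (D s0) * norm x" for x
      unfolding norm_scaleR real_norm_def mult.commute[of "\<bar>x\<bar>"] by (rule mult_right_mono) simp
    then show "onorm (\<lambda>h. h *\<^sub>R (vy s - vz s, - \<Gamma> (Y s) + \<Gamma> (Z s))) \<le> (1 + L) * norm (D s0)"
      by (rule onorm_le)
  qed (use s0 K in auto)
  moreover have "D t = 0" by (simp add: D_def Y_def Z_def veq yz)
  moreover have "(1 + L) * norm (D s0) * norm (s0 - t) \<le> (1 + L) * norm (D s0) * (1 / (2 * (1 + L)))"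
    using K(3)[OF s0(1)] hd(7) r(2) by (intro mult_left_mono) auto
  moreover have "(1 + L) * norm (D s0) * (1 / (2 * (1 + L))) = norm (D s0) / 2"
  proof -
    have "k * n * (1 / (2 * k)) = n / 2" if "k \<noteq> 0" for k n :: real using that by simp
    then show ?thesis using r(2) by (metis add_nonneg_eq_0_iff zero_le_one zero_neq_one)
  qed
  ultimately have "norm (D s0) \<le> norm (D s0) / 2" by (metis diff_zero order.trans)
  then have "norm (D s0) = 0" by simp
  then have D0: "D s = 0" if "s \<in> K" for s using s0(2)[OF that] by simp
  show thesis
  proof (rule that[OF h])
    fix s assume s: "s \<in> ?J" "\<bar>s - t\<bar> < h"
    then have sK: "s \<in> K" by (auto simp: K_def)
    have *: "coord c (y s) = coord c (z s)" "vy s = vz s" using D0[OF sK] by (simp_all add: D_def Y_def Z_def zero_prod_def)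
    have ys: "y s \<in> chart_dom c" "z s \<in> chart_dom c" using d1(2)[OF KJ(1,2)[OF sK]] d2(2)[OF KJ(1,3)[OF sK]] .
    show "first_order_contact ?J y z s"
    proof (rule first_order_contactI[OF yc zc s(1) c(1) ys(1)])
      show "y s = z s" using *(1) ys inj_onD[OF chart_facts(5)[OF c(1)]] by blast
      show "((coord c \<circ> y) has_vector_derivative vy s) (at s within ?J)" using vy[OF s(1) ys(1)] by blast
      show "((coord c \<circ> z) has_vector_derivative vy s) (at s within ?J)" using vz[OF s(1) ys(2)] *(2) by simp
    qed
  qed
qed

text \<open>
  The times of first-order contact form a subset of the interval that is open by
  \<open>geodesic_local_uniqueness\<close> and closed because the velocities are continuous.
\<close>

lemma geodesic_uniqueness:
  assumes ab: "a < b" and y: "locally_geodesic_on M \<A> g {a..b} y" and z: "locally_geodesic_on M \<A> g {a..b} z"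
    and t: "t \<in> {a..b}" and contact: "first_order_contact {a..b} y z t" and s: "s \<in> {a..b}"
  shows "y s = z s"
proof -
  let ?J = "{a..b}"
  have yc: "continuous_on ?J y" "y ` ?J \<subseteq> M" and zc: "continuous_on ?J z" "z ` ?J \<subseteq> M"
    using y z by (auto simp: locally_geodesic_on_def)
  define T where "T = {t \<in> ?J. first_order_contact ?J y z t}"
  have "openin (top_of_set ?J) T"
    unfolding openin_euclidean_subtopology_iff
  proof (intro conjI ballI)
    fix t assume "t \<in> T"
    then have t: "t \<in> ?J" "first_order_contact ?J y z t" by (auto simp: T_def)
    obtain h where "h > 0" "\<And>s. s \<in> ?J \<Longrightarrow> \<bar>s - t\<bar> < h \<Longrightarrow> first_order_contact ?J y z s"
      using geodesic_local_uniqueness[OF ab y z t] by metis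
    then show "\<exists>e>0. \<forall>s\<in>?J. dist s t < e \<longrightarrow> s \<in> T" by (auto simp: T_def dist_real_def)
  qed (auto simp: T_def)
  moreover have "closed T"
    unfolding closed_limpt
  proof (intro allI impI)
    fix t assume lim: "t islimpt T"
    have TJ: "T \<subseteq> ?J" by (auto simp: T_def)
    have "t islimpt ?J" by (rule islimpt_subset[OF lim TJ])
    then have tJ: "t \<in> ?J" using closed_limpt[of ?J] closed_atLeastAtMost by blast
    have nt: "at t within T \<noteq> bot" using lim by (simp add: trivial_limit_within)
    have ev: "eventually (\<lambda>s. s \<in> T) (at t within T)" by (simp add: eventually_at_filter)
    have "(y \<longlongrightarrow> y t) (at t within T)" "(z \<longlongrightarrow> z t) (at t within T)"
      using yc(1) zc(1) tJ unfolding continuous_on_def by (blast intro: tendsto_within_subset[OF _ TJ])+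
    moreover have "eventually (\<lambda>s. y s = z s) (at t within T)"
      using ev by eventually_elim (auto simp: T_def first_order_contact_def)
    ultimately have yz: "y t = z t"
      by (metis tendsto_unique[OF nt] tendsto_cong)
    obtain c where c: "c \<in> \<A>" "y t \<in> chart_dom c" using chart_exists[of "y t"] yc(2) tJ by blast
    obtain vy ay where vy: "\<And>s. s \<in> ?J \<Longrightarrow> y s \<in> chart_dom c \<Longrightarrow>
        ((coord c \<circ> y) has_vector_derivative vy s) (at s within ?J) \<and> (vy has_vector_derivative ay s) (at s within ?J)"
      using y c(1) unfolding locally_geodesic_on_def by metis
    obtain vz az where vz: "\<And>s. s \<in> ?J \<Longrightarrow> z s \<in> chart_dom c \<Longrightarrow>
        ((coord c \<circ> z) has_vector_derivative vz s) (at s within ?J) \<and> (vz has_vector_derivative az s) (at s within ?J)"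
      using z c(1) unfolding locally_geodesic_on_def by metis
    obtain d where d: "d > 0" "\<And>s. s \<in> ?J \<Longrightarrow> \<bar>s - t\<bar> < d \<Longrightarrow> y s \<in> chart_dom c"
      using curve_stays_in_chart[OF yc c(1) tJ c(2)] by metis
    have ty: "(vy \<longlongrightarrow> vy t) (at t within T)" "(vz \<longlongrightarrow> vz t) (at t within T)"
    proof -
      have "continuous (at t within ?J) vy" "continuous (at t within ?J) vz"
        using vy[OF tJ c(2)] vz[OF tJ] c(2) yz has_vector_derivative_continuous by auto
      then show "(vy \<longlongrightarrow> vy t) (at t within T)" "(vz \<longlongrightarrow> vz t) (at t within T)"
        unfolding continuous_within by (blast intro: tendsto_within_subset[OF _ TJ])+
    qed
    have "eventually (\<lambda>s. dist s t < d) (at t within T)"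
      using d(1) by (auto simp: eventually_at)
    with ev have "eventually (\<lambda>s. vy s = vz s) (at t within T)"
    proof eventually_elim
      case (elim s)
      then have s: "s \<in> ?J" "first_order_contact ?J y z s" "y s \<in> chart_dom c" using d(2) by (auto simp: T_def dist_real_def)
      then obtain v where "((coord c \<circ> y) has_vector_derivative v) (at s within ?J)" "((coord c \<circ> z) has_vector_derivative v) (at s within ?J)" "y s = z s"
        using c(1) unfolding first_order_contact_def by blast
      then show "vy s = vz s"
        using vy[OF s(1,3)] vz[OF s(1)] s(3) vector_derivative_within_unique[OF ab s(1)] by metis
    qed
    then have "vy t = vz t" using ty by (metis tendsto_unique[OF nt] tendsto_cong)
    then have "first_order_contact ?J y z t"
      by (intro first_order_contactI[OF yc zc tJ c yz, of "vy t"]) (use vy[OF tJ c(2)] vz[OF tJ] c(2) yz in auto)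
    then show "t \<in> T" using tJ by (simp add: T_def)
  qed
  then have "closedin (top_of_set ?J) T" by (rule closed_subset[rotated]) (auto simp: T_def)
  moreover have "t \<in> T" using t contact by (simp add: T_def)
  ultimately have "T = ?J"
    using connected_clopen[of ?J] connected_Icc[of a b] by blast
  then show ?thesis using s by (auto simp: T_def first_order_contact_def)
qed

section \<open>Geodesics inside a closed geodesic curve\<close>

text \<open>
  The case \<open>l = 0\<close> shows that constant curves are geodesics.
\<close>

lemma geodesic_reparam:
  assumes \<gamma>: "locally_geodesic_on M \<A> g UNIV \<gamma>"
  shows "locally_geodesic_on M \<A> g J (\<lambda>t. \<gamma> (\<tau> + l * t))"
  unfolding locally_geodesic_on_def
proof (intro conjI ballI)
  have c\<gamma>: "continuous_on UNIV \<gamma>" "\<gamma> ` UNIV \<subseteq> M" using \<gamma> by (auto simp: locally_geodesic_on_def)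
  show "continuous_on J (\<lambda>t. \<gamma> (\<tau> + l * t))"
    by (rule continuous_on_compose2[OF c\<gamma>(1)]) (auto intro!: continuous_intros)
  show "(\<lambda>t. \<gamma> (\<tau> + l * t)) ` J \<subseteq> M" using c\<gamma>(2) by blast
  fix c assume c: "c \<in> \<A>"
  obtain v a where va: "\<And>t. \<gamma> t \<in> chart_dom c \<Longrightarrow>
        ((coord c \<circ> \<gamma>) has_vector_derivative v t) (at t) \<and>
        (v has_vector_derivative a t) (at t) \<and> cov_deriv g c (coord c (\<gamma> t)) (v t) (v t) (a t) = 0"
    using \<gamma> c unfolding locally_geodesic_on_def by (metis UNIV_I)
  show "\<exists>v a. \<forall>t\<in>J. \<gamma> (\<tau> + l * t) \<in> chart_dom c \<longrightarrow>
        ((coord c \<circ> (\<lambda>t. \<gamma> (\<tau> + l * t))) has_vector_derivative v t) (at t within J) \<and>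
        (v has_vector_derivative a t) (at t within J) \<and>
        cov_deriv g c (coord c (\<gamma> (\<tau> + l * t))) (v t) (v t) (a t) = 0"
  proof (rule exI[of _ "\<lambda>t. l *\<^sub>R v (\<tau> + l * t)"],
      rule exI[of _ "\<lambda>t. l *\<^sub>R (l *\<^sub>R a (\<tau> + l * t))"], intro ballI impI conjI)
    fix t assume t: "t \<in> J" "\<gamma> (\<tau> + l * t) \<in> chart_dom c"
    have \<phi>: "((\<lambda>t. \<tau> + l * t) has_real_derivative l) (at t within J)"
      by (auto intro!: derivative_eq_intros)
    note A = va[OF t(2)]
    show "((coord c \<circ> (\<lambda>t. \<gamma> (\<tau> + l * t))) has_vector_derivative l *\<^sub>R v (\<tau> + l * t)) (at t within J)"
      using has_vector_derivative_reparam[OF conjunct1[OF A] \<phi>] by (simp add: o_def)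
    have "((\<lambda>t. v (\<tau> + l * t)) has_vector_derivative l *\<^sub>R a (\<tau> + l * t)) (at t within J)"
      by (rule has_vector_derivative_reparam[OF _ \<phi>]) (use A in blast)
    then show "((\<lambda>t. l *\<^sub>R v (\<tau> + l * t)) has_vector_derivative l *\<^sub>R (l *\<^sub>R a (\<tau> + l * t))) (at t within J)"
      by (rule bounded_linear.has_vector_derivative[OF bounded_linear_scaleR_right])
    have "coord c (\<gamma> (\<tau> + l * t)) \<in> coord c ` chart_dom c" using t by blast
    from christoffel_scale[OF chart_local_metric[OF c] this, of l "v (\<tau> + l * t)"]
    have "cov_deriv g c (coord c (\<gamma> (\<tau> + l * t))) (l *\<^sub>R v (\<tau> + l * t)) (l *\<^sub>R v (\<tau> + l * t)) (l *\<^sub>R (l *\<^sub>R a (\<tau> + l * t)))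
        = l\<^sup>2 *\<^sub>R cov_deriv g c (coord c (\<gamma> (\<tau> + l * t))) (v (\<tau> + l * t)) (v (\<tau> + l * t)) (a (\<tau> + l * t))"
      by (simp add: cov_deriv_def power2_eq_square scaleR_add_right)
    then show "cov_deriv g c (coord c (\<gamma> (\<tau> + l * t))) (l *\<^sub>R v (\<tau> + l * t)) (l *\<^sub>R v (\<tau> + l * t)) (l *\<^sub>R (l *\<^sub>R a (\<tau> + l * t))) = 0"
      using A by simp
  qed
qed

lemma speed_chart_independent:
  assumes y: "continuous_on UNIV y" "range y \<subseteq> M" and c: "c \<in> \<A>" "y t \<in> chart_dom c" and d: "d \<in> \<A>" "y t \<in> chart_dom d"
    and v: "((coord c \<circ> y) has_vector_derivative v) (at t)" and w: "((coord d \<circ> y) has_vector_derivative w) (at t)"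
  shows "g c (coord c (y t)) v v = g d (coord d (y t)) w w"
proof -
  have "((coord d \<circ> y) has_vector_derivative frechet_derivative (transition c d) (at (coord c (y t))) v) (at t)"
    by (rule velocity_transform[OF y c(1) d(1) UNIV_I c(2) d(2) v])
  then have "w = frechet_derivative (transition c d) (at (coord c (y t))) v"
    using w vector_derivative_unique_at by blast
  moreover have "coord c (y t) \<in> coord c ` (chart_dom c \<inter> chart_dom d)" using c d by blast
  ultimately show ?thesis
    using transition_facts(5)[OF c(1) d(1), of "coord c (y t)" v v] transition_apply[OF c] by simp
qed

text \<open>
  The speed does not depend on the chart, so its derivative may be computed in any chart around a point.
\<close>

lemma geodesic_constant_speed:
  assumes \<gamma>: "locally_geodesic_on M \<A> g UNIV \<gamma>"
  obtains G where "\<And>c s v. c \<in> \<A> \<Longrightarrow> \<gamma> s \<in> chart_dom c \<Longrightarrow> ((coord c \<circ> \<gamma>) has_vector_derivative v) (at s) \<Longrightarrow>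
    g c (coord c (\<gamma> s)) v v = G"
proof -
  have c\<gamma>: "continuous_on UNIV \<gamma>" "range \<gamma> \<subseteq> M" using \<gamma> by (auto simp: locally_geodesic_on_def)
  have "\<forall>s. \<exists>c. c \<in> \<A> \<and> \<gamma> s \<in> chart_dom c" using chart_exists c\<gamma>(2) by blast
  then obtain ch where ch: "\<And>s. ch s \<in> \<A>" "\<And>s. \<gamma> s \<in> chart_dom (ch s)" by metis
  have "\<forall>c. \<exists>v a. c \<in> \<A> \<longrightarrow> (\<forall>t. \<gamma> t \<in> chart_dom c \<longrightarrow>
        ((coord c \<circ> \<gamma>) has_vector_derivative v t) (at t) \<and>
        (v has_vector_derivative a t) (at t) \<and> cov_deriv g c (coord c (\<gamma> t)) (v t) (v t) (a t) = 0)"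
    using \<gamma> unfolding locally_geodesic_on_def by (metis UNIV_I)
  then obtain v a where va: "\<And>c t. c \<in> \<A> \<Longrightarrow> \<gamma> t \<in> chart_dom c \<Longrightarrow>
        ((coord c \<circ> \<gamma>) has_vector_derivative v c t) (at t) \<and>
        (v c has_vector_derivative a c t) (at t) \<and> cov_deriv g c (coord c (\<gamma> t)) (v c t) (v c t) (a c t) = 0"
    by metis
  define sp where "sp s = g (ch s) (coord (ch s) (\<gamma> s)) (v (ch s) s) (v (ch s) s)" for s
  have sp: "g c (coord c (\<gamma> s)) w w = sp s" if c: "c \<in> \<A>" "\<gamma> s \<in> chart_dom c" "((coord c \<circ> \<gamma>) has_vector_derivative w) (at s)" for c s w
    unfolding sp_def
    by (rule speed_chart_independent[OF c\<gamma> c(1,2) ch(1) ch(2) c(3)]) (use va[OF ch(1) ch(2)] in blast)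
  have "(sp has_real_derivative 0) (at s)" for s
  proof -
    define c where "c = ch s"
    have c: "c \<in> \<A>" "\<gamma> s \<in> chart_dom c" using ch by (auto simp: c_def)
    obtain \<delta> where \<delta>: "\<delta> > 0" "\<And>s'. \<bar>s' - s\<bar> < \<delta> \<Longrightarrow> \<gamma> s' \<in> chart_dom c"
      using curve_stays_in_chart[OF c\<gamma> c(1) UNIV_I c(2)] by (metis UNIV_I)
    let ?B = "ball s \<delta>"
    have B: "\<gamma> s' \<in> chart_dom c" if "s' \<in> ?B" for s' using \<delta>(2)[of s'] that by (simp add: dist_real_def abs_minus_commute)
    have sB: "s \<in> ?B" using \<delta>(1) by simp
    have "((\<lambda>t. g c ((coord c \<circ> \<gamma>) t) (v c t) (v c t)) has_vector_derivative 0) (at s within ?B)"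
    proof (rule geodesic_speed_constant[OF chart_local_metric[OF c(1)], where V = "v c" and a = "a c s" and X = "coord c \<circ> \<gamma>"])
      show "((coord c \<circ> \<gamma>) has_vector_derivative v c s) (at s within ?B)" "(v c has_vector_derivative a c s) (at s within ?B)"
        using va[OF c] has_vector_derivative_at_within by blast+
      show "cov_deriv g c ((coord c \<circ> \<gamma>) s) (v c s) (v c s) (a c s) = 0" using va[OF c] by simp
      show "(coord c \<circ> \<gamma>) ` ?B \<subseteq> coord c ` chart_dom c" using B by force
    qed (rule sB)
    then have "(sp has_vector_derivative 0) (at s within ?B)"
      by (rule has_vector_derivative_transform[OF sB, rotated]) (use sp[OF c(1) B] va[OF c(1) B] in simp)
    then show ?thesis
      unfolding has_real_derivative_iff_has_vector_derivative using at_within_open[OF sB open_ball] by simp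
  qed
  then have "sp s = sp 0" for s using DERIV_isconst_all[of sp s 0] by blast
  then show thesis using that[of "sp 0"] sp by metis
qed

text \<open>
  A geodesic at rest at one time has first-order contact with a constant curve.
\<close>

lemma geodesic_velocity_nonzero:
  assumes \<gamma>: "locally_geodesic_on M \<A> g UNIV \<gamma>" and nonconst: "\<not> \<gamma> constant_on UNIV"
    and c: "c \<in> \<A>" "\<gamma> s \<in> chart_dom c" and v: "((coord c \<circ> \<gamma>) has_vector_derivative v) (at s)"
  shows "v \<noteq> 0"
proof
  assume v0: "v = 0"
  have "\<gamma> x = \<gamma> s" for x
  proof -
    define a where "a = min s x - 1"
    define b where "b = max s x + 1"
    have ab: "a < b" "s \<in> {a..b}" "x \<in> {a..b}" by (auto simp: a_def b_def)
    have 1: "locally_geodesic_on M \<A> g {a..b} \<gamma>" using geodesic_reparam[OF \<gamma>, of "{a..b}" 0 1] by simp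
    have 2: "locally_geodesic_on M \<A> g {a..b} (\<lambda>_. \<gamma> s)" using geodesic_reparam[OF \<gamma>, of "{a..b}" s 0] by simp
    have "first_order_contact {a..b} \<gamma> (\<lambda>_. \<gamma> s) s"
    proof (rule first_order_contactI[where y = \<gamma> and z = "\<lambda>_. \<gamma> s", OF _ _ _ _ ab(2) c refl])
      show "((coord c \<circ> \<gamma>) has_vector_derivative v) (at s within {a..b})" using v by (rule has_vector_derivative_at_within)
      show "((coord c \<circ> (\<lambda>_. \<gamma> s)) has_vector_derivative v) (at s within {a..b})" by (simp add: v0 o_def)
    qed (use 1 2 in \<open>auto simp: locally_geodesic_on_def\<close>)
    from geodesic_uniqueness[OF ab(1) 1 2 ab(2) this ab(3)] show ?thesis .
  qed
  then show False using nonconst by (auto simp: constant_on_def)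
qed

text \<open>
  At an accumulation point of a fibre the difference quotients along the fibre, and so the velocity,
  would be zero. Hence fibres are discrete.
\<close>

lemma geodesic_fibre_countable:
  assumes \<gamma>: "locally_geodesic_on M \<A> g UNIV \<gamma>" and nonconst: "\<not> \<gamma> constant_on UNIV"
  shows "countable {s. \<gamma> s = q}"
proof -
  have c\<gamma>: "continuous_on UNIV \<gamma>" "range \<gamma> \<subseteq> M" using \<gamma> by (auto simp: locally_geodesic_on_def)
  have nolim: "\<not> s islimpt {s. \<gamma> s = q}" for s
  proof
    assume lim: "s islimpt {s. \<gamma> s = q}"
    have "closed (\<gamma> -` {q})" by (rule closed_vimage[OF closed_singleton c\<gamma>(1)])
    moreover have "\<gamma> -` {q} = {s. \<gamma> s = q}" by auto
    ultimately have "closed {s. \<gamma> s = q}" by simp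
    then have "s \<in> {s. \<gamma> s = q}" using lim unfolding closed_limpt by blast
    then have sq: "\<gamma> s = q" by simp
    obtain c where c: "c \<in> \<A>" "\<gamma> s \<in> chart_dom c" using chart_exists[of "\<gamma> s"] c\<gamma>(2) by blast
    obtain v where v: "((coord c \<circ> \<gamma>) has_vector_derivative v) (at s)"
      using \<gamma> c unfolding locally_geodesic_on_def by (metis UNIV_I)
    let ?F = "at s within {s. \<gamma> s = q}"
    have "((\<lambda>t. (1 / (t - s)) *\<^sub>R ((coord c \<circ> \<gamma>) t - (coord c \<circ> \<gamma>) s)) \<longlongrightarrow> v) ?F"
      by (rule has_vector_derivative_slope[OF has_vector_derivative_at_within[OF v]])
    moreover have "eventually (\<lambda>t. (1 / (t - s)) *\<^sub>R ((coord c \<circ> \<gamma>) t - (coord c \<circ> \<gamma>) s) = 0) ?F"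
      by (auto simp: eventually_at_filter sq)
    ultimately have "((\<lambda>t. 0) \<longlongrightarrow> v) ?F" by (rule Lim_transform_eventually)
    note lim0 = this
    have "?F \<noteq> bot" using lim by (simp add: trivial_limit_within)
    then have "v = 0" by (rule tendsto_unique[OF _ lim0 tendsto_const])
    then show False using geodesic_velocity_nonzero[OF \<gamma> nonconst c v] by blast
  qed
  then have "{s. \<gamma> s = q} sparse_in UNIV" by (auto simp: sparse_in_def)
  then show ?thesis using sparse_imp_countable[of UNIV "{s. \<gamma> s = q}"] by simp
qed

text \<open>
  Choose times \<open>T n\<close> tending to 0 and parameters \<open>S n\<close> in one period with \<open>y (T n) = \<gamma> (S n)\<close>; after
  passing to a subsequence, \<open>S n\<close> tends to some \<open>\<tau>\<close>. Comparing difference quotients in a chart, the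
  velocity of \<open>y\<close> at 0 is a multiple \<open>l\<close> of the nonzero velocity of \<open>\<gamma>\<close> at \<open>\<tau>\<close>, where \<open>l\<close> is the limit
  of \<open>(S n - \<tau>) / T n\<close>. So \<open>y\<close> has first-order contact at 0 with the geodesic \<open>t \<mapsto> \<gamma> (\<tau> + l t)\<close>. The
  argument allows \<open>C\<close> to cross itself at \<open>y 0\<close>.
\<close>

lemma geodesic_inside_curve:
  assumes \<gamma>: "locally_geodesic_on M \<A> g UNIV \<gamma>" and nonconst: "\<not> \<gamma> constant_on UNIV"
    and p: "p > 0" "\<And>t. \<gamma> (t + p) = \<gamma> t"
    and y: "locally_geodesic_on M \<A> g {0..1} y" and sub: "y ` {0..1} \<subseteq> range \<gamma>"
  obtains \<tau> l where "\<And>t. t \<in> {0..1} \<Longrightarrow> y t = \<gamma> (\<tau> + l * t)"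
proof -
  have c\<gamma>: "continuous_on UNIV \<gamma>" "range \<gamma> \<subseteq> M" using \<gamma> by (auto simp: locally_geodesic_on_def)
  have yc: "continuous_on {0..1} y" "y ` {0..1} \<subseteq> M" using y by (auto simp: locally_geodesic_on_def)
  interpret periodic_fun_simple \<gamma> p by standard (rule p(2))
  define tn where "tn n = 1 / real (Suc n)" for n
  have tn: "tn n \<in> {0<..1}" for n by (simp add: tn_def)
  have "\<exists>s\<in>{0..p}. y (tn n) = \<gamma> s" for n
  proof -
    have "tn n \<in> {0..1}" using tn[of n] by simp
    then obtain s where s: "y (tn n) = \<gamma> s" using sub by blast
    define k where "k = \<lfloor>s / p\<rfloor>"
    have "of_int k \<le> s / p" "s / p < of_int k + 1" by (auto simp: k_def)
    then have "s + of_int (- k) * p \<in> {0..p}" using p(1) by (simp add: field_simps)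
    moreover have "y (tn n) = \<gamma> (s + of_int (- k) * p)" using s plus_of_int[of s "- k"] by simp
    ultimately show ?thesis by blast
  qed
  then obtain sn where sn: "\<And>n. sn n \<in> {0..p}" "\<And>n. y (tn n) = \<gamma> (sn n)" by metis
  obtain \<tau> r where r: "strict_mono r" "(sn \<circ> r) \<longlonglongrightarrow> \<tau>"
    using compact_imp_seq_compact[OF compact_Icc[of 0 p]] sn(1) unfolding seq_compact_def by metis
  define T where "T n = tn (r n)" for n
  define S where "S n = sn (r n)" for n
  have "tn \<longlonglongrightarrow> 0" unfolding tn_def using lim_1_over_n[THEN LIMSEQ_Suc] by simp
  then have T0: "T \<longlonglongrightarrow> 0" using LIMSEQ_subseq_LIMSEQ[OF _ r(1)] by (simp add: T_def[abs_def] o_def)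
  have S\<tau>: "S \<longlonglongrightarrow> \<tau>" using r(2) by (simp add: S_def[abs_def] o_def)
  have T: "T n \<in> {0<..1}" for n using tn by (simp add: T_def)
  have TS: "y (T n) = \<gamma> (S n)" for n using sn(2) by (simp add: T_def S_def)
  have TW: "filterlim T (at 0 within {0..1}) sequentially"
    unfolding filterlim_at using T0 T by (auto intro!: always_eventually simp: less_imp_le) (metis less_irrefl)
  have "(y \<longlongrightarrow> y 0) (at 0 within {0..1})" using yc(1) unfolding continuous_on_def by simp
  from filterlim_compose[OF this TW] have 1: "(\<lambda>n. \<gamma> (S n)) \<longlonglongrightarrow> y 0" by (simp only: TS)
  have 2: "(\<lambda>n. \<gamma> (S n)) \<longlonglongrightarrow> \<gamma> \<tau>"
    using continuous_on_tendsto_compose[OF c\<gamma>(1) S\<tau>] by simp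
  have y0: "y 0 = \<gamma> \<tau>" by (rule LIMSEQ_unique[OF 1 2])
  have zero: "(0::real) \<in> {0..1}" by simp
  then have "y 0 \<in> M" using yc(2) by blast
  then obtain c where c: "c \<in> \<A>" "y 0 \<in> chart_dom c" using chart_exists by blast
  obtain v where v: "((coord c \<circ> y) has_vector_derivative v) (at 0 within {0..1})"
    using y c unfolding locally_geodesic_on_def by (metis zero)
  have c\<tau>: "\<gamma> \<tau> \<in> chart_dom c" using c(2) y0 by simp
  obtain w where w: "((coord c \<circ> \<gamma>) has_vector_derivative w) (at \<tau>)"
    using \<gamma> c(1) c\<tau> unfolding locally_geodesic_on_def by (metis UNIV_I)
  have w0: "w \<noteq> 0" by (rule geodesic_velocity_nonzero[OF \<gamma> nonconst c(1) c\<tau> w])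
  \<comment> \<open>the difference quotient of \<open>\<gamma>\<close> at \<open>\<tau>\<close>, extended continuously: the parameters \<open>S n\<close> may equal \<open>\<tau>\<close>\<close>
  define h where "h s = (if s = \<tau> then w else (1 / (s - \<tau>)) *\<^sub>R ((coord c \<circ> \<gamma>) s - (coord c \<circ> \<gamma>) \<tau>))" for s
  have "(h \<longlongrightarrow> w) (at \<tau>)"
    using has_vector_derivative_slope[OF w]
    by (rule Lim_transform_eventually) (auto simp: h_def eventually_at_filter)
  then have "isCont h \<tau>" by (simp add: isCont_def h_def)
  from isCont_tendsto_compose[OF this S\<tau>] have hS: "(\<lambda>n. h (S n)) \<longlonglongrightarrow> w"
    by (simp add: h_def[of \<tau>])
  define q where "q n = (S n - \<tau>) / T n" for n
  have qh: "q n *\<^sub>R h (S n) = (1 / (T n - 0)) *\<^sub>R ((coord c \<circ> y) (T n) - (coord c \<circ> y) 0)" for n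
    using TS[of n] y0 by (simp add: q_def h_def)
  have qv: "(\<lambda>n. q n *\<^sub>R h (S n)) \<longlonglongrightarrow> v"
    unfolding qh by (rule filterlim_compose[OF has_vector_derivative_slope[OF v] TW])
  have hw: "(\<lambda>n. h (S n) \<bullet> w) \<longlonglongrightarrow> w \<bullet> w" by (intro tendsto_intros hS)
  have ww: "w \<bullet> w \<noteq> 0" using w0 by simp
  \<comment> \<open>the quotients \<open>q n\<close> converge because their multiples of the vectors \<open>h (S n)\<close> do, and these tend to \<open>w \<noteq> 0\<close>\<close>
  have "(\<lambda>n. (q n *\<^sub>R h (S n)) \<bullet> w / (h (S n) \<bullet> w)) \<longlonglongrightarrow> v \<bullet> w / (w \<bullet> w)"
    by (intro tendsto_intros qv hw ww)
  moreover have "eventually (\<lambda>n. h (S n) \<bullet> w \<noteq> 0) sequentially"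
    using tendsto_imp_eventually_ne[OF hw ww] .
  then have "eventually (\<lambda>n. (q n *\<^sub>R h (S n)) \<bullet> w / (h (S n) \<bullet> w) = q n) sequentially"
    by eventually_elim simp
  ultimately have ql: "q \<longlonglongrightarrow> v \<bullet> w / (w \<bullet> w)" by (rule Lim_transform_eventually)
  define l where "l = v \<bullet> w / (w \<bullet> w)"
  have "(\<lambda>n. q n *\<^sub>R h (S n)) \<longlonglongrightarrow> l *\<^sub>R w" unfolding l_def by (intro tendsto_intros ql hS)
  then have vl: "v = l *\<^sub>R w" by (rule LIMSEQ_unique[OF qv])
  have z: "locally_geodesic_on M \<A> g {0..1} (\<lambda>t. \<gamma> (\<tau> + l * t))" by (rule geodesic_reparam[OF \<gamma>])
  have "first_order_contact {0..1} y (\<lambda>t. \<gamma> (\<tau> + l * t)) 0"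
  proof (rule first_order_contactI[where y = y and z = "\<lambda>t. \<gamma> (\<tau> + l * t)", OF yc _ _ zero c _ v])
    have "((\<lambda>t. \<tau> + l * t) has_real_derivative l) (at 0 within {0..1})"
      by (auto intro!: derivative_eq_intros)
    from has_vector_derivative_reparam[OF _ this, of "coord c \<circ> \<gamma>" w] w
    show "((coord c \<circ> (\<lambda>t. \<gamma> (\<tau> + l * t))) has_vector_derivative v) (at 0 within {0..1})"
      by (simp add: o_def vl)
  qed (use z y0 in \<open>auto simp: locally_geodesic_on_def\<close>)
  from geodesic_uniqueness[OF zero_less_one y z zero this] show thesis using that by blast
qed

section \<open>Curves of small energy along a geodesic\<close>

text \<open>
  Along the curve \<open>\<gamma> \<circ> \<phi>\<close> the covariant acceleration is \<open>\<phi>''\<close> times the velocity of \<open>\<gamma>\<close>, since the terms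
  with \<open>(\<phi>')\<^sup>2\<close> form the geodesic equation. The number \<open>G\<close> is the squared speed of \<open>\<gamma>\<close>.
\<close>

lemma energy_along_geodesic:
  assumes \<gamma>: "locally_geodesic_on M \<A> g UNIV \<gamma>"
    and G: "\<And>c s v. c \<in> \<A> \<Longrightarrow> \<gamma> s \<in> chart_dom c \<Longrightarrow> ((coord c \<circ> \<gamma>) has_vector_derivative v) (at s) \<Longrightarrow>
      g c (coord c (\<gamma> s)) v v = G"
    and \<phi>: "\<And>t. (\<phi> has_real_derivative \<phi>' t) (at t)" "\<And>t. (\<phi>' has_real_derivative k) (at t)"
  shows "W22_curve M \<A> (\<lambda>t. \<gamma> (\<phi> t))" "spline_energy \<A> g (\<lambda>t. \<gamma> (\<phi> t)) = ennreal (k\<^sup>2 * G)"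
proof -
  let ?y = "\<lambda>t. \<gamma> (\<phi> t)"
  have c\<gamma>: "continuous_on UNIV \<gamma>" "range \<gamma> \<subseteq> M" using \<gamma> by (auto simp: locally_geodesic_on_def)
  have c\<phi>: "continuous_on X \<phi>" "continuous_on X \<phi>'" for X
    by (rule DERIV_continuous_on[OF has_field_derivative_at_within[OF \<phi>(1)]]
          DERIV_continuous_on[OF has_field_derivative_at_within[OF \<phi>(2)]])+
  have cy: "continuous_on X ?y" for X by (rule continuous_on_compose2[OF c\<gamma>(1) c\<phi>(1)]) simp
  have yM: "?y ` X \<subseteq> M" for X using c\<gamma>(2) by blast
  have local: "\<exists>V w. continuous_on {a..b} V \<and> continuous_on {a..b} w \<and> continuous_on {a..b} (coord c \<circ> ?y) \<and>
      has_weak_derivative a b (coord c \<circ> ?y) V \<and> has_weak_derivative a b V w \<and>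
      (\<forall>t\<in>{a..b}. k\<^sup>2 * G = g c (coord c (?y t)) (cov_deriv g c (coord c (?y t)) (V t) (V t) (w t))
                                                  (cov_deriv g c (coord c (?y t)) (V t) (V t) (w t)))"
    if c: "c \<in> \<A>" and ab: "a < b" and sub: "?y ` {a..b} \<subseteq> chart_dom c" for c a b
  proof -
    note lc = chart_local_metric[OF c]
    obtain v acc where va: "\<And>t. \<gamma> t \<in> chart_dom c \<Longrightarrow>
        ((coord c \<circ> \<gamma>) has_vector_derivative v t) (at t) \<and>
        (v has_vector_derivative acc t) (at t) \<and> cov_deriv g c (coord c (\<gamma> t)) (v t) (v t) (acc t) = 0"
      using \<gamma> c unfolding locally_geodesic_on_def by (metis UNIV_I)
    have dom: "\<gamma> (\<phi> t) \<in> chart_dom c" if "t \<in> {a..b}" for t using sub that by blast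
    have acceq: "acc t = - christoffel g c (coord c (\<gamma> t)) (v t) (v t)" if "\<gamma> t \<in> chart_dom c" for t
      using va[OF that] by (simp add: cov_deriv_def eq_neg_iff_add_eq_0)
    define V where "V t = \<phi>' t *\<^sub>R v (\<phi> t)" for t
    define w where "w t = k *\<^sub>R v (\<phi> t) + (\<phi>' t)\<^sup>2 *\<^sub>R acc (\<phi> t)" for t
    have cx: "continuous_on {a..b} (coord c \<circ> ?y)" by (rule coord_curve_continuous[OF cy c sub])
    have d\<phi>: "(\<phi> has_real_derivative \<phi>' t) (at t within X)" "(\<phi>' has_real_derivative k) (at t within X)" for t X
      by (rule has_field_derivative_at_within[OF \<phi>(1)] has_field_derivative_at_within[OF \<phi>(2)])+
    have dv: "((\<lambda>t. v (\<phi> t)) has_vector_derivative \<phi>' t *\<^sub>R acc (\<phi> t)) (at t within {a..b})" if "t \<in> {a..b}" for t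
      by (rule has_vector_derivative_reparam[OF _ d\<phi>(1)]) (use va[OF dom[OF that]] in blast)
    have cv: "continuous_on {a..b} (\<lambda>t. v (\<phi> t))"
      by (rule continuous_on_vector_derivative[OF dv])
    have "continuous_on {a..b} (\<lambda>t. - christoffel g c ((coord c \<circ> ?y) t) (v (\<phi> t)) (v (\<phi> t)))"
      by (intro continuous_on_minus christoffel_continuous_on[OF lc cx cv]) (use sub in force)
    then have cacc: "continuous_on {a..b} (\<lambda>t. acc (\<phi> t))"
      by (rule continuous_on_eq) (simp add: acceq dom)
    have dx: "((coord c \<circ> ?y) has_vector_derivative V t) (at t within {a..b})" if "t \<in> {a..b}" for t
    proof -
      have "((coord c \<circ> \<gamma>) has_vector_derivative v (\<phi> t)) (at (\<phi> t))" using va[OF dom[OF that]] by blast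
      from has_vector_derivative_reparam[OF this d\<phi>(1)] show ?thesis by (simp add: o_def V_def)
    qed
    have dV: "(V has_vector_derivative w t) (at t within {a..b})" if "t \<in> {a..b}" for t
    proof -
      have "(V has_vector_derivative \<phi>' t *\<^sub>R (\<phi>' t *\<^sub>R acc (\<phi> t)) + k *\<^sub>R v (\<phi> t)) (at t within {a..b})"
        unfolding V_def[abs_def] by (rule has_vector_derivative_scaleR[OF d\<phi>(2) dv[OF that]])
      then show ?thesis by (simp add: w_def power2_eq_square add.commute)
    qed
    have cV: "continuous_on {a..b} V" unfolding V_def by (intro continuous_intros c\<phi> cv)
    have cw: "continuous_on {a..b} w" unfolding w_def by (intro continuous_intros c\<phi> cv cacc)
    have "has_weak_derivative a b (coord c \<circ> ?y) V"
      by (rule primitive_on_has_weak_derivative[OF primitive_on_C1[OF dx cV] ab])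
    moreover have "has_weak_derivative a b V w"
      by (rule primitive_on_has_weak_derivative[OF primitive_on_C1[OF dV cw] ab])
    moreover have "k\<^sup>2 * G = g c (coord c (?y t)) (cov_deriv g c (coord c (?y t)) (V t) (V t) (w t))
                                                  (cov_deriv g c (coord c (?y t)) (V t) (V t) (w t))"
      if t: "t \<in> {a..b}" for t
    proof -
      have xU: "coord c (?y t) \<in> coord c ` chart_dom c" using dom[OF t] by blast
      have "cov_deriv g c (coord c (?y t)) (V t) (V t) (w t) = k *\<^sub>R v (\<phi> t)"
        using christoffel_scale[OF lc xU, of "\<phi>' t" "v (\<phi> t)"] acceq[OF dom[OF t]]
        by (simp add: cov_deriv_def V_def w_def)
      moreover have "g c (coord c (?y t)) (v (\<phi> t)) (v (\<phi> t)) = G"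
        using G[OF c dom[OF t]] va[OF dom[OF t]] by blast
      ultimately show ?thesis
        using linear_scale[OF lm_linear(1)[OF lc xU]] linear_scale[OF lm_linear(2)[OF lc xU]]
        by (simp add: power2_eq_square)
    qed
    ultimately show ?thesis
      by (intro exI[of _ V] exI[of _ w] conjI ballI cV cw cx)
  qed
  show W: "W22_curve M \<A> ?y"
    unfolding W22_curve_def
  proof (intro conjI cy yM ballI allI impI, elim conjE)
    fix c a b assume c: "c \<in> \<A>" and ab: "a < b" and sub: "?y ` {a..b} \<subseteq> chart_dom c"
    from local[OF c ab sub] obtain V w where "continuous_on {a..b} V" "continuous_on {a..b} w"
      "continuous_on {a..b} (coord c \<circ> ?y)"
      "has_weak_derivative a b (coord c \<circ> ?y) V" "has_weak_derivative a b V w"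
      by (elim exE conjE) (rule that)
    then show "W22_on a b (coord c \<circ> ?y)"
      unfolding W22_on_def by (intro exI[of _ V] exI[of _ w] conjI L2_on_continuous)
  qed
  have I: "spline_integrand \<A> g ?y (\<lambda>_. k\<^sup>2 * G)"
    unfolding spline_integrand_def
  proof (intro ballI allI impI, elim conjE)
    fix c a b assume c: "c \<in> \<A>" and ab: "a < b" and sub: "?y ` {a..b} \<subseteq> chart_dom c"
    from local[OF c ab sub] obtain V w where Vw: "has_weak_derivative a b (coord c \<circ> ?y) V" "has_weak_derivative a b V w"
      "\<forall>t\<in>{a..b}. k\<^sup>2 * G = g c (coord c (?y t)) (cov_deriv g c (coord c (?y t)) (V t) (V t) (w t))
                                                  (cov_deriv g c (coord c (?y t)) (V t) (V t) (w t))"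
      by (elim exE conjE) (rule that)
    show "\<exists>v w. has_weak_derivative a b (coord c \<circ> ?y) v \<and> has_weak_derivative a b v w \<and>
           (AE t in lebesgue. t \<in> {a<..<b} \<longrightarrow>
              k\<^sup>2 * G = g c (coord c (?y t)) (cov_deriv g c (coord c (?y t)) (v t) (v t) (w t))
                                        (cov_deriv g c (coord c (?y t)) (v t) (v t) (w t)))"
      by (rule exI[of _ V], rule exI[of _ w], intro conjI Vw(1,2) AE_I2 impI Vw(3)[rule_format]) auto
  qed
  then have "spline_integrand \<A> g ?y (SOME f. spline_integrand \<A> g ?y f)"
    by (rule someI[of "spline_integrand \<A> g ?y"])
  from spline_integrand_unique[OF cy yM this I]
  have "AE t in lebesgue. ennreal ((SOME f. spline_integrand \<A> g ?y f) t) * indicator {0..1} t = ennreal (k\<^sup>2 * G) * indicator {0..1} t"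
    by eventually_elim (auto simp: indicator_def)
  then have "spline_energy \<A> g ?y = (\<integral>\<^sup>+ t. ennreal (k\<^sup>2 * G) * indicator {0..1::real} t \<partial>lebesgue)"
    unfolding spline_energy_def
    by (rule nn_integral_cong_AE)
  also have "\<dots> = ennreal (k\<^sup>2 * G)" by (simp add: nn_integral_cmult_indicator)
  finally show "spline_energy \<A> g ?y = ennreal (k\<^sup>2 * G)" .
qed

lemma geodesic_loops_small_energy:
  assumes \<gamma>: "locally_geodesic_on M \<A> g UNIV \<gamma>" and p: "p > 0" "\<And>t. \<gamma> (t + p) = \<gamma> t"
    and \<theta>: "0 < \<theta>" "\<theta> < 1" "\<theta> \<notin> \<rat>" and \<epsilon>: "\<epsilon> > 0"
  obtains y where "W22_curve M \<A> y" "y 0 = \<gamma> r" "y \<theta> = \<gamma> \<sigma>" "y 1 = \<gamma> r"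
    "spline_energy \<A> g y < ennreal \<epsilon>"
proof -
  interpret periodic_fun_simple \<gamma> p by standard (rule p(2))
  obtain G where G: "\<And>c s v. c \<in> \<A> \<Longrightarrow> \<gamma> s \<in> chart_dom c \<Longrightarrow> ((coord c \<circ> \<gamma>) has_vector_derivative v) (at s) \<Longrightarrow>
    g c (coord c (\<gamma> s)) v v = G"
    using geodesic_constant_speed[OF \<gamma>] by metis
  define D where "D = \<theta> * (1 - \<theta>)"
  have D: "D > 0" using \<theta> by (simp add: D_def)
  \<comment> \<open>the tolerance that makes \<open>K\<^sup>2 (\<bar>G\<bar> + 1) < \<epsilon>\<close> for the constant \<open>K = \<phi>''\<close> below\<close>
  define \<eta> where "\<eta> = D / (2 * p) * sqrt (\<epsilon> / (\<bar>G\<bar> + 1))"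
  have "\<eta> > 0" using D p(1) \<epsilon> by (simp add: \<eta>_def add_nonneg_pos)
  then obtain k :: nat and m :: int where km: "\<bar>(\<sigma> - r) / p + m - k * \<theta>\<bar> < \<eta>"
    using irrational_multiples_dense[OF \<theta>(3)] by metis
  \<comment> \<open>the defect at \<open>\<theta>\<close> of the affine function from \<open>r\<close> to \<open>r + k p\<close>\<close>
  define e where "e = \<sigma> + of_int m * p - r - real k * p * \<theta>"
  define K where "K = - 2 * e / D"
  have "e = p * ((\<sigma> - r) / p + m - k * \<theta>)" using p(1) by (simp add: e_def field_simps)
  then have "\<bar>e\<bar> = p * \<bar>(\<sigma> - r) / p + m - k * \<theta>\<bar>" using p(1) by (simp add: abs_mult)
  also have "\<dots> < p * \<eta>" using km p(1) by simp
  finally have "\<bar>e\<bar> < p * \<eta>" .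
  then have "2 * \<bar>e\<bar> / D < 2 * (p * \<eta>) / D" using D by (simp add: divide_strict_right_mono)
  also have "\<dots> = sqrt (\<epsilon> / (\<bar>G\<bar> + 1))" using D p(1) by (simp add: \<eta>_def)
  finally have Kb: "\<bar>K\<bar> < sqrt (\<epsilon> / (\<bar>G\<bar> + 1))" using D by (simp add: K_def abs_mult)
  have "K\<^sup>2 < (sqrt (\<epsilon> / (\<bar>G\<bar> + 1)))\<^sup>2"
    using power_strict_mono[OF Kb, of 2] by simp
  also have "\<dots> = \<epsilon> / (\<bar>G\<bar> + 1)" using \<epsilon> by simp
  finally have K2: "K\<^sup>2 * (\<bar>G\<bar> + 1) < \<epsilon>" by (simp add: pos_less_divide_eq add_nonneg_pos)
  have "K\<^sup>2 * G \<le> K\<^sup>2 * (\<bar>G\<bar> + 1)" by (intro mult_left_mono) auto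
  with K2 have small: "K\<^sup>2 * G < \<epsilon>" by simp
  define \<phi> where "\<phi> t = r + real k * p * t + e / D * (t * (1 - t))" for t
  define \<phi>' where "\<phi>' t = real k * p + e / D * (1 - 2 * t)" for t
  have d1: "(\<phi> has_real_derivative \<phi>' t) (at t)" for t
    unfolding \<phi>_def[abs_def] \<phi>'_def using D by (auto intro!: derivative_eq_intros simp: algebra_simps)
  have d2: "(\<phi>' has_real_derivative K) (at t)" for t
    unfolding \<phi>'_def[abs_def] K_def using D by (auto intro!: derivative_eq_intros simp: field_simps)
  have W: "W22_curve M \<A> (\<lambda>t. \<gamma> (\<phi> t))"
    by (rule energy_along_geodesic(1)[OF \<gamma> G d1 d2])
  have E: "spline_energy \<A> g (\<lambda>t. \<gamma> (\<phi> t)) = ennreal (K\<^sup>2 * G)"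
    by (rule energy_along_geodesic(2)[OF \<gamma> G d1 d2])
  show thesis
  proof (rule that[OF W])
    show "\<gamma> (\<phi> 0) = \<gamma> r" by (simp add: \<phi>_def)
    show "\<gamma> (\<phi> 1) = \<gamma> r" using plus_of_nat[of r k] by (simp add: \<phi>_def)
    have "\<phi> \<theta> = \<sigma> + of_int m * p" using D by (simp add: \<phi>_def D_def[symmetric] e_def)
    then show "\<gamma> (\<phi> \<theta>) = \<gamma> \<sigma>" using plus_of_int[of \<sigma> m] by simp
    show "spline_energy \<A> g (\<lambda>t. \<gamma> (\<phi> t)) < ennreal \<epsilon>"
      using ennreal_lessI[OF \<epsilon> small] E by simp
  qed
qed

end

section \<open>Nonexistence of minimizers\<close>

theorem lemma2p15:
  fixes M :: "'m::{t2_space, second_countable_topology} set"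
    and \<A> :: "('m, 'e::euclidean_space) chart set"
    and g :: "('m, 'e) metric"
    and C :: "'m set"
    and y1 :: 'm
  assumes "riemannian_manifold M \<A> g"
    and "closed_geodesic_curve M \<A> g C"
    and "y1 \<in> C"
    and "\<And>y. locally_geodesic_on M \<A> g {0..1} y \<Longrightarrow> y 0 = y1 \<Longrightarrow> y 1 = y1 \<Longrightarrow> y ` {0..1} \<subseteq> C"
  shows "\<exists>(I::nat) (t::nat \<Rightarrow> real) (ybar::nat \<Rightarrow> 'm).
           I > 2 \<and> 0 \<le> t 1 \<and> strict_mono_on {1..I} t \<and> t I \<le> 1 \<and> (\<forall>i\<in>{1..I}. ybar i \<in> M) \<and>
           \<not> (\<exists>y. is_arg_min (spline_energy \<A> g)
                    (\<lambda>y. W22_curve M \<A> y \<and> (\<forall>i\<in>{1..I}. y (t i) = ybar i)) y)"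
proof -
  interpret riemannian M \<A> g by unfold_locales (rule assms(1))
  obtain \<gamma> p where \<gamma>: "locally_geodesic_on M \<A> g UNIV \<gamma>" and p: "p > 0" "\<And>t. \<gamma> (t + p) = \<gamma> t"
    and nonconst: "\<not> \<gamma> constant_on UNIV" and C: "C = range \<gamma>"
    using assms(2) unfolding closed_geodesic_curve_def by blast
  obtain r where r: "\<gamma> r = y1" using assms(3) C by blast
  have \<gamma>M: "\<gamma> s \<in> M" for s using \<gamma> unfolding locally_geodesic_on_def by blast
  have "uncountable ({0<..<1::real} - \<rat>)"
    by (intro uncountable_minus_countable countable_rat) (simp add: uncountable_open_interval)
  then obtain \<theta> :: real where \<theta>: "0 < \<theta>" "\<theta> < 1" "\<theta> \<notin> \<rat>"
    by (metis DiffE countable_empty ex_in_conv greaterThanLessThan_iff)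
  define R where "R = {s. \<gamma> s = y1}"
  \<comment> \<open>all possible values at \<open>\<theta>\<close> of loops at \<open>y1\<close> that are affine reparametrizations of \<open>\<gamma>\<close>\<close>
  define B where "B = (\<lambda>(s, s'). \<gamma> (s + (s' - s) * \<theta>)) ` (R \<times> R)"
  have "countable R" unfolding R_def by (rule geodesic_fibre_countable[OF \<gamma> nonconst])
  then have "countable B" unfolding B_def by (intro countable_image countable_SIGMA)
  then have "countable (\<Union>b\<in>B. {s. \<gamma> s = b})"
    by (intro countable_UN geodesic_fibre_countable[OF \<gamma> nonconst])
  then have "(\<Union>b\<in>B. {s. \<gamma> s = b}) \<noteq> UNIV" using uncountable_UNIV_real by metis
  then obtain \<sigma> where \<sigma>: "\<gamma> \<sigma> \<notin> B" by blast
  define t :: "nat \<Rightarrow> real" where "t i = (if i = 1 then 0 else if i = 2 then \<theta> else 1)" for i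
  define ybar where "ybar i = (if i = 2 then \<gamma> \<sigma> else y1)" for i :: nat
  define P where "P y \<longleftrightarrow> W22_curve M \<A> y \<and> (\<forall>i\<in>{1..3}. y (t i) = ybar i)" for y
  have three: "{1..3} = {1, 2, 3::nat}" by auto
  have P: "P y \<longleftrightarrow> W22_curve M \<A> y \<and> y 0 = y1 \<and> y \<theta> = \<gamma> \<sigma> \<and> y 1 = y1" for y
    unfolding P_def three by (simp add: t_def ybar_def)
  have "\<not> is_arg_min (spline_energy \<A> g) P y" for y
  proof
    assume "is_arg_min (spline_energy \<A> g) P y"
    then have y: "W22_curve M \<A> y" "y 0 = y1" "y \<theta> = \<gamma> \<sigma>" "y 1 = y1"
      and min: "\<And>z. P z \<Longrightarrow> \<not> spline_energy \<A> g z < spline_energy \<A> g y"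
      unfolding is_arg_min_def P by blast+
    have "spline_energy \<A> g y = 0"
    proof (rule ccontr)
      assume "spline_energy \<A> g y \<noteq> 0"
      then have "0 < spline_energy \<A> g y" by (simp add: zero_less_iff_neq_zero)
      then obtain e where e: "0 < e" "e < spline_energy \<A> g y" using dense by blast
      then have "e \<noteq> top" by auto
      then obtain \<epsilon> where \<epsilon>: "e = ennreal \<epsilon>" "\<epsilon> > 0"
        using e(1) by (cases e) (auto simp: ennreal_less_zero_iff)
      obtain z where "W22_curve M \<A> z" "z 0 = \<gamma> r" "z \<theta> = \<gamma> \<sigma>" "z 1 = \<gamma> r"
        "spline_energy \<A> g z < ennreal \<epsilon>"
        using geodesic_loops_small_energy[OF \<gamma> p \<theta> \<epsilon>(2)] by metis
      then show False using min[of z] e(2) \<epsilon>(1) r unfolding P by (metis less_trans)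
    qed
    then have geo: "locally_geodesic_on M \<A> g {0..1} y" by (rule zero_energy_imp_geodesic[OF y(1)])
    then have "y ` {0..1} \<subseteq> range \<gamma>" using assms(4) y(2,4) C by blast
    then obtain \<tau> l where yl: "\<And>t. t \<in> {0..1} \<Longrightarrow> y t = \<gamma> (\<tau> + l * t)"
      using geodesic_inside_curve[OF \<gamma> nonconst p geo] by metis
    have "\<tau> \<in> R" "\<tau> + l \<in> R" using yl[of 0] yl[of 1] y(2,4) by (auto simp: R_def)
    moreover have "\<gamma> \<sigma> = \<gamma> (\<tau> + ((\<tau> + l) - \<tau>) * \<theta>)" using yl[of \<theta>] y(3) \<theta> by simp
    ultimately have "\<gamma> \<sigma> \<in> B" unfolding B_def by (intro image_eqI[of _ _ "(\<tau>, \<tau> + l)"]) auto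
    then show False using \<sigma> by blast
  qed
  moreover have "strict_mono_on {1..3} t"
    using \<theta> by (auto simp: strict_mono_on_def t_def)
  moreover have "\<forall>i\<in>{1..3}. ybar i \<in> M" using \<gamma>M r by (auto simp: ybar_def)
  ultimately show ?thesis
    unfolding P_def[abs_def] by (intro exI[of _ "3::nat"] exI[of _ t] exI[of _ ybar]) (simp add: t_def)
qed

end
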